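(* (1) Let $N_1,N_2,N_3$ be pairwise relatively prime integers greater than one. Then the weights can be "heard": if $N_1',N_2',N_3'$ are also pairwise relatively prime integers greater than one and the weighted projective spaces $X(N_1,N_2,N_3)$ and $X(N_1',N_2',N_3')$ have the same Laplace spectrum (with multiplicities), then $\{N_1,N_2,N_3\}=\{N_1',N_2',N_3'\}$. (2) Let $N_1,N_2,N_3,N_4$ be pairwise relatively prime integers greater than one. Then all the pairwise sums can be "heard": if $N_1',N_2',N_3',N_4'$ are also pairwise relatively prime integers greater than one and $X(N_1,\dots,N_4)$ and $X(N_1',\dots,N_4')$ have the same Laplace spectrum (with multiplicities), then the multisets $\{N_i+N_j : i<j\}$ and $\{N_i'+N_j' : i<j\}$ coincide. Moreover, the multiset of pairwise sums determines at most two choices of the weights: for any multiset $M$ there are at most two sets $\{N_1,N_2,N_3,N_4\}$ of pairwise relatively prime integers greater than one whose multiset of pairwise sums $\{N_i+N_j : i<j\}$ equals $M$.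
   Context: For positive integers $N_1,\dots,N_d$ (the weights), $X(N_1,\dots,N_d)=S^{2d-1}/S^1$ is the weighted projective space, where $S^{2d-1}\subset\mathbb{C}^d$ is the unit sphere with its round metric and $S^1$ acts by $e^{it}\cdot(z_1,\dots,z_d)=(e^{iN_1t}z_1,\dots,e^{iN_dt}z_d)$. It is regarded as a real Riemannian orbifold of dimension $2d-2$. The Laplace operator of $S^{2d-1}$ maps the space $C^\infty(S^{2d-1})^{S^1}$ of $S^1$-invariant smooth functions to itself, and via the identification $C^\infty(X)=C^\infty(S^{2d-1})^{S^1}$ it defines the Laplace operator on $X$; the Laplace spectrum of $X$ is the multiset of eigenvalues of this operator. To "hear" a quantity means that it is determined by the Laplace spectrum. *)

theory Defs
  imports "HOL-Analysis.Analysis" "HOL-Library.Function_Algebras" "HOL-Library.Multiset"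
begin

section \<open>Smooth functions\<close>

primrec k_smooth_on ::
    "nat \<Rightarrow> 'a::euclidean_space set \<Rightarrow> ('a \<Rightarrow> 'b::real_normed_vector) \<Rightarrow> bool" where
  "k_smooth_on 0 U f \<longleftrightarrow> continuous_on U f"
| "k_smooth_on (Suc k) U f \<longleftrightarrow>
     (\<forall>x\<in>U. f differentiable (at x)) \<and>
     (\<forall>v. k_smooth_on k U (\<lambda>x. frechet_derivative f (at x) v))"

text \<open>The derivatives are taken at points of the ambient space, so these notions are the usual
  ones only for open \<open>U\<close>.\<close>

definition smooth_on ::
    "'a::euclidean_space set \<Rightarrow> ('a \<Rightarrow> 'b::real_normed_vector) \<Rightarrow> bool" where
  "smooth_on U f \<longleftrightarrow> (\<forall>k. k_smooth_on k U f)"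

section \<open>The Laplace operator of the round unit sphere\<close>

text \<open>A function on the sphere is represented by its extension by zero to the ambient space,
  so that functions that agree on the sphere are equal.\<close>

definition smooth_sphere_functions :: "('a::euclidean_space \<Rightarrow> real) set" where
  "smooth_sphere_functions =
     {f. (\<forall>x. x \<notin> sphere 0 1 \<longrightarrow> f x = 0) \<and>
         (\<exists>U F. open U \<and> sphere 0 1 \<subseteq> U \<and> smooth_on U F \<and> (\<forall>x\<in>sphere 0 1. F x = f x))}"

text \<open>The map \<open>sgn\<close> sends \<open>y\<close> to \<open>y /\<^sub>R norm y\<close>; composing with it extends an object on the
  sphere to a neighbourhood of the sphere, constantly along rays.\<close>

definition ray_extension :: "('a::euclidean_space \<Rightarrow> 'b) \<Rightarrow> 'a \<Rightarrow> 'b" where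
  "ray_extension f = (\<lambda>y. f (sgn y))"

text \<open>The derivative of \<open>ray_extension f\<close> at a point \<open>x\<close> of the sphere vanishes on the normal
  vector \<open>x\<close> and is the differential of \<open>f\<close> on the tangent space, the orthogonal complement of
  \<open>x\<close>. Hence the vector below is tangent to the sphere and is the Riemannian gradient of \<open>f\<close>.\<close>

definition sphere_gradient :: "('a::euclidean_space \<Rightarrow> real) \<Rightarrow> 'a \<Rightarrow> 'a" where
  "sphere_gradient f x =
     (\<Sum>b\<in>Basis. frechet_derivative (ray_extension f) (at x) b *\<^sub>R b)"

text \<open>The divergence of a tangent vector field \<open>X\<close> is the trace of its Levi-Civita derivative,
  i.e. of the tangential part of its derivative. The trace may be taken over the whole ambient
  space, since the derivative of \<open>ray_extension X\<close> vanishes in the normal direction.\<close>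

definition sphere_divergence :: "('a::euclidean_space \<Rightarrow> 'a) \<Rightarrow> 'a \<Rightarrow> real" where
  "sphere_divergence X x =
     (\<Sum>b\<in>Basis. frechet_derivative (ray_extension X) (at x) b \<bullet> b)"

text \<open>The sign makes the eigenvalues non-negative.\<close>

definition sphere_laplacian :: "('a::euclidean_space \<Rightarrow> real) \<Rightarrow> 'a \<Rightarrow> real" where
  "sphere_laplacian f x = - sphere_divergence (sphere_gradient f) x"

section \<open>Weighted projective spaces\<close>

definition weighted_rotation :: "('n::finite \<Rightarrow> nat) \<Rightarrow> real \<Rightarrow> complex ^ 'n \<Rightarrow> complex ^ 'n" where
  "weighted_rotation N t z = (\<chi> i. cis (real (N i) * t) * z $ i)"

text \<open>Smooth functions on the weighted projective space, that is, smooth functions on the unit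
  sphere that are invariant under the circle action.\<close>

definition wps_smooth_functions :: "('n::finite \<Rightarrow> nat) \<Rightarrow> (complex ^ 'n \<Rightarrow> real) set" where
  "wps_smooth_functions N =
     {f \<in> smooth_sphere_functions. \<forall>t. \<forall>z\<in>sphere 0 1. f (weighted_rotation N t z) = f z}"

definition wps_eigenspace :: "('n::finite \<Rightarrow> nat) \<Rightarrow> real \<Rightarrow> (complex ^ 'n \<Rightarrow> real) set" where
  "wps_eigenspace N \<mu> =
     {f \<in> wps_smooth_functions N. \<forall>z\<in>sphere 0 1. sphere_laplacian f z = \<mu> * f z}"

interpretation real_functions: vector_space "\<lambda>(c::real) (f::'a \<Rightarrow> real) x. c * f x"
  by unfold_locales (auto simp: algebra_simps fun_eq_iff)

text \<open>The Laplace spectrum is an infinite multiset, given by its multiplicity function; a real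
  number is an eigenvalue iff its multiplicity is positive. All eigenspaces are
  finite-dimensional, so the convention that an infinite dimension is \<open>0\<close> plays no role.\<close>

definition laplace_spectrum :: "('n::finite \<Rightarrow> nat) \<Rightarrow> real \<Rightarrow> nat" where
  "laplace_spectrum N \<mu> = real_functions.dim (wps_eigenspace N \<mu>)"

section \<open>Weights\<close>

definition coprime_weights :: "('n::finite \<Rightarrow> nat) \<Rightarrow> bool" where
  "coprime_weights N \<longleftrightarrow> (\<forall>i. N i > 1) \<and> (\<forall>i j. i \<noteq> j \<longrightarrow> coprime (N i) (N j))"

definition pairwise_sums :: "('n::{finite,linorder} \<Rightarrow> nat) \<Rightarrow> nat multiset" where
  "pairwise_sums N = image_mset (\<lambda>(i, j). N i + N j) (mset_set {(i, j). i < j})"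

end

theory Submission
  imports Defs "HOL-Complex_Analysis.Complex_Analysis" "HOL-Library.Real_Mod"
begin

text \<open>
  The spherical Laplacian is self-adjoint and acts on homogeneous functions of degree \<open>k\<close> like the
  number \<open>k (k + 2 d - 2)\<close>, up to the Euclidean Laplacian. By density of the polynomials, the invariant eigenfunctions
  are the restrictions of invariant harmonic polynomials, and the spectrum is equivalent to knowing for
  every degree the number of monomials in \<open>z\<close> and \<open>cnj z\<close> that are invariant under the circle.

  The generating function of these numbers is a contour integral over the unit circle, hence a sum of
  residues. If an integer \<open>m \<ge> 3\<close> divides sums of two weights but no difference, the generating
  function has a simple pole at the primitive \<open>m\<close>-th roots of unity, so that the largest sums can be
  heard one after the other. Once two weight systems agree in all but few sums, comparing the
  leading coefficients at \<open>1\<close>, which are monotone along the remaining one-parameter families,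
  forces equality.
\<close>

section \<open>Calculus of smooth functions\<close>

text \<open>Inner products on the sphere are integrals over a spherical shell with a radial cutoff,
  so self-adjointness follows from translation invariance of Lebesgue measure. On the invariant
  polynomials of degree k, the Laplacian minus the k-th eigenvalue lowers the degree by two. On
  degree k - 2 it is invertible, since the eigenvalues are distinct. So each eigenspace is a
  complement of the polynomials of degree k - 2, and its dimension is a difference of two monomial
  counts. A pole reveals a sum m only while m is large against the other sums and differences, since
  a small m may divide several of them. The leading coefficient at 1 replaces it for the smallest
  sum of three weights, and in general for the smaller of the two middle sums a + e and b + c of
  four weights a < b < c < e. The remaining two sums follow from (a + b) + (c + e) = (a + c) + (b +
  e) = (a + e) + (b + c). The six sums of four weights do not tell which middle sum is which. The
  complement w -> h - w, with h half of the total, interchanges the two; this is the source of the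
  two choices of weights.\<close>

lemma k_smooth_on_cong:
  fixes f g :: "'a::euclidean_space \<Rightarrow> 'b::real_normed_vector"
  assumes U: "open U" and eq: "\<And>x. x \<in> U \<Longrightarrow> f x = g x" and f: "k_smooth_on k U f"
  shows "k_smooth_on k U g"
  using eq f
proof (induction k arbitrary: f g)
  case 0
  then show ?case by (simp add: continuous_on_cong[of U U f g])
next
  case (Suc k)
  have diff: "g differentiable at x" if x: "x \<in> U" for x
    using Suc.prems that U
    by (metis has_derivative_transform_within_open differentiable_def k_smooth_on.simps(2))
  have fr: "frechet_derivative f (at x) = frechet_derivative g (at x)" if "x \<in> U" for x
    using frechet_derivative_transform_within_open[of f x U g] Suc.prems that U by auto
  have "k_smooth_on k U (\<lambda>x. frechet_derivative g (at x) v)" for v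
    by (rule Suc.IH[of "\<lambda>x. frechet_derivative f (at x) v"]) (use fr Suc.prems in auto)
  with diff show ?case by simp
qed

text \<open>An explicit derivative \<open>f'\<close> is easier to differentiate again than
  \<open>frechet_derivative\<close>; both agree on the open set \<open>U\<close>, and
  \<open>k_smooth_on_cong\<close> passes from one to the other.\<close>

lemma k_smooth_on_SucI:
  fixes f :: "'a::euclidean_space \<Rightarrow> 'b::real_normed_vector"
  assumes "open U" and der: "\<And>x. x \<in> U \<Longrightarrow> (f has_derivative f' x) (at x)"
    and "\<And>v. k_smooth_on k U (\<lambda>x. f' x v)"
  shows "k_smooth_on (Suc k) U f"
proof -
  have "k_smooth_on k U (\<lambda>x. frechet_derivative f (at x) v)" for v
    by (rule k_smooth_on_cong[OF assms(1) _ assms(3)[of v]])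
      (use frechet_derivative_at[OF der] in auto)
  then show ?thesis using der by (auto simp: differentiable_def)
qed

lemma k_smooth_on_SucD:
  fixes f :: "'a::euclidean_space \<Rightarrow> 'b::real_normed_vector"
  assumes "k_smooth_on (Suc k) U f"
  shows "k_smooth_on k U f"
  using assms
proof (induction k arbitrary: f)
  case 0
  then show ?case
    by (auto intro!: continuous_at_imp_continuous_on differentiable_imp_continuous_within)
qed auto

lemma k_smooth_on_has_derivative:
  assumes "k_smooth_on (Suc k) U f" "x \<in> U"
  shows "(f has_derivative frechet_derivative f (at x)) (at x)"
  using assms frechet_derivative_works by auto

lemma k_smooth_on_const: "open U \<Longrightarrow> k_smooth_on k U (\<lambda>x. c)"
proof (induction k arbitrary: c)
  case (Suc k)
  then show ?case
    by (intro k_smooth_on_SucI[where f' = "\<lambda>_ _. 0"]) auto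
qed auto

lemma k_smooth_on_bounded_linear:
  assumes "open U" "bounded_linear f"
  shows "k_smooth_on k U f"
proof (cases k)
  case 0
  with assms show ?thesis by (simp add: linear_continuous_on)
next
  case (Suc j)
  show ?thesis unfolding Suc
    by (rule k_smooth_on_SucI[OF assms(1), where f' = "\<lambda>_. f"])
      (use assms in \<open>auto intro: bounded_linear_imp_has_derivative k_smooth_on_const\<close>)
qed

lemma k_smooth_on_linear_image:
  assumes "open U" "bounded_linear L" "k_smooth_on k U f"
  shows "k_smooth_on k U (\<lambda>x. L (f x))"
  using assms(3)
proof (induction k arbitrary: f)
  case 0
  then show ?case using assms(2) by (simp add: bounded_linear.continuous_on)
next
  case (Suc k)
  show ?case
    by (rule k_smooth_on_SucI[OF assms(1), where f' = "\<lambda>x v. L (frechet_derivative f (at x) v)"])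
      (use Suc assms k_smooth_on_has_derivative[OF Suc.prems] in
        \<open>auto intro: bounded_linear.has_derivative\<close>)
qed

lemma k_smooth_on_add:
  assumes "open U" "k_smooth_on k U f" "k_smooth_on k U g"
  shows "k_smooth_on k U (\<lambda>x. f x + g x)"
  using assms(2,3)
proof (induction k arbitrary: f g)
  case 0
  then show ?case by (simp add: continuous_on_add)
next
  case (Suc k)
  show ?case
    by (rule k_smooth_on_SucI[OF assms(1), where f' = "\<lambda>x v. frechet_derivative f (at x) v
          + frechet_derivative g (at x) v"])
      (use Suc k_smooth_on_has_derivative[OF Suc.prems(1)] k_smooth_on_has_derivative[OF Suc.prems(2)]
        in \<open>auto intro!: has_derivative_add\<close>)
qed

lemma k_smooth_on_bilinear:
  assumes "open U" "bounded_bilinear B" "k_smooth_on k U f" "k_smooth_on k U g"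
  shows "k_smooth_on k U (\<lambda>x. B (f x) (g x))"
  using assms(3,4)
proof (induction k arbitrary: f g)
  case 0
  then show ?case using assms(2) by (simp add: bounded_bilinear.continuous_on)
next
  case (Suc k)
  show ?case
  proof (rule k_smooth_on_SucI[OF assms(1), where f' = "\<lambda>x v. B (f x) (frechet_derivative g (at x) v)
          + B (frechet_derivative f (at x) v) (g x)"])
    show "((\<lambda>x. B (f x) (g x)) has_derivative
         (\<lambda>v. B (f x) (frechet_derivative g (at x) v) + B (frechet_derivative f (at x) v) (g x))) (at x)"
      if "x \<in> U" for x
      by (rule bounded_bilinear.FDERIV[OF assms(2)])
       (use k_smooth_on_has_derivative[OF Suc.prems(1)] k_smooth_on_has_derivative[OF Suc.prems(2)] that in auto)
    show "k_smooth_on k U (\<lambda>x. B (f x) (frechet_derivative g (at x) v)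
        + B (frechet_derivative f (at x) v) (g x))" for v
      by (intro k_smooth_on_add assms(1) Suc.IH) 
       (use Suc.prems k_smooth_on_SucD[OF Suc.prems(1)] k_smooth_on_SucD[OF Suc.prems(2)] in auto)
  qed
qed

lemma k_smooth_on_sum:
  assumes "open U" "\<And>i. i \<in> I \<Longrightarrow> k_smooth_on k U (f i)"
  shows "k_smooth_on k U (\<lambda>x. \<Sum>i\<in>I. f i x)"
  using assms(2)
proof (induction I rule: infinite_finite_induct)
  case (insert i I)
  then show ?case by (auto intro!: k_smooth_on_add assms(1))
qed (auto intro: k_smooth_on_const assms(1))

lemma frechet_derivative_eq_sum_Basis:
  assumes "f differentiable at x"
  shows "frechet_derivative f (at x) v = (\<Sum>b\<in>Basis. (v \<bullet> b) *\<^sub>R frechet_derivative f (at x) b)"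
proof -
  have "linear (frechet_derivative f (at x))"
    using assms linear_frechet_derivative by blast
  then have "frechet_derivative f (at x) (\<Sum>b\<in>Basis. (v \<bullet> b) *\<^sub>R b) =
      (\<Sum>b\<in>Basis. (v \<bullet> b) *\<^sub>R frechet_derivative f (at x) b)"
    by (simp add: linear_sum linear_scale o_def)
  then show ?thesis by (simp add: euclidean_representation)
qed

text \<open>The chain rule evaluates the derivative of \<open>f\<close> in the direction
  \<open>frechet_derivative g (at x) v\<close>, which moves with \<open>x\<close>, whereas
  \<open>k_smooth_on\<close> speaks of fixed directions. Expanding that direction in
  \<open>Basis\<close> gives a sum of products to which the induction hypothesis applies.\<close>

lemma k_smooth_on_compose:
  fixes f :: "'b::euclidean_space \<Rightarrow> 'c::real_normed_vector" and g :: "'a::euclidean_space \<Rightarrow> 'b"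
  assumes "open U" "open V" "g ` U \<subseteq> V" "k_smooth_on k V f" "k_smooth_on k U g"
  shows "k_smooth_on k U (\<lambda>x. f (g x))"
  using assms(4,5)
proof (induction k arbitrary: f)
  case 0
  then show ?case using assms(3) by (simp add: continuous_on_compose2)
next
  case (Suc k)
  show ?case
  proof (rule k_smooth_on_SucI[OF assms(1), where f' = "\<lambda>x v. \<Sum>b\<in>Basis.
      (frechet_derivative g (at x) v \<bullet> b) *\<^sub>R frechet_derivative f (at (g x)) b"])
    fix x assume x: "x \<in> U"
    then have gx: "g x \<in> V" using assms(3) by auto
    note df = k_smooth_on_has_derivative[OF Suc.prems(1) gx]
    note dg = k_smooth_on_has_derivative[OF Suc.prems(2) x]
    have "((\<lambda>x. f (g x)) has_derivative (\<lambda>v. frechet_derivative f (at (g x)) (frechet_derivative g (at x) v))) (at x)"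
      using diff_chain_at[OF dg df] by (simp add: o_def)
    then show "((\<lambda>x. f (g x)) has_derivative (\<lambda>v. \<Sum>b\<in>Basis.
      (frechet_derivative g (at x) v \<bullet> b) *\<^sub>R frechet_derivative f (at (g x)) b)) (at x)"
      using frechet_derivative_eq_sum_Basis[of f "g x"] df
      by (subst (asm) frechet_derivative_eq_sum_Basis[of f "g x"]) (auto simp: differentiable_def)
  next
    fix v
    have "k_smooth_on k U (\<lambda>x. frechet_derivative f (at (g x)) b)" for b
      by (rule Suc.IH[of "\<lambda>y. frechet_derivative f (at y) b"])
        (use Suc.prems(1) k_smooth_on_SucD[OF Suc.prems(2)] in auto)
    moreover have "k_smooth_on k U (\<lambda>x. frechet_derivative g (at x) v \<bullet> b)" for b
      by (rule k_smooth_on_linear_image[OF assms(1) bounded_linear_inner_left]) (use Suc.prems(2) in auto)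
    ultimately show "k_smooth_on k U (\<lambda>x. \<Sum>b\<in>Basis.
      (frechet_derivative g (at x) v \<bullet> b) *\<^sub>R frechet_derivative f (at (g x)) b)"
      by (intro k_smooth_on_sum k_smooth_on_bilinear[OF _ bounded_bilinear_scaleR] assms(1))
  qed
qed

lemma k_smooth_on_subset:
  assumes "V \<subseteq> U" "k_smooth_on k U f" shows "k_smooth_on k V f"
  using assms(2)
proof (induction k arbitrary: f)
  case 0 then show ?case using assms(1) continuous_on_subset by auto
qed (use assms(1) in auto)

lemma smooth_on_has_derivative:
  assumes "smooth_on U f" "x \<in> U"
  shows "(f has_derivative frechet_derivative f (at x)) (at x)"
  using assms k_smooth_on_has_derivative unfolding smooth_on_def by blast

lemma smooth_on_differentiable: "smooth_on U f \<Longrightarrow> x \<in> U \<Longrightarrow> f differentiable at x"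
  using smooth_on_has_derivative differentiable_def by blast

lemma smooth_on_derivative:
  assumes "smooth_on U f" shows "smooth_on U (\<lambda>x. frechet_derivative f (at x) v)"
proof -
  have "k_smooth_on (Suc k) U f" for k using assms unfolding smooth_on_def by blast
  then show ?thesis by (simp add: smooth_on_def)
qed

lemma smooth_on_continuous_on: "smooth_on U f \<Longrightarrow> continuous_on U f"
  unfolding smooth_on_def using k_smooth_on.simps(1) by blast

lemma smooth_on_const: "open U \<Longrightarrow> smooth_on U (\<lambda>x. c)"
  by (simp add: smooth_on_def k_smooth_on_const)

lemma smooth_on_bounded_linear: "open U \<Longrightarrow> bounded_linear f \<Longrightarrow> smooth_on U f"
  by (simp add: smooth_on_def k_smooth_on_bounded_linear)

lemma smooth_on_linear_image:
  "open U \<Longrightarrow> bounded_linear L \<Longrightarrow> smooth_on U f \<Longrightarrow> smooth_on U (\<lambda>x. L (f x))"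
  by (simp add: smooth_on_def k_smooth_on_linear_image)

lemma smooth_on_add:
  "open U \<Longrightarrow> smooth_on U f \<Longrightarrow> smooth_on U g \<Longrightarrow> smooth_on U (\<lambda>x. f x + g x)"
  by (simp add: smooth_on_def k_smooth_on_add)

lemma smooth_on_bilinear:
  "open U \<Longrightarrow> bounded_bilinear B \<Longrightarrow> smooth_on U f \<Longrightarrow> smooth_on U g \<Longrightarrow>
    smooth_on U (\<lambda>x. B (f x) (g x))"
  by (simp add: smooth_on_def k_smooth_on_bilinear)

lemmas smooth_on_mult = smooth_on_bilinear[OF _ bounded_bilinear_mult]
lemmas smooth_on_scaleR = smooth_on_bilinear[OF _ bounded_bilinear_scaleR]

lemma smooth_on_sum:
  "open U \<Longrightarrow> (\<And>i. i \<in> I \<Longrightarrow> smooth_on U (f i)) \<Longrightarrow> smooth_on U (\<lambda>x. \<Sum>i\<in>I. f i x)"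
  by (simp add: smooth_on_def k_smooth_on_sum)

lemma smooth_on_prod:
  fixes f :: "'i \<Rightarrow> 'a::euclidean_space \<Rightarrow> 'b::{real_normed_algebra, comm_ring_1}"
  assumes "open U" "\<And>i. i \<in> I \<Longrightarrow> smooth_on U (f i)"
  shows "smooth_on U (\<lambda>x. \<Prod>i\<in>I. f i x)"
  using assms(2)
proof (induction I rule: infinite_finite_induct)
  case (insert i I)
  then show ?case by (auto intro!: smooth_on_mult assms(1))
qed (auto intro: smooth_on_const assms(1))

lemma smooth_on_power:
  fixes f :: "'a::euclidean_space \<Rightarrow> 'b::{real_normed_algebra, comm_ring_1}"
  assumes "open U" "smooth_on U f"
  shows "smooth_on U (\<lambda>x. f x ^ n)"
  using smooth_on_prod[OF assms(1), of "{..<n}" "\<lambda>_. f"] assms(2) by simp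

lemma smooth_on_compose:
  "open U \<Longrightarrow> open V \<Longrightarrow> g ` U \<subseteq> V \<Longrightarrow> smooth_on V f \<Longrightarrow> smooth_on U g \<Longrightarrow>
    smooth_on U (\<lambda>x. f (g x))"
  by (simp add: smooth_on_def k_smooth_on_compose)

lemma smooth_on_cong:
  "open U \<Longrightarrow> (\<And>x. x \<in> U \<Longrightarrow> f x = g x) \<Longrightarrow> smooth_on U f \<Longrightarrow> smooth_on U g"
  unfolding smooth_on_def using k_smooth_on_cong by blast

lemma smooth_on_subset: "V \<subseteq> U \<Longrightarrow> smooth_on U f \<Longrightarrow> smooth_on V f"
  unfolding smooth_on_def using k_smooth_on_subset by blast

lemma open_punctured: "open (- {0::'a::euclidean_space})"
  by auto

section \<open>Smoothness of the radial projection away from the origin\<close>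

lemma has_derivative_inverse_norm_power:
  fixes x :: "'a::euclidean_space"
  assumes "x \<noteq> 0"
  shows "((\<lambda>x. inverse (norm x) ^ p) has_derivative
    (\<lambda>v. - real p * ((x \<bullet> v) * inverse (norm x) ^ (p + 2)))) (at x)"
proof (cases p)
  case 0
  then show ?thesis by simp
next
  case (Suc q)
  have "((\<lambda>x. inverse (norm x)) has_derivative (\<lambda>v. - (inverse (norm x) * (v \<bullet> sgn x) * inverse (norm x)))) (at x)"
    using has_derivative_norm[OF assms] assms
    by (auto intro!: derivative_eq_intros)
  then have "((\<lambda>x. inverse (norm x) ^ p) has_derivative
    (\<lambda>v. of_nat p * (- (inverse (norm x) * (v \<bullet> sgn x) * inverse (norm x))) * inverse (norm x) ^ (p - 1))) (at x)"
    by (rule has_derivative_power)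
  then show ?thesis
    by (rule has_derivative_eq_rhs)
      (auto simp: Suc sgn_div_norm divide_inverse inner_commute algebra_simps)
qed

text \<open>The derivative of a negative power of the norm is a linear form times another such
  power, so the family is closed under differentiation; hence the induction over \<open>k\<close>
  with \<open>p\<close> arbitrary.\<close>

lemma smooth_on_inverse_norm_power:
  "smooth_on (- {0}) (\<lambda>x::'a::euclidean_space. inverse (norm x) ^ p)"
proof -
  have "k_smooth_on k (- {0}) (\<lambda>x::'a. inverse (norm x) ^ p)" for k
  proof (induction k arbitrary: p)
    case 0
    show ?case by (auto intro!: continuous_intros)
  next
    case (Suc k)
    show ?case
    proof (rule k_smooth_on_SucI[OF open_punctured has_derivative_inverse_norm_power])
      show "k_smooth_on k (- {0}) (\<lambda>x::'a. - real p * ((x \<bullet> v) * inverse (norm x) ^ (p + 2)))" for v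
        by (intro k_smooth_on_bilinear[OF _ bounded_bilinear_mult] k_smooth_on_const open_punctured
          k_smooth_on_bounded_linear bounded_linear_inner_left Suc.IH)
    qed auto
  qed
  then show ?thesis by (simp add: smooth_on_def)
qed

lemma smooth_on_sgn: "smooth_on (- {0}) (sgn :: 'a::euclidean_space \<Rightarrow> 'a)"
proof (rule smooth_on_cong[OF open_punctured])
  show "inverse (norm x) ^ 1 *\<^sub>R x = sgn x" for x :: 'a by (simp add: sgn_div_norm)
  show "smooth_on (- {0}) (\<lambda>x::'a. inverse (norm x) ^ 1 *\<^sub>R x)"
    by (intro smooth_on_scaleR smooth_on_inverse_norm_power open_punctured
      smooth_on_bounded_linear bounded_linear_ident)
qed

section \<open>Gradient, divergence and Laplacian on the sphere\<close>

lemma differentiable_has_derivative: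
  "f differentiable at x \<Longrightarrow> (f has_derivative frechet_derivative f (at x)) (at x)"
  by (simp only: frechet_derivative_works)

lemma ray_extension_scaleR:
  assumes "c > 0" shows "ray_extension h (c *\<^sub>R y) = ray_extension h y"
  using assms by (simp add: ray_extension_def sgn_scaleR)

lemma ray_extension_on_sphere: "norm x = 1 \<Longrightarrow> ray_extension f x = f x"
  by (simp add: ray_extension_def sgn_div_norm)

lemma norm_sgn_neq_0: "(y :: 'a::real_normed_vector) \<noteq> 0 \<Longrightarrow> norm (sgn y) = 1"
  by (simp add: norm_sgn)

text \<open>A ray extension is homogeneous of degree 0, so its derivative is homogeneous of degree
  -1 and is known everywhere once it is known on the sphere.\<close>

lemma ray_extension_derivative:
  fixes y :: "'a::euclidean_space"
  assumes "y \<noteq> 0" "ray_extension h differentiable (at (sgn y))"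
  shows "(ray_extension h has_derivative
    (\<lambda>v. frechet_derivative (ray_extension h) (at (sgn y)) v /\<^sub>R norm y)) (at y)"
proof -
  let ?H = "ray_extension h"
  have H: "(?H has_derivative frechet_derivative ?H (at (sgn y))) (at (y /\<^sub>R norm y))"
    using differentiable_has_derivative[OF assms(2)] by (simp add: sgn_div_norm)
  have "((\<lambda>u. u /\<^sub>R norm y) has_derivative (\<lambda>v. v /\<^sub>R norm y)) (at y)"
    by (intro derivative_eq_intros) auto
  from diff_chain_at[OF this H]
  have "((\<lambda>u. ?H (u /\<^sub>R norm y)) has_derivative
      (\<lambda>v. frechet_derivative ?H (at (sgn y)) (v /\<^sub>R norm y))) (at y)"
    by (simp add: o_def)
  moreover have "(\<lambda>u. ?H (u /\<^sub>R norm y)) = ?H"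
    using assms(1) by (auto simp: ray_extension_scaleR)
  moreover have "frechet_derivative ?H (at (sgn y)) (v /\<^sub>R norm y) =
      frechet_derivative ?H (at (sgn y)) v /\<^sub>R norm y" for v
    using linear_frechet_derivative[OF assms(2)] by (rule linear_scale)
  ultimately show ?thesis by simp
qed

lemma ray_extension_radial_derivative:
  fixes x :: "'a::euclidean_space"
  assumes "ray_extension h differentiable (at x)"
  shows "frechet_derivative (ray_extension h) (at x) x = 0"
proof -
  let ?H = "ray_extension h"
  have H: "(?H has_derivative frechet_derivative ?H (at x)) (at ((1 + (0::real)) *\<^sub>R x))"
    using differentiable_has_derivative[OF assms] by simp
  have "((\<lambda>t. (1 + t) *\<^sub>R x) has_derivative (\<lambda>t. t *\<^sub>R x)) (at (0::real))"
    by (auto intro!: derivative_eq_intros)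
  from diff_chain_at[OF this H]
  have 1: "((\<lambda>t. ?H ((1 + t) *\<^sub>R x)) has_derivative (\<lambda>t. frechet_derivative ?H (at x) (t *\<^sub>R x))) (at 0)"
    by (simp add: o_def)
  have "((\<lambda>t. ?H ((1 + t) *\<^sub>R x)) has_derivative (\<lambda>t. 0)) (at 0)"
  proof (rule has_derivative_transform_within_open[where s = "{-1<..}" and f = "\<lambda>t. ?H x"])
    show "?H x = ?H ((1 + t) *\<^sub>R x)" if "t \<in> {-1<..}" for t :: real
      using that by (simp add: ray_extension_scaleR)
  qed auto
  then have "(\<lambda>t. frechet_derivative ?H (at x) (t *\<^sub>R x)) = (\<lambda>t. 0)"
    using 1 has_derivative_unique by blast
  from fun_cong[OF this, of 1] show ?thesis by simp
qed

lemma sphere_smooth_ray_extension: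
  assumes "f \<in> smooth_sphere_functions"
  shows "smooth_on (- {0}) (ray_extension f)"
proof -
  obtain U F where U: "open U" "sphere 0 1 \<subseteq> U" "smooth_on U F" "\<forall>x\<in>sphere 0 1. F x = f x"
    using assms by (auto simp: smooth_sphere_functions_def)
  show ?thesis
  proof (rule smooth_on_cong[OF open_punctured])
    show "smooth_on (- {0}) (\<lambda>x. F (sgn x))"
      by (rule smooth_on_compose[OF open_punctured U(1) _ U(3) smooth_on_sgn])
        (use U(2) norm_sgn_neq_0 in \<open>auto simp: subset_iff\<close>)
  qed (use U(4) in \<open>auto simp: ray_extension_def norm_sgn\<close>)
qed

lemma smooth_sphere_functions_zero: "f \<in> smooth_sphere_functions \<Longrightarrow> norm x \<noteq> 1 \<Longrightarrow> f x = 0"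
  by (auto simp: smooth_sphere_functions_def)

lemma smooth_sphere_functions_restrict:
  assumes "smooth_on UNIV p"
  shows "(\<lambda>x. if norm x = 1 then p x else 0) \<in> smooth_sphere_functions"
  using assms by (auto simp: smooth_sphere_functions_def)

lemma smooth_sphere_functions_add:
  assumes "f \<in> smooth_sphere_functions" "g \<in> smooth_sphere_functions"
  shows "f + g \<in> smooth_sphere_functions"
proof -
  obtain U F where U: "open U" "sphere 0 1 \<subseteq> U" "smooth_on U F" "\<forall>x\<in>sphere 0 1. F x = f x"
    using assms by (auto simp: smooth_sphere_functions_def)
  obtain V G where V: "open V" "sphere 0 1 \<subseteq> V" "smooth_on V G" "\<forall>x\<in>sphere 0 1. G x = g x"
    using assms by (auto simp: smooth_sphere_functions_def)
  have "smooth_on (U \<inter> V) (\<lambda>x. F x + G x)"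
    using U V by (intro smooth_on_add) (auto elim: smooth_on_subset[rotated])
  then show ?thesis using U V assms
    by (auto simp: smooth_sphere_functions_def intro!: exI[of _ "U \<inter> V"] exI[of _ "\<lambda>x. F x + G x"])
qed

lemma smooth_sphere_functions_scale:
  assumes "f \<in> smooth_sphere_functions"
  shows "(\<lambda>x. c * f x) \<in> smooth_sphere_functions"
proof -
  obtain U F where U: "open U" "sphere 0 1 \<subseteq> U" "smooth_on U F" "\<forall>x\<in>sphere 0 1. F x = f x"
    using assms by (auto simp: smooth_sphere_functions_def)
  have "smooth_on U (\<lambda>x. c * F x)"
    using U by (intro smooth_on_mult smooth_on_const)
  then show ?thesis using U assms
    by (auto simp: smooth_sphere_functions_def intro!: exI[of _ U] exI[of _ "\<lambda>x. c * F x"])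
qed

lemma smooth_sphere_functions_subspace: "real_functions.subspace smooth_sphere_functions"
proof (rule real_functions.subspaceI)
  show "0 \<in> (smooth_sphere_functions :: ('a \<Rightarrow> real) set)"
    by (auto simp: smooth_sphere_functions_def intro!: exI[of _ UNIV] exI[of _ "\<lambda>_. 0"] smooth_on_const)
qed (auto intro: smooth_sphere_functions_add smooth_sphere_functions_scale)

lemma sphere_gradient_inner:
  assumes "ray_extension f differentiable (at x)"
  shows "sphere_gradient f x \<bullet> v = frechet_derivative (ray_extension f) (at x) v"
  unfolding frechet_derivative_eq_sum_Basis[OF assms, of v]
  by (simp add: sphere_gradient_def inner_sum_left inner_commute[of v] mult.commute)

lemma smooth_ray_extension_gradient:
  fixes f :: "'a::euclidean_space \<Rightarrow> real"
  assumes "smooth_on (- {0}) (ray_extension f)"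
  shows "smooth_on (- {0}) (ray_extension (sphere_gradient f))"
proof (rule smooth_on_cong[OF open_punctured])
  show "smooth_on (- {0}) (\<lambda>y. \<Sum>b\<in>Basis. frechet_derivative (ray_extension f) (at (sgn y)) b *\<^sub>R b)"
    by (intro smooth_on_sum smooth_on_scaleR smooth_on_const open_punctured
        smooth_on_compose[of _ "- {0}" sgn "\<lambda>y. frechet_derivative (ray_extension f) (at y) _"]
        smooth_on_sgn smooth_on_derivative assms) (auto simp: sgn_zero_iff)
qed (auto simp: ray_extension_def sphere_gradient_def)

context
  fixes f :: "'a::euclidean_space \<Rightarrow> real" and G Y
  assumes smooth: "smooth_on (- {0}) (ray_extension f)"
  defines "G \<equiv> ray_extension f" and "Y \<equiv> ray_extension (sphere_gradient f)"
begin

lemma ray_extension_has_derivative: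
  assumes "y \<noteq> 0"
  shows "(G has_derivative (\<lambda>v. Y y \<bullet> v / norm y)) (at y)"
proof -
  have d: "ray_extension f differentiable at (sgn y)"
    by (rule smooth_on_differentiable[OF smooth]) (use assms in \<open>auto simp: sgn_zero_iff\<close>)
  show ?thesis
    using ray_extension_derivative[OF assms d] sphere_gradient_inner[OF d]
    by (simp add: G_def Y_def ray_extension_def divide_inverse mult.commute)
qed

lemma ray_extension_gradient_radial:
  assumes "y \<noteq> 0" shows "Y y \<bullet> y = 0"
proof -
  have d: "ray_extension f differentiable at (sgn y)"
    by (rule smooth_on_differentiable[OF smooth]) (use assms in \<open>auto simp: sgn_zero_iff\<close>)
  have "Y y \<bullet> sgn y = 0"
    using sphere_gradient_inner[OF d, of "sgn y"] ray_extension_radial_derivative[OF d]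
    by (simp add: Y_def ray_extension_def)
  then show ?thesis using assms by (simp add: sgn_div_norm)
qed

text \<open>The Laplacian on the sphere becomes a Euclidean divergence in the punctured space. The
  factor \<open>1 / norm y\<close> appears because one derivative of a field of degree 0 is
  taken.\<close>

lemma ray_extension_gradient_divergence:
  assumes "y \<noteq> 0"
  shows "(\<Sum>b\<in>Basis. frechet_derivative Y (at y) b \<bullet> b) = - sphere_laplacian f (sgn y) / norm y"
proof -
  have d: "Y differentiable at (sgn y)"
    unfolding Y_def
    by (rule smooth_on_differentiable[OF smooth_ray_extension_gradient[OF smooth]])
       (use assms in \<open>auto simp: sgn_zero_iff\<close>)
  have "frechet_derivative Y (at y) = (\<lambda>v. frechet_derivative Y (at (sgn y)) v /\<^sub>R norm y)"
    using frechet_derivative_at[OF ray_extension_derivative[OF assms d[unfolded Y_def]]]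
    by (simp add: Y_def)
  then show ?thesis
    by (simp add: sphere_laplacian_def sphere_divergence_def Y_def sum_distrib_left[symmetric] 
       divide_inverse mult.commute)
qed

end

lemma sphere_gradient_add:
  assumes "ray_extension f differentiable (at x)" "ray_extension g differentiable (at x)"
  shows "sphere_gradient (\<lambda>x. f x + g x) x = sphere_gradient f x + sphere_gradient g x"
proof -
  have "ray_extension (\<lambda>x. f x + g x) = (\<lambda>y. ray_extension f y + ray_extension g y)"
    by (simp add: ray_extension_def fun_eq_iff)
  moreover have "frechet_derivative (\<lambda>y. ray_extension f y + ray_extension g y) (at x) =
      (\<lambda>v. frechet_derivative (ray_extension f) (at x) v + frechet_derivative (ray_extension g) (at x) v)"
    by (intro frechet_derivative_at[symmetric] has_derivative_add)
      (use assms differentiable_has_derivative in auto)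
  ultimately show ?thesis
    by (simp add: sphere_gradient_def sum.distrib algebra_simps)
qed

lemma sphere_gradient_scale:
  assumes "ray_extension f differentiable (at x)"
  shows "sphere_gradient (\<lambda>x. c * f x) x = c *\<^sub>R sphere_gradient f x"
proof -
  have "ray_extension (\<lambda>x. c * f x) = (\<lambda>y. c * ray_extension f y)"
    by (simp add: ray_extension_def fun_eq_iff)
  moreover have "frechet_derivative (\<lambda>y. c * ray_extension f y) (at x) =
      (\<lambda>v. c * frechet_derivative (ray_extension f) (at x) v)"
    by (intro frechet_derivative_at[symmetric] has_derivative_mult_right)
      (use assms differentiable_has_derivative in auto)
  ultimately show ?thesis
    by (simp add: sphere_gradient_def scaleR_sum_right)
qed

text \<open>Away from the origin a ray extension sees only values on the sphere, so identities
  between gradients need to be checked only there before they are differentiated again.\<close>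

lemma frechet_derivative_ray_extension_cong:
  fixes x :: "'a::euclidean_space"
  assumes "\<And>u. norm u = 1 \<Longrightarrow> h u = h' u" "norm x = 1" "ray_extension h differentiable at x"
  shows "frechet_derivative (ray_extension h) (at x) = frechet_derivative (ray_extension h') (at x)"
  by (rule frechet_derivative_transform_within_open[OF assms(3) open_punctured])
    (use assms in \<open>auto simp: ray_extension_def norm_sgn\<close>)

lemma sphere_laplacian_add:
  assumes f: "smooth_on (- {0}) (ray_extension f)" and g: "smooth_on (- {0}) (ray_extension g)"
    and x: "norm x = 1"
  shows "sphere_laplacian (\<lambda>x. f x + g x) x = sphere_laplacian f x + sphere_laplacian g x"
proof -
  have x0: "x \<in> - {0}" using x by auto
  have d: "ray_extension (sphere_gradient f) differentiable at x" "ray_extension (sphere_gradient g) differentiable at x"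
    using smooth_on_differentiable[OF smooth_ray_extension_gradient[OF f] x0]
     smooth_on_differentiable[OF smooth_ray_extension_gradient[OF g] x0] by auto
  have *: "((\<lambda>y. ray_extension (sphere_gradient f) y + ray_extension (sphere_gradient g) y) has_derivative
     (\<lambda>v. frechet_derivative (ray_extension (sphere_gradient f)) (at x) v + frechet_derivative (ray_extension (sphere_gradient g)) (at x) v)) (at x)"
    by (intro has_derivative_add) (use d differentiable_has_derivative in auto)
  have **: "(\<lambda>y. ray_extension (sphere_gradient f) y + ray_extension (sphere_gradient g) y) 
     = ray_extension (\<lambda>u. sphere_gradient f u + sphere_gradient g u)"
    by (simp add: ray_extension_def fun_eq_iff)
  have "frechet_derivative (ray_extension (\<lambda>u. sphere_gradient f u + sphere_gradient g u)) (at x) =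
    frechet_derivative (ray_extension (sphere_gradient (\<lambda>x. f x + g x))) (at x)"
  proof (rule frechet_derivative_ray_extension_cong[OF _ x])
    show "sphere_gradient f u + sphere_gradient g u = sphere_gradient (\<lambda>x. f x + g x) u" if "norm u = 1" for u
      using smooth_on_differentiable[OF f, of u] smooth_on_differentiable[OF g, of u] that
      by (cases "u = 0") (simp_all add: sphere_gradient_add)
  qed (use * ** in \<open>auto simp: differentiable_def\<close>)
  then have "frechet_derivative (ray_extension (sphere_gradient (\<lambda>x. f x + g x))) (at x) =
     (\<lambda>v. frechet_derivative (ray_extension (sphere_gradient f)) (at x) v + frechet_derivative (ray_extension (sphere_gradient g)) (at x) v)"
    using frechet_derivative_at[OF *] ** by simp
  then show ?thesis
    by (simp add: sphere_laplacian_def sphere_divergence_def inner_add_left sum.distrib)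
qed

lemma sphere_laplacian_scale:
  assumes f: "smooth_on (- {0}) (ray_extension f)"
    and x: "norm x = 1"
  shows "sphere_laplacian (\<lambda>x. c * f x) x = c * sphere_laplacian f x"
proof -
  have x0: "x \<in> - {0}" using x by auto
  have d: "ray_extension (sphere_gradient f) differentiable at x"
    using smooth_on_differentiable[OF smooth_ray_extension_gradient[OF f] x0] by auto
  have *: "((\<lambda>y. c *\<^sub>R ray_extension (sphere_gradient f) y) has_derivative
     (\<lambda>v. c *\<^sub>R frechet_derivative (ray_extension (sphere_gradient f)) (at x) v)) (at x)"
    by (intro has_derivative_scaleR_right) (use d differentiable_has_derivative in auto)
  have **: "(\<lambda>y. c *\<^sub>R ray_extension (sphere_gradient f) y) 
     = ray_extension (\<lambda>u. c *\<^sub>R sphere_gradient f u)"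
    by (simp add: ray_extension_def fun_eq_iff)
  have "frechet_derivative (ray_extension (\<lambda>u. c *\<^sub>R sphere_gradient f u)) (at x) =
    frechet_derivative (ray_extension (sphere_gradient (\<lambda>x. c * f x))) (at x)"
  proof (rule frechet_derivative_ray_extension_cong[OF _ x])
    show "c *\<^sub>R sphere_gradient f u = sphere_gradient (\<lambda>x. c * f x) u" if "norm u = 1" for u
      using smooth_on_differentiable[OF f, of u] that
      by (cases "u = 0") (simp_all add: sphere_gradient_scale)
  qed (use * ** in \<open>auto simp: differentiable_def\<close>)
  then have "frechet_derivative (ray_extension (sphere_gradient (\<lambda>x. c * f x))) (at x) =
     (\<lambda>v. c *\<^sub>R frechet_derivative (ray_extension (sphere_gradient f)) (at x) v)"
    using frechet_derivative_at[OF *] ** by simp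
  then show ?thesis
    by (simp add: sphere_laplacian_def sphere_divergence_def sum_distrib_left)
qed

section \<open>Integration by parts on a spherical shell\<close>

lemma integral_derivative_eq_0:
  fixes u :: "'a::euclidean_space \<Rightarrow> real"
  assumes der: "\<And>y. (u has_derivative u' y) (at y)"
    and K: "compact K" "continuous_on K E" "\<And>y. y \<notin> K \<Longrightarrow> u y = 0"
    and u': "\<And>y. u' y b = indicator K y *\<^sub>R E y"
  shows "integral\<^sup>L lborel (\<lambda>y. u' y b) = 0"
proof -
  \<comment> \<open>Difference quotients in direction \<open>b\<close>. By translation invariance
    each has integral 0, and dominated convergence hands this on to the derivative.\<close>
  define s where "s k y = (u (y + (1 / Suc k) *\<^sub>R b) - u y) * Suc k" for k y
  have cont: "continuous_on A u" for A
    by (rule continuous_at_imp_continuous_on) (use has_derivative_continuous[OF der] in auto)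
  have int_u: "integrable lborel u"
  proof -
    have "integrable lborel (\<lambda>y. indicator K y *\<^sub>R u y)"
      by (rule borel_integrable_compact[OF K(1) cont])
    also have "(\<lambda>y. indicator K y *\<^sub>R u y) = u"
    proof
      show "indicator K y *\<^sub>R u y = u y" for y by (cases "y \<in> K") (auto simp: K(3))
    qed
    finally show ?thesis .
  qed
  have shift: "integrable lborel (\<lambda>y. u (y + c))" "integral\<^sup>L lborel (\<lambda>y. u (y + c)) = integral\<^sup>L lborel u" for c
  proof -
    have *: "integrable (distr lborel borel ((+) c)) u"
      using int_u by (simp add: lborel_distr_plus)
    have m: "u \<in> borel_measurable borel" using cont by (rule borel_measurable_continuous_onI)
    show "integrable lborel (\<lambda>y. u (y + c))"
      using * by (subst (asm) integrable_distr_eq) (auto simp: add.commute m)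
    have "integral\<^sup>L (distr lborel borel ((+) c)) u = integral\<^sup>L lborel (\<lambda>y. u (c + y))"
      by (rule integral_distr) (auto simp: m)
    then show "integral\<^sup>L lborel (\<lambda>y. u (y + c)) = integral\<^sup>L lborel u"
      by (simp add: lborel_distr_plus add.commute)
  qed
  have s0: "integral\<^sup>L lborel (s k) = 0" for k
    unfolding s_def using shift int_u by simp
  obtain M0 where "\<forall>y\<in>K. norm (E y) \<le> M0"
    using compact_continuous_image[OF K(2,1)] compact_imp_bounded[of "E ` K"] by (auto simp: bounded_iff)
  then have M: "\<And>y. y \<in> K \<Longrightarrow> \<bar>E y\<bar> \<le> max 0 M0" "max 0 M0 \<ge> 0"
    by (auto simp: le_max_iff_disj)
  define M where "M = max 0 M0"
  note M = M[folded M_def]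
  have u'M: "\<bar>u' y b\<bar> \<le> M" for y
    using M by (auto simp: u' indicator_def)
  obtain R where R: "R > 0" "\<And>y. y \<in> K \<Longrightarrow> norm y \<le> R"
    using compact_imp_bounded[OF K(1)] unfolding bounded_pos by blast
  \<comment> \<open>The mean value theorem bounds every quotient by \<open>M\<close>. All steps have
    length at most \<open>norm b\<close>, so one ball of radius \<open>R + norm b\<close> contains
    all supports.\<close>
  let ?w = "\<lambda>y. indicator (cball 0 (R + norm b)) y *\<^sub>R M"
  have line: "((\<lambda>t. y + t *\<^sub>R b) has_derivative (\<lambda>s. s *\<^sub>R b)) (at t)" for y t
    by (auto intro!: derivative_eq_intros)
  have bound: "norm (s k y) \<le> ?w y" for k y
  proof -
    let ?h = "1 / real (Suc k)"
    have h: "?h > 0" "?h \<le> 1" by auto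
    have "((\<lambda>t. u (y + t *\<^sub>R b)) has_real_derivative u' (y + t *\<^sub>R b) b) (at t)" for t
    proof -
      have "((\<lambda>t. u (y + t *\<^sub>R b)) has_derivative (\<lambda>s. u' (y + t *\<^sub>R b) (s *\<^sub>R b))) (at t)"
        using diff_chain_at[OF line[of y t] der] by (simp add: o_def)
      moreover have "linear (u' (y + t *\<^sub>R b))" by (rule has_derivative_linear[OF der])
      ultimately show ?thesis
        by (simp add: has_field_derivative_def linear_scale mult_commute_abs)
    qed
    from MVT2[OF h(1), of "\<lambda>t. u (y + t *\<^sub>R b)", OF this]
    obtain t where "u (y + ?h *\<^sub>R b) - u (y + 0 *\<^sub>R b) = (?h - 0) * u' (y + t *\<^sub>R b) b" by blast
    then have "s k y = u' (y + t *\<^sub>R b) b" using h by (simp add: s_def)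
    then have 1: "\<bar>s k y\<bar> \<le> M" using u'M by simp
    have "s k y = 0" if "norm y > R + norm b"
    proof -
      have "norm (?h *\<^sub>R b) \<le> norm b" using h mult_right_mono[OF h(2), of "norm b"] by simp
      then have "norm (y + ?h *\<^sub>R b) > R" using norm_diff_ineq[of y "?h *\<^sub>R b"] that by linarith
      moreover have "norm y > R" using that norm_ge_zero[of b] by linarith
      ultimately have "y + ?h *\<^sub>R b \<notin> K" "y \<notin> K" using R(2) leD by blast+
      then show ?thesis using K(3) by (simp add: s_def)
    qed
    with 1 M(2) show ?thesis by (auto simp: indicator_def)
  qed
  have lim: "(\<lambda>k. s k y) \<longlonglongrightarrow> u' y b" for y
  proof -
    have "((\<lambda>t. u (y + t *\<^sub>R b)) has_derivative (\<lambda>s. u' (y + 0 *\<^sub>R b) (s *\<^sub>R b))) (at 0)"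
      using diff_chain_at[OF line[of y 0] der] by (simp add: o_def)
    moreover have "linear (u' y)" by (rule has_derivative_linear[OF der])
    ultimately have "((\<lambda>t. u (y + t *\<^sub>R b)) has_real_derivative u' y b) (at 0)"
      by (simp add: has_field_derivative_def linear_scale mult_commute_abs)
    then have "((\<lambda>h. (u (y + h *\<^sub>R b) - u y) / h) \<longlongrightarrow> u' y b) (at 0)"
      by (simp add: has_field_derivative_iff)
    moreover have "filterlim (\<lambda>k. 1 / real (Suc k)) (at 0) sequentially"
      unfolding filterlim_at using LIMSEQ_inverse_real_of_nat
      by (simp add: divide_inverse del: of_nat_Suc)
    ultimately have "(\<lambda>k. (u (y + (1 / real (Suc k)) *\<^sub>R b) - u y) / (1 / real (Suc k))) \<longlonglongrightarrow> u' y b"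
      by (rule filterlim_compose)
    then show ?thesis by (simp add: s_def)
  qed
  have "(\<lambda>k. integral\<^sup>L lborel (s k)) \<longlonglongrightarrow> integral\<^sup>L lborel (\<lambda>y. u' y b)"
  proof (rule integral_dominated_convergence[where w = ?w])
    have sm: "s k \<in> borel_measurable borel" for k
      unfolding s_def by (intro borel_measurable_continuous_onI continuous_intros
         continuous_on_compose2[OF cont[of UNIV]]) auto
    then show "s k \<in> borel_measurable lborel" for k by simp
    show "(\<lambda>y. u' y b) \<in> borel_measurable lborel"
      using borel_measurable_LIMSEQ_real[of lborel s, OF lim] sm by simp
    show "integrable lborel ?w"
      by (rule borel_integrable_compact) auto
    show "AE y in lborel. (\<lambda>k. s k y) \<longlonglongrightarrow> u' y b" by (rule AE_I2) (rule lim)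
    show "AE y in lborel. norm (s k y) \<le> ?w y" for k by (rule AE_I2) (rule bound)
  qed
  then have "(\<lambda>k::nat. 0) \<longlonglongrightarrow> integral\<^sup>L lborel (\<lambda>y. u' y b)" by (simp only: s0)
  then show ?thesis by (rule LIMSEQ_unique[symmetric, OF tendsto_const])
qed

lemma DERIV_max_square: "((\<lambda>s::real. (max 0 s)\<^sup>2) has_real_derivative 2 * max 0 s) (at s)"
proof (cases s "0 :: real" rule: linorder_cases)
  case less
  show ?thesis
    by (rule has_field_derivative_transform_within_open[where f = "\<lambda>_. 0" and S = "{..<0}"])
      (use less in auto)
next
  case equal
  show ?thesis unfolding equal CARAT_DERIV
  proof (intro exI[of _ "\<lambda>z. max 0 z"] conjI allI)
    show "(max 0 z)\<^sup>2 - (max 0 0)\<^sup>2 = max 0 z * (z - 0)" for z :: real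
      by (simp add: max_def power2_eq_square)
  qed (auto intro!: continuous_intros)
next
  case greater
  show ?thesis
    by (rule has_field_derivative_transform_within_open[where f = "\<lambda>x. x^2" and S = "{0<..}"])
      (use greater in \<open>auto intro!: derivative_eq_intros\<close>)
qed

text \<open>The cutoff is positive exactly between the radii 1 and 2. Squaring makes the positive
  part differentiable, and one derivative is all that integration by parts uses. It is radial, so
  its gradient is orthogonal to tangential fields.\<close>

definition annulus_cutoff :: "'a::euclidean_space \<Rightarrow> real" where
  "annulus_cutoff y = (max 0 ((y \<bullet> y - 1) * (4 - y \<bullet> y)))\<^sup>2"

definition annulus :: "'a::euclidean_space set" where
  "annulus = cball 0 2 - ball 0 1"

lemma compact_annulus: "compact annulus"
  by (simp add: annulus_def compact_diff)

lemma annulus_subset: "annulus \<subseteq> - {0}"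
  by (auto simp: annulus_def)

lemma annulus_factor_nonpos:
  fixes y :: "'a::euclidean_space"
  assumes "norm y \<le> 1 \<or> norm y \<ge> 2"
  shows "(y \<bullet> y - 1) * (4 - y \<bullet> y) \<le> 0"
proof -
  have "(norm y)\<^sup>2 \<le> 1 \<or> (norm y)\<^sup>2 \<ge> 4"
    using assms power_mono[of "norm y" 1 2] power_mono[of 2 "norm y" 2] by auto
  then show ?thesis
    unfolding dot_square_norm by (auto simp: mult_le_0_iff)
qed

lemma annulus_cutoff_zero:
  fixes y :: "'a::euclidean_space"
  assumes "norm y \<le> 1 \<or> norm y \<ge> 2" shows "annulus_cutoff y = 0"
  using annulus_factor_nonpos[OF assms] by (simp add: annulus_cutoff_def)

lemma annulus_cutoff_pos:
  fixes y :: "'a::euclidean_space"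
  assumes "1 < norm y" "norm y < 2" shows "annulus_cutoff y > 0"
proof -
  have "(norm y)\<^sup>2 > 1" "(norm y)\<^sup>2 < 2\<^sup>2"
    using assms power_strict_mono[of 1 "norm y" 2] power_strict_mono[of "norm y" 2 2] by auto
  then have "(y \<bullet> y - 1) * (4 - y \<bullet> y) > 0"
    unfolding dot_square_norm by simp
  then show ?thesis unfolding annulus_cutoff_def by (metis less_max_iff_disj zero_less_power)
qed

definition cutoff_slope :: "'a::euclidean_space \<Rightarrow> real" where
  "cutoff_slope y = 2 * max 0 ((y \<bullet> y - 1) * (4 - y \<bullet> y)) * (2 * (4 - y \<bullet> y) - 2 * (y \<bullet> y - 1))"

lemma annulus_cutoff_has_derivative:
  "(annulus_cutoff has_derivative (\<lambda>v. cutoff_slope y * (y \<bullet> v))) (at y)"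
proof -
  have "((\<lambda>y. (y \<bullet> y - 1) * (4 - y \<bullet> y)) has_derivative 
     (\<lambda>v. (2 * (4 - y \<bullet> y) - 2 * (y \<bullet> y - 1)) * (y \<bullet> v))) (at y)"
    by (auto intro!: derivative_eq_intros simp: inner_commute algebra_simps)
  from diff_chain_at[OF this DERIV_max_square[unfolded has_field_derivative_def]]
  show ?thesis unfolding o_def annulus_cutoff_def[abs_def] 
    by (rule has_derivative_eq_rhs) (simp add: cutoff_slope_def fun_eq_iff algebra_simps)
qed

lemma cutoff_slope_zero:
  fixes y :: "'a::euclidean_space"
  assumes "norm y \<le> 1 \<or> norm y \<ge> 2" shows "cutoff_slope y = 0"
  using annulus_factor_nonpos[OF assms] by (simp add: cutoff_slope_def)

lemma continuous_on_annulus_cutoff [continuous_intros]: "continuous_on A annulus_cutoff"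
  unfolding annulus_cutoff_def[abs_def] by (intro continuous_intros)

lemma continuous_on_cutoff_slope [continuous_intros]: "continuous_on A cutoff_slope"
  unfolding cutoff_slope_def[abs_def] by (intro continuous_intros)

text \<open>The integral of a product over the sphere, up to a constant factor, in polar coordinates.\<close>

definition sphere_inner :: "('a::euclidean_space \<Rightarrow> real) \<Rightarrow> ('a \<Rightarrow> real) \<Rightarrow> real" where
  "sphere_inner f g =
     integral\<^sup>L lborel (\<lambda>y. annulus_cutoff y / norm y * (ray_extension f y * ray_extension g y))"

lemma integrable_sphere_inner:
  assumes "continuous_on (- {0}) h"
  shows "integrable lborel (\<lambda>y::'a::euclidean_space. annulus_cutoff y / norm y * h y)"
proof -
  have "integrable lborel (\<lambda>y::'a. indicator annulus y *\<^sub>R (annulus_cutoff y / norm y * h y))"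
    by (rule borel_integrable_compact[OF compact_annulus])
      (use annulus_subset in \<open>auto intro!: continuous_intros continuous_on_subset[OF assms]\<close>)
  also have "(\<lambda>y::'a. indicator annulus y *\<^sub>R (annulus_cutoff y / norm y * h y)) =
     (\<lambda>y. annulus_cutoff y / norm y * h y)"
  proof
    show "indicator annulus y *\<^sub>R (annulus_cutoff y / norm y * h y) = annulus_cutoff y / norm y * h y" for y :: 'a
      by (cases "y \<in> annulus") (auto simp: annulus_def annulus_cutoff_zero)
  qed
  finally show ?thesis .
qed

text \<open>Green's identity: the divergence of the cutoff times
  \<open>F * grad G - G * grad F\<close> integrates to 0. The derivative of the radial cutoff drops
  out against tangential gradients, the mixed gradient terms cancel, and
  \<open>(\<alpha> - \<beta>) * sphere_inner f g\<close> remains. The weight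
  \<open>1 / norm y\<close> in \<open>sphere_inner\<close> comes from
  \<open>ray_extension_gradient_divergence\<close>.\<close>

lemma sphere_laplacian_selfadjoint:
  fixes f g :: "'a::euclidean_space \<Rightarrow> real"
  assumes f: "smooth_on (- {0}) (ray_extension f)" and g: "smooth_on (- {0}) (ray_extension g)"
    and ef: "\<And>x. norm x = 1 \<Longrightarrow> sphere_laplacian f x = \<alpha> * f x"
    and eg: "\<And>x. norm x = 1 \<Longrightarrow> sphere_laplacian g x = \<beta> * g x"
    and ne: "\<alpha> \<noteq> \<beta>"
  shows "sphere_inner f g = 0"
proof -
  define F G where "F = ray_extension f" and "G = ray_extension g"
  define X Y where "X = ray_extension (sphere_gradient f)" and "Y = ray_extension (sphere_gradient g)"
  note sX = smooth_ray_extension_gradient[OF f, folded X_def]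
  note sY = smooth_ray_extension_gradient[OF g, folded Y_def]
  \<comment> \<open>The product rule for \<open>u b\<close> in direction \<open>v\<close>, valid
    away from the origin. Near the origin the cutoff is zero, which \<open>u'\<close> records by
    discarding \<open>E\<close> outside the annulus.\<close>
  define E where "E y v b = cutoff_slope y * (y \<bullet> v) * (F y * (Y y \<bullet> b) - G y * (X y \<bullet> b)) +
      annulus_cutoff y * ((X y \<bullet> v / norm y) * (Y y \<bullet> b) + F y * (frechet_derivative Y (at y) v \<bullet> b)
        - (Y y \<bullet> v / norm y) * (X y \<bullet> b) - G y * (frechet_derivative X (at y) v \<bullet> b))" for y v b
  define u where "u b y = annulus_cutoff y * (F y * (Y y \<bullet> b) - G y * (X y \<bullet> b))" for b y
  define u' where "u' b y v = (if y \<in> annulus then E y v b else 0)" for b y v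
  have E0: "E y v b = 0" if "y \<notin> annulus" for y v b
    using that by (auto simp: E_def annulus_def annulus_cutoff_zero cutoff_slope_zero)
  have der: "(u b has_derivative u' b y) (at y)" for b y
  proof (cases "y = 0")
    case True
    have "u' b y = (\<lambda>v. 0)" using True by (auto simp: u'_def annulus_def)
    moreover have "(u b has_derivative (\<lambda>v. 0)) (at y)"
      by (rule has_derivative_transform_within_open[where s = "ball 0 1" and f = "\<lambda>_. 0"])
        (use True in \<open>auto simp: u_def annulus_cutoff_zero\<close>)
    ultimately show ?thesis by simp
  next
    case False
    then have y: "y \<in> - {0}" by simp
    have "(u b has_derivative (\<lambda>v. E y v b)) (at y)"
      unfolding u_def
      by (rule has_derivative_eq_rhs, (rule derivative_intros annulus_cutoff_has_derivative 
         ray_extension_has_derivative[OF f False, folded F_def X_def]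
         ray_extension_has_derivative[OF g False, folded G_def Y_def]
         smooth_on_has_derivative[OF sX y] smooth_on_has_derivative[OF sY y])+)
       (simp add: E_def fun_eq_iff algebra_simps)
    moreover have "u' b y = (\<lambda>v. E y v b)" using E0 by (auto simp: u'_def)
    ultimately show ?thesis by simp
  qed
  have contE: "continuous_on annulus (\<lambda>y. E y b b)" for b
    unfolding E_def F_def G_def
    by (intro continuous_intros continuous_on_subset[OF smooth_on_continuous_on[OF f] annulus_subset]
      continuous_on_subset[OF smooth_on_continuous_on[OF g] annulus_subset]
      continuous_on_subset[OF smooth_on_continuous_on[OF sX] annulus_subset]
      continuous_on_subset[OF smooth_on_continuous_on[OF sY] annulus_subset]
      continuous_on_subset[OF smooth_on_continuous_on[OF smooth_on_derivative[OF sX]] annulus_subset]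
      continuous_on_subset[OF smooth_on_continuous_on[OF smooth_on_derivative[OF sY]] annulus_subset])
     (use annulus_subset in auto)
  have u'E: "u' b y b = indicator annulus y *\<^sub>R E y b b" for b y
    by (simp add: u'_def indicator_def)
  have "integral\<^sup>L lborel (\<lambda>y. u' b y b) = 0" for b
    by (rule integral_derivative_eq_0[OF der compact_annulus contE _ u'E])
       (auto simp: u_def annulus_def annulus_cutoff_zero)
  moreover have "integrable lborel (\<lambda>y. u' b y b)" for b
    unfolding u'E by (rule borel_integrable_compact[OF compact_annulus contE])
  ultimately have "integral\<^sup>L lborel (\<lambda>y. \<Sum>b\<in>Basis. u' b y b) = 0"
    by simp
  moreover have "(\<Sum>b\<in>Basis. u' b y b) = (\<alpha> - \<beta>) * (annulus_cutoff y / norm y * (F y * G y))" for y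
  proof (cases "y = 0")
    case True
    then show ?thesis by (simp add: u'_def annulus_def)
  next
    case False
    have n: "norm (sgn y) = 1" using False by (simp add: norm_sgn)
    have divX: "(\<Sum>b\<in>Basis. frechet_derivative X (at y) b \<bullet> b) = - \<alpha> * F y / norm y"
      using ray_extension_gradient_divergence[OF f False] ef[OF n] by (simp add: X_def F_def ray_extension_def)
    have divY: "(\<Sum>b\<in>Basis. frechet_derivative Y (at y) b \<bullet> b) = - \<beta> * G y / norm y"
      using ray_extension_gradient_divergence[OF g False] eg[OF n] by (simp add: Y_def G_def ray_extension_def)
    have rad: "(\<Sum>b\<in>Basis. (y \<bullet> b) * (X y \<bullet> b)) = 0" "(\<Sum>b\<in>Basis. (y \<bullet> b) * (Y y \<bullet> b)) = 0"
    proof -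
      have "X y \<bullet> y = 0" "Y y \<bullet> y = 0"
        using ray_extension_gradient_radial[OF f False] ray_extension_gradient_radial[OF g False]
        unfolding X_def Y_def by blast+
      then have "y \<bullet> X y = 0" "y \<bullet> Y y = 0" by (metis inner_commute)+
      then show "(\<Sum>b\<in>Basis. (y \<bullet> b) * (X y \<bullet> b)) = 0" "(\<Sum>b\<in>Basis. (y \<bullet> b) * (Y y \<bullet> b)) = 0"
        using euclidean_inner[of y "X y"] euclidean_inner[of y "Y y"] by (metis, metis)
    qed
    have "(\<Sum>b\<in>Basis. u' b y b) = (\<Sum>b\<in>Basis. E y b b)"
      using E0 by (intro sum.cong) (auto simp: u'_def)
    also have "\<dots> = cutoff_slope y * (F y * (\<Sum>b\<in>Basis. (y \<bullet> b) * (Y y \<bullet> b)) - G y * (\<Sum>b\<in>Basis. (y \<bullet> b) * (X y \<bullet> b)))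
        + annulus_cutoff y * (F y * (\<Sum>b\<in>Basis. frechet_derivative Y (at y) b \<bullet> b)
         - G y * (\<Sum>b\<in>Basis. frechet_derivative X (at y) b \<bullet> b))"
      by (simp add: E_def sum.distrib sum_subtractf sum_distrib_left algebra_simps)
    also have "\<dots> = (\<alpha> - \<beta>) * (annulus_cutoff y / norm y * (F y * G y))"
      unfolding divX divY rad using False by (simp add: field_simps)
    finally show ?thesis .
  qed
  ultimately have "(\<alpha> - \<beta>) * sphere_inner f g = 0"
    by (simp only: sphere_inner_def F_def G_def integral_mult_right_zero)
  then show ?thesis using ne by simp
qed

lemma sphere_inner_commute: "sphere_inner f g = sphere_inner g f"
  by (simp add: sphere_inner_def mult.commute)

lemma continuous_ray_extension:
  "f \<in> smooth_sphere_functions \<Longrightarrow> continuous_on (- {0}) (ray_extension f)"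
  using sphere_smooth_ray_extension smooth_on_continuous_on by blast

lemma sphere_inner_add:
  assumes "f \<in> smooth_sphere_functions" "f' \<in> smooth_sphere_functions" "g \<in> smooth_sphere_functions"
  shows "sphere_inner (f + f') g = sphere_inner f g + sphere_inner f' g"
proof -
  have "sphere_inner (f + f') g = integral\<^sup>L lborel (\<lambda>y. annulus_cutoff y / norm y * (ray_extension f y * ray_extension g y)
    + annulus_cutoff y / norm y * (ray_extension f' y * ray_extension g y))"
    unfolding sphere_inner_def by (intro Bochner_Integration.integral_cong) (auto simp: ray_extension_def algebra_simps)
  also have "\<dots> = sphere_inner f g + sphere_inner f' g"
    unfolding sphere_inner_def
    by (intro Bochner_Integration.integral_add integrable_sphere_inner continuous_intros continuous_ray_extension assms)
  finally show ?thesis .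
qed

lemma sphere_inner_scale: "sphere_inner (\<lambda>x. c * f x) g = c * sphere_inner f g"
proof -
  have "sphere_inner (\<lambda>x. c * f x) g = integral\<^sup>L lborel (\<lambda>y. c * (annulus_cutoff y / norm y * (ray_extension f y * ray_extension g y)))"
    unfolding sphere_inner_def by (intro Bochner_Integration.integral_cong) (auto simp: ray_extension_def algebra_simps)
  then show ?thesis by (simp only: sphere_inner_def integral_mult_right_zero)
qed

text \<open>The points of the open shell where the ray extension is nonzero form an open null set,
  hence the empty set, and every ray meets the shell at radius 3/2.\<close>

lemma sphere_inner_definite:
  assumes f: "f \<in> smooth_sphere_functions" and 0: "sphere_inner f f = 0"
  shows "f = 0"
proof -
  let ?F = "ray_extension f"
  let ?\<phi> = "\<lambda>y. annulus_cutoff y / norm y * (?F y * ?F y)"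
  have int: "integrable lborel ?\<phi>"
    by (intro integrable_sphere_inner continuous_intros continuous_ray_extension f)
  have nn: "?\<phi> y \<ge> 0" for y by (simp add: annulus_cutoff_def)
  have "AE y in lborel. ?\<phi> y = 0"
    using 0 integral_nonneg_eq_0_iff_AE[OF int] nn by (simp add: sphere_inner_def)
  then have ae: "AE y in lborel. \<not> (y \<in> (ball 0 2 - cball 0 1) \<and> ?F y \<noteq> 0)"
  proof (rule AE_mp, intro AE_I2 impI notI)
    fix y :: 'a assume *: "?\<phi> y = 0" "y \<in> ball 0 2 - cball 0 1 \<and> ?F y \<noteq> 0"
    then have "annulus_cutoff y > 0" "y \<noteq> 0" by (auto intro: annulus_cutoff_pos)
    with * show False by simp
  qed
  let ?S = "{y \<in> ball 0 2 - cball 0 1. ?F y \<noteq> 0}"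
  have "continuous_on (ball 0 2 - cball 0 1) ?F"
    by (rule continuous_on_subset[OF continuous_ray_extension[OF f]]) auto
  moreover have "?S = (ball 0 2 - cball 0 1) \<inter> ?F -` (- {0})" by auto
  ultimately have op: "open ?S"
    by (metis continuous_on_open_vimage open_Compl open_Diff open_ball closed_cball closed_singleton Int_commute)
  have "?S \<in> null_sets lborel"
    using ae op by (subst AE_iff_null_sets) auto
  then have "negligible ?S" using null_sets_completionI negligible_iff_null_sets by blast
  then have emp: "?S = {}" using open_not_negligible op by blast
  have "f x = 0" if x: "norm x = 1" for x
  proof -
    have "(3/2) *\<^sub>R x \<notin> ?S" using emp by blast
    then have "?F ((3/2) *\<^sub>R x) = 0" using x by auto
    then show ?thesis using ray_extension_scaleR[of "3/2" f x] ray_extension_on_sphere[OF x, of f] by simp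
  qed
  then show ?thesis
    using smooth_sphere_functions_zero[OF f] by (metis fun_eq_iff zero_fun_apply)
qed

text \<open>Gram-Schmidt: \<open>b'\<close> is the part of the new vector orthogonal to the old
  span, and the old projection is corrected along it.\<close>

lemma sphere_projection_exists:
  assumes "finite B" "B \<subseteq> smooth_sphere_functions" "f \<in> smooth_sphere_functions"
  shows "\<exists>g \<in> real_functions.span B. \<forall>h \<in> real_functions.span B. sphere_inner (f - g) h = 0"
  using assms
proof (induction B arbitrary: f rule: finite_induct)
  case empty
  show ?case by (auto simp: sphere_inner_def ray_extension_def)
next
  case (insert b B)
  let ?S = "smooth_sphere_functions :: ('a \<Rightarrow> real) set"
  note sub = smooth_sphere_functions_subspace
  have diff: "u - v \<in> ?S" if "u \<in> ?S" "v \<in> ?S" for u v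
    using that real_functions.subspace_diff[OF sub] by blast
  have span: "real_functions.span A \<subseteq> ?S" if "A \<subseteq> ?S" for A
    using that real_functions.span_minimal[OF _ sub] by blast
  have sc: "(\<lambda>x. c * u x) \<in> ?S" if "u \<in> ?S" for c u using that smooth_sphere_functions_scale by blast
  have innr: "sphere_inner u (v + w) = sphere_inner u v + sphere_inner u w" if "u \<in> ?S" "v \<in> ?S" "w \<in> ?S" for u v w
    using that sphere_inner_add sphere_inner_commute by metis
  have innc: "sphere_inner u (\<lambda>x. c * v x) = c * sphere_inner u v" for u v :: "'a \<Rightarrow> real" and c
    using sphere_inner_scale sphere_inner_commute by metis
  have innd: "sphere_inner (u - v) w = sphere_inner u w - sphere_inner v w" if "u \<in> ?S" "v \<in> ?S" "w \<in> ?S" for u v w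
    using sphere_inner_add[of "u - v" v w] that diff by simp
  have bS: "b \<in> ?S" "B \<subseteq> ?S" using insert.prems by auto
  obtain p where p: "p \<in> real_functions.span B" "\<forall>h \<in> real_functions.span B. sphere_inner (b - p) h = 0"
    using insert.IH[OF bS(2,1)] by blast
  obtain g where g: "g \<in> real_functions.span B" "\<forall>h \<in> real_functions.span B. sphere_inner (f - g) h = 0"
    using insert.IH[OF bS(2) insert.prems(2)] by blast
  have S: "p \<in> ?S" "g \<in> ?S" using p g span[OF bS(2)] by auto
  define b' where "b' = b - p"
  have b'S: "b' \<in> ?S" using bS S diff by (simp add: b'_def)
  \<comment> \<open>If \<open>b\<close> already lies in the old span, then \<open>b'\<close> is
    zero, division by zero makes \<open>c\<close> zero, and the correction disappears as it
    should.\<close>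
  define c where "c = sphere_inner (f - g) b' / sphere_inner b' b'"
  define g' where "g' = g + (\<lambda>x. c * b' x)"
  have g'S: "f - g' \<in> ?S" "f - g \<in> ?S" using insert.prems S b'S sc diff smooth_sphere_functions_add unfolding g'_def by blast+
  have fg': "f - g' = (f - g) - (\<lambda>x. c * b' x)" by (simp add: g'_def algebra_simps)
  have perpB: "sphere_inner (f - g') h = 0" if "h \<in> real_functions.span B" for h
  proof -
    have "sphere_inner b' h = 0" "sphere_inner (f - g) h = 0"
      unfolding b'_def using that p(2) g(2) by blast+
    then show ?thesis
      unfolding fg' using that span[OF bS(2)] g'S b'S sc[OF b'S]
      by (subst innd) (auto simp only: sphere_inner_scale mult_zero_right diff_0_right)
  qed
  have perpb': "sphere_inner (f - g') b' = 0"
  proof (cases "sphere_inner b' b' = 0")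
    case True
    then have "b' = 0" using sphere_inner_definite b'S by blast
    then show ?thesis by (simp add: sphere_inner_def ray_extension_def)
  next
    case False
    then have "sphere_inner (f - g) b' - c * sphere_inner b' b' = 0" by (simp add: c_def)
    then show ?thesis unfolding fg' using g'S b'S sc[OF b'S]
      by (subst innd) (auto simp only: sphere_inner_scale)
  qed
  have mono: "real_functions.span B \<subseteq> real_functions.span (insert b B)"
    by (intro real_functions.span_mono) auto
  have "g' \<in> real_functions.span (insert b B)"
    unfolding g'_def b'_def using p(1) g(1) mono
    by (intro real_functions.span_add real_functions.span_scale[of "b - p"] real_functions.span_diff)
      (auto intro: real_functions.span_base)
  moreover have "sphere_inner (f - g') h = 0" if h: "h \<in> real_functions.span (insert b B)" for h
  proof -
    obtain k where k: "h - (\<lambda>x. k * b x) \<in> real_functions.span B"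
      using h unfolding real_functions.span_insert by auto
    let ?q = "h - (\<lambda>x. k * b x) + (\<lambda>x. k * p x)"
    have q: "?q \<in> real_functions.span B"
      using k p(1) by (intro real_functions.span_add real_functions.span_scale)
    have "h = ?q + (\<lambda>x. k * b' x)" by (simp add: b'_def fun_eq_iff algebra_simps)
    then have "sphere_inner (f - g') h = sphere_inner (f - g') ?q + k * sphere_inner (f - g') b'"
      using innr[of "f - g'" ?q "\<lambda>x. k * b' x"] q span[OF bS(2)] g'S b'S sc innc by (metis subsetD)
    then show ?thesis using perpB[OF q] perpb' by simp
  qed
  ultimately show ?case by blast
qed

section \<open>Homogeneous functions and monomials\<close>

lemma
  fixes p :: "'a::euclidean_space \<Rightarrow> real"
  assumes p: "smooth_on UNIV p" and hom: "\<And>c y. c > 0 \<Longrightarrow> p (c *\<^sub>R y) = c ^ k * p y"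
  shows homogeneous_Euler: "frechet_derivative p (at y) y = k * p y"
    and homogeneous_derivative_scaleR: "c > 0 \<Longrightarrow>
      c * frechet_derivative p (at (c *\<^sub>R y)) v = c ^ k * frechet_derivative p (at y) v"
proof -
  have der: "(p has_derivative frechet_derivative p (at y)) (at y)" for y
    using smooth_on_has_derivative[OF p] by simp
  have lin: "linear (frechet_derivative p (at y))" for y
    using has_derivative_linear[OF der] .
  have d1: "((\<lambda>t. t *\<^sub>R y) has_derivative (\<lambda>t. t *\<^sub>R y)) (at (1::real))"
    by (auto intro!: derivative_eq_intros)
  have d2: "(p has_derivative frechet_derivative p (at y)) (at (1 *\<^sub>R y))" using der by simp
  have "((\<lambda>t. p (t *\<^sub>R y)) has_derivative (\<lambda>t. frechet_derivative p (at y) (t *\<^sub>R y))) (at 1)"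
    using diff_chain_at[OF d1 d2] by (simp add: o_def)
  moreover have "((\<lambda>t. p (t *\<^sub>R y)) has_derivative (\<lambda>t. t * k * p y)) (at (1::real))"
  proof (rule has_derivative_transform_within_open[where s = "{0<..}" and f = "\<lambda>t. t ^ k * p y"])
    show "((\<lambda>t. t ^ k * p y) has_derivative (\<lambda>t. t * k * p y)) (at (1::real))"
      by (auto intro!: derivative_eq_intros)
  qed (use hom in auto)
  ultimately have "(\<lambda>t::real. frechet_derivative p (at y) (t *\<^sub>R y)) = (\<lambda>t::real. t * k * p y)"
    by (rule has_derivative_unique)
  from fun_cong[OF this, of 1] show "frechet_derivative p (at y) y = k * p y" by simp
  assume c: "c > 0"
  have "((\<lambda>u. c *\<^sub>R u) has_derivative (\<lambda>u. c *\<^sub>R u)) (at y)"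
    by (auto intro!: derivative_eq_intros)
  from diff_chain_at[OF this der]
  have "((\<lambda>u. p (c *\<^sub>R u)) has_derivative (\<lambda>v. frechet_derivative p (at (c *\<^sub>R y)) (c *\<^sub>R v))) (at y)"
    by (simp add: o_def)
  moreover have "((\<lambda>u. p (c *\<^sub>R u)) has_derivative (\<lambda>v. c ^ k * frechet_derivative p (at y) v)) (at y)"
    unfolding hom[OF c] by (intro has_derivative_mult_right der)
  ultimately have "(\<lambda>v. frechet_derivative p (at (c *\<^sub>R y)) (c *\<^sub>R v)) = (\<lambda>v. c ^ k * frechet_derivative p (at y) v)"
    by (rule has_derivative_unique)
  from fun_cong[OF this, of v] show "c * frechet_derivative p (at (c *\<^sub>R y)) v = c ^ k * frechet_derivative p (at y) v"
    by (simp add: linear_scale[OF lin])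
qed

text \<open>Off the origin the ray extension is \<open>p y\<close> times the norm to the power
  \<open>-k\<close>. Differentiating this formula twice and taking the trace leaves the Euclidean
  Laplacian; the remaining terms combine by Euler's identity.\<close>

lemma sphere_laplacian_homogeneous:
  fixes p :: "'a::euclidean_space \<Rightarrow> real"
  assumes p: "smooth_on UNIV p" and hom: "\<And>c y. c > 0 \<Longrightarrow> p (c *\<^sub>R y) = c ^ k * p y"
    and x: "norm x = 1"
  shows "sphere_laplacian (\<lambda>x. if norm x = 1 then p x else 0) x =
    k * (k + real DIM('a) - 2) * p x -
      (\<Sum>b\<in>Basis. frechet_derivative (\<lambda>y. frechet_derivative p (at y) b) (at x) b)"
proof -
  let ?f = "\<lambda>x. if norm x = 1 then p x else 0"
  let ?i = "\<lambda>y::'a. inverse (norm y)"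
  define D where "D y v = frechet_derivative p (at y) v" for y v
  have der: "(p has_derivative D y) (at y)" for y
    using smooth_on_has_derivative[OF p] by (simp add: D_def[abs_def])
  have lin: "linear (D y)" for y
    using has_derivative_linear[OF der] .
  have derD: "((\<lambda>y. D y b) has_derivative frechet_derivative (\<lambda>y. D y b) (at x)) (at x)" for b
    using smooth_on_has_derivative[OF smooth_on_derivative[OF p], of x b] by (simp add: D_def)
  have sgn_hom: "p (sgn y) = ?i y ^ k * p y" if "y \<noteq> 0" for y
    using hom[of "?i y" y] that by (simp add: sgn_div_norm)
  \<comment> \<open>The factor \<open>norm y * ?i y ^ k\<close> is the norm to the power
    \<open>1 - k\<close>, written so that \<open>k = 0\<close> is not a special case.\<close>
  have D_hom: "D (sgn y) v = norm y * ?i y ^ k * D y v" if "y \<noteq> 0" for y v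
    using homogeneous_derivative_scaleR[OF p hom, of "?i y" y v] that
    by (simp add: sgn_div_norm D_def field_simps)
  have fx: "(ray_extension ?f has_derivative (\<lambda>v. D u v - k * (u \<bullet> v) * p u)) (at u)"
    if u: "norm u = 1" for u
  proof (rule has_derivative_transform_within_open[where s = "- {0}" and f = "\<lambda>y. ?i y ^ k * p y"])
    have "u \<noteq> 0" using u by auto
    show "((\<lambda>y. ?i y ^ k * p y) has_derivative (\<lambda>v. D u v - k * (u \<bullet> v) * p u)) (at u)"
      by (rule has_derivative_eq_rhs, (rule has_derivative_mult has_derivative_inverse_norm_power \<open>u \<noteq> 0\<close> der)+)
        (simp add: u)
  qed (use u sgn_hom in \<open>auto simp: ray_extension_def norm_sgn\<close>)
  have grad: "sphere_gradient ?f u = (\<Sum>b\<in>Basis. D u b *\<^sub>R b) - (k * p u) *\<^sub>R u" if u: "norm u = 1" for u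
  proof -
    have "sphere_gradient ?f u = (\<Sum>b\<in>Basis. (D u b - k * (u \<bullet> b) * p u) *\<^sub>R b)"
      unfolding sphere_gradient_def frechet_derivative_at[OF fx[OF u], symmetric] ..
    also have "\<dots> = (\<Sum>b\<in>Basis. D u b *\<^sub>R b) - (k * p u) *\<^sub>R (\<Sum>b\<in>Basis. (u \<bullet> b) *\<^sub>R b)"
      by (simp add: scaleR_diff_left sum_subtractf scaleR_sum_right algebra_simps)
    finally show ?thesis by (simp add: euclidean_representation)
  qed
  define W where "W y = (\<Sum>b\<in>Basis. D y b *\<^sub>R b)" for y
  define W' where "W' v = (\<Sum>b\<in>Basis. frechet_derivative (\<lambda>y. D y b) (at x) v *\<^sub>R b)" for v
  have derW: "(W has_derivative W') (at x)"
    unfolding W_def[abs_def] W'_def[abs_def] by (intro has_derivative_sum has_derivative_scaleR_left derD)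
  have x0: "x \<noteq> 0" using x by auto
  have derY: "(ray_extension (sphere_gradient ?f) has_derivative
     (\<lambda>v. ((1 - real k) * (x \<bullet> v)) *\<^sub>R W x + W' v - (k * (D x v - (k + 1) * (x \<bullet> v) * p x)) *\<^sub>R x - (k * p x) *\<^sub>R v)) (at x)"
  proof (rule has_derivative_transform_within_open[where s = "- {0}" and
      f = "\<lambda>y. (norm y * ?i y ^ k) *\<^sub>R W y - (k * (?i y ^ (k + 1) * p y)) *\<^sub>R y"])
    show "(norm y * ?i y ^ k) *\<^sub>R W y - (k * (?i y ^ (k + 1) * p y)) *\<^sub>R y = ray_extension (sphere_gradient ?f) y"
      if "y \<in> - {0}" for y
    proof -
      have y: "y \<noteq> 0" using that by simp
      have "ray_extension (sphere_gradient ?f) y = W (sgn y) - (k * p (sgn y)) *\<^sub>R sgn y"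
        using grad[of "sgn y"] y by (simp add: ray_extension_def norm_sgn W_def)
      also have "W (sgn y) = (norm y * ?i y ^ k) *\<^sub>R W y"
        unfolding W_def D_hom[OF y] by (simp add: scaleR_sum_right)
      finally show ?thesis unfolding sgn_hom[OF y] by (simp add: sgn_div_norm mult_ac)
    qed
    show "((\<lambda>y. (norm y * ?i y ^ k) *\<^sub>R W y - (k * (?i y ^ (k + 1) * p y)) *\<^sub>R y) has_derivative 
      (\<lambda>v. ((1 - real k) * (x \<bullet> v)) *\<^sub>R W x + W' v - (k * (D x v - (k + 1) * (x \<bullet> v) * p x)) *\<^sub>R x - (k * p x) *\<^sub>R v)) (at x)"
      by (rule has_derivative_eq_rhs, (rule has_derivative_diff has_derivative_scaleR has_derivative_mult has_derivative_norm
          has_derivative_inverse_norm_power x0 der derW has_derivative_ident has_derivative_const)+)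
        (simp add: fun_eq_iff x sgn_div_norm inner_commute algebra_simps)
  qed (use x0 in auto)
  have DW: "(\<Sum>b\<in>Basis. (x \<bullet> b) * (W x \<bullet> b)) = k * p x"
  proof -
    have "(\<Sum>b\<in>Basis. (x \<bullet> b) * (W x \<bullet> b)) = x \<bullet> W x" by (rule euclidean_inner[symmetric])
    also have "\<dots> = (\<Sum>b\<in>Basis. (x \<bullet> b) * D x b)" by (simp add: W_def inner_sum_right mult.commute)
    also have "\<dots> = D x (\<Sum>b\<in>Basis. (x \<bullet> b) *\<^sub>R b)"
      by (simp add: linear_sum[OF lin] linear_scale[OF lin])
    also have "\<dots> = k * p x"
      using homogeneous_Euler[OF p hom, of x] by (simp add: euclidean_representation D_def)
    finally show ?thesis .
  qed
  have Dx: "(\<Sum>b\<in>Basis. D x b * (x \<bullet> b)) = k * p x"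
    using homogeneous_Euler[OF p hom, of x] linear_sum[OF lin, of x "\<lambda>b. (x \<bullet> b) *\<^sub>R b" Basis]
    by (simp add: euclidean_representation D_def[symmetric] linear_scale[OF lin] mult.commute)
  have xx: "(\<Sum>b\<in>Basis. (x \<bullet> b) * (x \<bullet> b)) = 1"
    using euclidean_inner[of x x] x by (simp add: dot_square_norm)
  have W'b: "W' b \<bullet> b = frechet_derivative (\<lambda>y. D y b) (at x) b" if "b \<in> Basis" for b
    using that by (simp add: W'_def inner_sum_left inner_Basis if_distrib cong: if_cong)
  have bb: "(\<Sum>b\<in>(Basis::'a set). b \<bullet> b) = real DIM('a)" by (simp add: inner_same_Basis)
  have "- sphere_laplacian ?f x = (\<Sum>b\<in>Basis. (((1 - real k) * (x \<bullet> b)) *\<^sub>R W x + W' b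
        - (k * (D x b - (k + 1) * (x \<bullet> b) * p x)) *\<^sub>R x - (k * p x) *\<^sub>R b) \<bullet> b)"
    unfolding sphere_laplacian_def sphere_divergence_def frechet_derivative_at[OF derY, symmetric] by simp
  also have "\<dots> = (1 - real k) * (\<Sum>b\<in>Basis. (x \<bullet> b) * (W x \<bullet> b)) + (\<Sum>b\<in>Basis. W' b \<bullet> b)
      - k * (\<Sum>b\<in>Basis. D x b * (x \<bullet> b)) + k * (k + 1) * p x * (\<Sum>b\<in>Basis. (x \<bullet> b) * (x \<bullet> b)) - k * p x * (\<Sum>b\<in>(Basis::'a set). b \<bullet> b)"
    by (simp add: inner_diff_left inner_add_left sum.distrib sum_subtractf sum_distrib_left algebra_simps)
  also have "(\<Sum>b\<in>Basis. W' b \<bullet> b) = (\<Sum>b\<in>Basis. frechet_derivative (\<lambda>y. D y b) (at x) b)"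
    by (intro sum.cong W'b refl)
  finally show ?thesis unfolding DW Dx xx bb by (simp add: D_def algebra_simps)
qed

section \<open>Monomials in the coordinates and their conjugates\<close>

definition coordinate :: "'n + 'n \<Rightarrow> complex ^ 'n::finite \<Rightarrow> complex" where
  "coordinate j z = (case j of Inl i \<Rightarrow> z $ i | Inr i \<Rightarrow> cnj (z $ i))"

text \<open>\<open>Inl i\<close> indexes \<open>z $ i\<close> and \<open>Inr i\<close> its
  conjugate. These are thus ordinary monomials in twice as many variables, and both kinds of
  coordinates are treated alike.\<close>

definition bimonomial :: "('n + 'n \<Rightarrow> nat) \<Rightarrow> complex ^ 'n::finite \<Rightarrow> complex" where
  "bimonomial x z = (\<Prod>j\<in>UNIV. coordinate j z ^ x j)"

definition conj_index :: "'n + 'n \<Rightarrow> 'n + 'n" where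
  "conj_index j = (case j of Inl i \<Rightarrow> Inr i | Inr i \<Rightarrow> Inl i)"

text \<open>At \<open>x j = 0\<close> truncated subtraction leaves \<open>x\<close> unchanged. In
  derivatives this is harmless, because the factor \<open>x j\<close> vanishes.\<close>

definition lower :: "'n + 'n \<Rightarrow> ('n + 'n \<Rightarrow> nat) \<Rightarrow> 'n + 'n \<Rightarrow> nat" where
  "lower j x = x(j := x j - 1)"

lemma conj_index_simps [simp]:
  "conj_index (Inl i) = Inr i" "conj_index (Inr i) = Inl i"
  "conj_index (conj_index j) = j" "conj_index j \<noteq> j"
  by (auto simp: conj_index_def split: sum.splits)

lemma bij_conj_index: "bij conj_index"
  by (rule o_bij[of conj_index]) (auto simp: fun_eq_iff)

lemma coordinate_conj_index: "coordinate (conj_index j) z = cnj (coordinate j z)"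
  by (auto simp: coordinate_def conj_index_def split: sum.splits)

lemma bounded_linear_coordinate: "bounded_linear (coordinate j)"
proof (cases j)
  case (Inl i)
  then have "coordinate j = (\<lambda>z. z $ i)" by (auto simp: coordinate_def)
  then show ?thesis by (simp add: bounded_linear_vec_nth)
next
  case (Inr i)
  then have "coordinate j = (\<lambda>z. cnj (z $ i))" by (auto simp: coordinate_def)
  then show ?thesis
    by (simp add: bounded_linear_compose[OF bounded_linear_cnj bounded_linear_vec_nth])
qed

lemma bimonomial_has_derivative:
  "(bimonomial x has_derivative
    (\<lambda>v. \<Sum>j\<in>UNIV. of_nat (x j) * coordinate j v * bimonomial (lower j x) z)) (at z)"
proof -
  have 1: "((\<lambda>z. coordinate j z ^ x j) has_derivative
      (\<lambda>v. of_nat (x j) * coordinate j v * coordinate j z ^ (x j - 1))) (at z)" for j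
    by (rule has_derivative_power bounded_linear_imp_has_derivative[OF bounded_linear_coordinate])+
  have 2: "bimonomial (lower j x) z = coordinate j z ^ (x j - 1) * (\<Prod>l\<in>UNIV - {j}. coordinate l z ^ x l)" for j
    unfolding bimonomial_def
    by (subst prod.remove[of UNIV j]) (auto simp: lower_def intro!: prod.cong)
  show ?thesis
    unfolding bimonomial_def[of x, abs_def]
    by (rule has_derivative_eq_rhs[OF has_derivative_prod[OF 1]]) (simp add: 2 fun_eq_iff mult.assoc)
qed

lemma bimonomial_smooth: "smooth_on UNIV (bimonomial x)"
  unfolding bimonomial_def[abs_def]
  by (intro smooth_on_prod smooth_on_power smooth_on_bounded_linear bounded_linear_coordinate) auto

lemma bimonomial_mult: "bimonomial x (\<chi> i. z $ i * w $ i) = bimonomial x z * bimonomial x w"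
  by (simp add: bimonomial_def prod.distrib[symmetric] power_mult_distrib[symmetric])
    (auto intro!: prod.cong simp: coordinate_def split: sum.splits)

lemma bimonomial_scaleR: "bimonomial x (c *\<^sub>R z) = of_real (c ^ sum x UNIV) * bimonomial x z"
proof -
  have "coordinate j (c *\<^sub>R z) = of_real c * coordinate j z" for j
    using linear_scale[OF bounded_linear.linear[OF bounded_linear_coordinate], of j c z] by (simp add: scaleR_conv_of_real)
  then show ?thesis
    by (simp add: bimonomial_def power_mult_distrib prod.distrib power_sum)
qed

lemma bimonomial_conj: "bimonomial (x \<circ> conj_index) z = cnj (bimonomial x z)"
proof -
  have "bimonomial (x \<circ> conj_index) z = (\<Prod>j\<in>UNIV. coordinate (conj_index j) z ^ x j)"
    unfolding bimonomial_def
    using prod.reindex_bij_betw[OF bij_conj_index, of "\<lambda>j. coordinate (conj_index j) z ^ x j"] by simp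
  then show ?thesis by (simp add: bimonomial_def coordinate_conj_index)
qed

lemma sum_Basis_complex_vec:
  fixes f :: "complex ^ 'n::finite \<Rightarrow> 'b::comm_monoid_add"
  shows
  "(\<Sum>v\<in>Basis. f v) = (\<Sum>i\<in>UNIV. f (axis i (1::complex)) + f (axis i \<i>))"
proof -
  have "(\<Sum>v\<in>Basis. f v) = (\<Sum>i\<in>UNIV. sum f ((\<lambda>u. axis i u) ` (Basis :: complex set)))"
    unfolding Basis_vec_def
    by (subst sum.UNION_disjoint) (auto simp: axis_eq_axis UNION_singleton_eq_range)
  moreover have "sum f ((\<lambda>u. axis i u) ` (Basis :: complex set)) = f (axis i 1) + f (axis i \<i>)" for i
    by (auto simp: Basis_complex_def axis_eq_axis)
  ultimately show ?thesis by simp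
qed

text \<open>On each complex line the basis vectors 1 and i contribute \<open>1 + i * i = 0\<close>
  for a coordinate with itself and \<open>1 + i * cnj i = 2\<close> for a conjugate pair. Hence the
  Laplacian consists of mixed derivatives only.\<close>

lemma sum_Basis_coordinate_mult:
  "(\<Sum>v\<in>Basis. coordinate j v * coordinate l v) = (if l = conj_index j then 2 else 0)"
proof -
  have "(\<Sum>v\<in>Basis. coordinate j v * coordinate l v) =
     (\<Sum>i\<in>UNIV. coordinate j (axis i 1) * coordinate l (axis i 1) + coordinate j (axis i \<i>) * coordinate l (axis i \<i>))"
    by (rule sum_Basis_complex_vec)
  also have "\<dots> = (if l = conj_index j then 2 else 0)"
    by (cases j; cases l) (auto simp: coordinate_def axis_def if_distrib[of cnj] mult_if_delta 
       if_distrib[of "\<lambda>x. x * _"] sum.distrib cong: if_cong)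
  finally show ?thesis .
qed

lemma sphere_sum_coordinate:
  assumes "norm (z :: complex ^ 'n::finite) = 1"
  shows "(\<Sum>i\<in>UNIV. coordinate (Inl i) z * coordinate (Inr i) z) = 1"
proof -
  have "(\<Sum>i\<in>UNIV. coordinate (Inl i) z * coordinate (Inr i) z) = (\<Sum>i\<in>UNIV. complex_of_real ((norm (z $ i))\<^sup>2))"
    by (simp add: coordinate_def complex_norm_square del: of_real_power)
  also have "\<dots> = complex_of_real ((norm z)\<^sup>2)"
    by (simp add: norm_vec_def L2_set_def sum_nonneg)
  finally show ?thesis using assms by simp
qed

text \<open>Each exponent has to yield exactly one real function, so that real dimensions are
  numbers of exponents. An exponent and its conjugate yield \<open>Re + Im\<close> and
  \<open>Re - Im\<close> of one monomial, which together span \<open>Re\<close> and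
  \<open>Im\<close>.\<close>

definition re_im :: "complex \<Rightarrow> real" where "re_im w = Re w + Im w"

definition sphere_monomial :: "('n + 'n \<Rightarrow> nat) \<Rightarrow> complex ^ 'n::finite \<Rightarrow> real" where
  "sphere_monomial x = (\<lambda>z. if norm z = 1 then re_im (bimonomial x z) else 0)"

lemma bounded_linear_re_im: "bounded_linear re_im"
  unfolding re_im_def[abs_def] by (intro bounded_linear_add bounded_linear_Re bounded_linear_Im)

lemma re_im_simps:
  "re_im (a + b) = re_im a + re_im b" "re_im (of_real c * a) = c * re_im a" "re_im (of_nat n * a) = n * re_im a"
  "re_im (sum h A) = (\<Sum>a\<in>A. re_im (h a))" "re_im 0 = 0" "re_im (a - b) = re_im a - re_im b"
  by (auto simp: re_im_def sum.distrib algebra_simps)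

lemma re_im_bimonomial_smooth: "smooth_on UNIV (\<lambda>z. re_im (bimonomial x z))"
  by (rule smooth_on_linear_image[OF open_UNIV bounded_linear_re_im bimonomial_smooth])

lemma sphere_monomial_smooth: "sphere_monomial x \<in> smooth_sphere_functions"
  unfolding sphere_monomial_def by (intro smooth_sphere_functions_restrict re_im_bimonomial_smooth)

lemma lower_other: "lower j x (conj_index j) = x (conj_index j)"
  by (simp add: lower_def)

text \<open>Each conjugate pair occurs twice in the sum over \<open>j\<close>, which turns the
  factor 2 into the usual factor 4 of the mixed second derivatives.\<close>

lemma laplacian_re_im_bimonomial:
  "(\<Sum>b\<in>Basis. frechet_derivative (\<lambda>y. frechet_derivative (\<lambda>z. re_im (bimonomial x z)) (at y) b) (at z) b) =
   (\<Sum>j\<in>UNIV. real (2 * x j * x (conj_index j)) * re_im (bimonomial (lower (conj_index j) (lower j x)) z))"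
proof -
  have d1: "frechet_derivative (\<lambda>z. re_im (bimonomial x z)) (at y) =
      (\<lambda>v. re_im (\<Sum>j\<in>UNIV. of_nat (x j) * coordinate j v * bimonomial (lower j x) y))" for x y
    by (intro frechet_derivative_at[symmetric] bounded_linear.has_derivative[OF bounded_linear_re_im]
      bimonomial_has_derivative)
  have d2: "frechet_derivative (\<lambda>y. re_im (\<Sum>j\<in>UNIV. of_nat (x j) * coordinate j b * bimonomial (lower j x) y)) (at z) =
     (\<lambda>v. re_im (\<Sum>j\<in>UNIV. of_nat (x j) * coordinate j b *
        (\<Sum>l\<in>UNIV. of_nat (lower j x l) * coordinate l v * bimonomial (lower l (lower j x)) z)))" for b
    by (intro frechet_derivative_at[symmetric] bounded_linear.has_derivative[OF bounded_linear_re_im]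
      has_derivative_sum has_derivative_mult_right bimonomial_has_derivative)
  have "(\<Sum>b\<in>Basis. \<Sum>j\<in>UNIV. of_nat (x j) * coordinate j b *
        (\<Sum>l\<in>UNIV. of_nat (lower j x l) * coordinate l b * bimonomial (lower l (lower j x)) z)) =
     (\<Sum>j\<in>UNIV. \<Sum>l\<in>UNIV. of_nat (x j * lower j x l) * bimonomial (lower l (lower j x)) z *
        (\<Sum>b\<in>Basis. coordinate j b * coordinate l b))"
    by (simp add: sum_distrib_left sum_distrib_right mult_ac)
      (subst sum.swap, intro sum.cong refl, rule sum.swap)
  also have "\<dots> = (\<Sum>j\<in>UNIV. of_nat (2 * x j * x (conj_index j)) * bimonomial (lower (conj_index j) (lower j x)) z)"
    unfolding sum_Basis_coordinate_mult
    by (intro sum.cong refl) (simp add: mult_delta_right lower_other)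
  finally have e: "(\<Sum>b\<in>Basis. \<Sum>j\<in>UNIV. of_nat (x j) * coordinate j b *
        (\<Sum>l\<in>UNIV. of_nat (lower j x l) * coordinate l b * bimonomial (lower l (lower j x)) z)) =
     (\<Sum>j\<in>UNIV. of_nat (2 * x j * x (conj_index j)) * bimonomial (lower (conj_index j) (lower j x)) z)" .
  have "(\<Sum>b\<in>Basis. frechet_derivative (\<lambda>y. frechet_derivative (\<lambda>z. re_im (bimonomial x z)) (at y) b) (at z) b) =
     re_im (\<Sum>b\<in>Basis. \<Sum>j\<in>UNIV. of_nat (x j) * coordinate j b *
        (\<Sum>l\<in>UNIV. of_nat (lower j x l) * coordinate l b * bimonomial (lower l (lower j x)) z))"
    unfolding d1 d2 re_im_simps(4)[where A = Basis] ..
  also have "\<dots> = (\<Sum>j\<in>UNIV. real (2 * x j * x (conj_index j)) * re_im (bimonomial (lower (conj_index j) (lower j x)) z))"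
    unfolding e re_im_simps(4) re_im_simps(3) by simp
  finally show ?thesis .
qed

text \<open>The parameter \<open>d\<close> is the complex dimension, so this is the classical value
  \<open>k * (k + n - 2)\<close> for the unit sphere in real dimension
  \<open>n = 2 * d\<close>.\<close>

definition eigenvalue :: "nat \<Rightarrow> nat \<Rightarrow> real" where
  "eigenvalue d k = real k * (real k + 2 * real d - 2)"

lemma sphere_laplacian_monomial:
  fixes z :: "complex ^ 'n::finite"
  assumes "sum x UNIV = k" "norm z = 1"
  shows "sphere_laplacian (sphere_monomial x) z = eigenvalue CARD('n) k * sphere_monomial x z -
    (\<Sum>j\<in>UNIV. real (2 * x j * x (conj_index j)) * sphere_monomial (lower (conj_index j) (lower j x)) z)"
proof -
  have hom: "re_im (bimonomial x (c *\<^sub>R y)) = c ^ k * re_im (bimonomial x y)" for c and y :: "complex ^ 'n"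
    unfolding bimonomial_scaleR assms(1) re_im_simps ..
  show ?thesis
    unfolding sphere_monomial_def
    by (subst sphere_laplacian_homogeneous[OF re_im_bimonomial_smooth hom assms(2)], subst laplacian_re_im_bimonomial)
     (use assms in \<open>simp add: eigenvalue_def algebra_simps\<close>)
qed

lemma eigenvalue_less:
  assumes "d \<ge> 1" "j < k" shows "eigenvalue d j < eigenvalue d k"
proof -
  have "real j * (real j + 2 * real d - 2) \<le> real j * (real k + 2 * real d - 2)"
    using assms by (intro mult_left_mono) auto
  also have "\<dots> < real k * (real k + 2 * real d - 2)"
    using assms by (intro mult_strict_right_mono) auto
  finally show ?thesis by (simp add: eigenvalue_def)
qed

lemma eigenvalue_eq_iff: "d \<ge> 1 \<Longrightarrow> eigenvalue d j = eigenvalue d k \<longleftrightarrow> j = k"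
  using eigenvalue_less[of d j k] eigenvalue_less[of d k j] by (cases j k rule: linorder_cases) auto

section \<open>Linear independence of the monomials\<close>

lemma characters_independent:
  fixes ch :: "'x \<Rightarrow> 'm \<Rightarrow> 'k::field"
  assumes "finite X" "e \<in> M" "\<And>a b. a \<in> M \<Longrightarrow> b \<in> M \<Longrightarrow> m a b \<in> M"
    and "\<And>x a b. a \<in> M \<Longrightarrow> b \<in> M \<Longrightarrow> ch x (m a b) = ch x a * ch x b" "\<And>x. ch x e = 1"
    and "\<And>x y. x \<in> X \<Longrightarrow> y \<in> X \<Longrightarrow> x \<noteq> y \<Longrightarrow> \<exists>a\<in>M. ch x a \<noteq> ch y a"
    and "\<And>a. a \<in> M \<Longrightarrow> (\<Sum>x\<in>X. d x * ch x a) = 0"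
  shows "\<forall>x\<in>X. d x = 0"
  using assms(1,6,7)
proof (induction X arbitrary: d rule: finite_induct)
  case (insert u X)
  \<comment> \<open>Dedekind's elimination: subtracting \<open>ch u b\<close> times the relation at
    \<open>a\<close> from the relation at \<open>m b a\<close> removes \<open>u\<close>. A
    \<open>b\<close> that separates \<open>x\<close> from \<open>u\<close> then gives
    \<open>d x = 0\<close>.\<close>
  have "\<forall>x\<in>X. d x * (ch x b - ch u b) = 0" if b: "b \<in> M" for b
  proof (rule insert.IH)
    fix a assume a: "a \<in> M"
    have "(\<Sum>x\<in>X. d x * ch x b * ch x a) = - (d u * ch u b * ch u a)"
      using insert.prems(2)[OF assms(3)[OF b a]] insert.hyps
      by (simp add: assms(4)[OF b a] mult.assoc eq_neg_iff_add_eq_0 add.commute)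
    moreover have "(\<Sum>x\<in>X. d x * ch x a) = - (d u * ch u a)"
      using insert.prems(2)[OF a] insert.hyps by (simp add: eq_neg_iff_add_eq_0 add.commute)
    then have "ch u b * (\<Sum>x\<in>X. d x * ch x a) = - (d u * ch u b * ch u a)" by simp
    then have "(\<Sum>x\<in>X. d x * ch u b * ch x a) = - (d u * ch u b * ch u a)"
      by (simp add: sum_distrib_left mult_ac)
    ultimately show "(\<Sum>x\<in>X. d x * (ch x b - ch u b) * ch x a) = 0"
      by (simp add: algebra_simps sum_subtractf)
  qed (use insert.prems(1) in auto)
  then have "\<forall>x\<in>X. d x = 0" using insert.prems(1) insert.hyps by (metis insertCI mult_eq_0_iff right_minus_eq)
  moreover from this have "d u = 0" using insert.prems(2)[OF assms(2)] insert.hyps assms(5) by simp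
  ultimately show ?case by simp
qed simp

lemma bimonomial_single:
  "bimonomial x (\<chi> l. if l = i then w else 1) = w ^ x (Inl i) * cnj w ^ x (Inr i)"
proof -
  have "bimonomial x (\<chi> l. if l = i then w else 1) =
    (\<Prod>l\<in>UNIV. coordinate (Inl l) (\<chi> l. if l = i then w else 1) ^ x (Inl l)) *
    (\<Prod>l\<in>UNIV. coordinate (Inr l) (\<chi> l. if l = i then w else 1) ^ x (Inr l))"
    unfolding bimonomial_def UNIV_Plus_UNIV[symmetric] by (subst prod.Plus) auto
  then show ?thesis
    by (simp add: coordinate_def if_distrib[of "\<lambda>u. u ^ _"] if_distrib[of cnj] cong: if_cong)
qed

text \<open>In a coordinate where the exponents differ, the value 2 separates different total
  degrees. If the total degrees agree, a point of the unit circle close to 1 separates the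
  differences of the two exponents.\<close>

lemma bimonomial_distinct:
  assumes "x \<noteq> y"
  shows "\<exists>z \<in> {z. \<forall>i. z $ i \<noteq> 0}. bimonomial x z \<noteq> bimonomial y z"
proof -
  obtain j where j: "x j \<noteq> y j" using assms by auto
  define i where "i = (case j of Inl i \<Rightarrow> i | Inr i \<Rightarrow> i)"
  have i: "x (Inl i) \<noteq> y (Inl i) \<or> x (Inr i) \<noteq> y (Inr i)"
    using j by (auto simp: i_def split: sum.splits)
  let ?z = "\<lambda>w::complex. (\<chi> l. if l = i then w else 1)"
  have mem: "?z w \<in> {z. \<forall>i. z $ i \<noteq> 0}" if "w \<noteq> 0" for w using that by simp
  show ?thesis
  proof (cases "x (Inl i) + x (Inr i) = y (Inl i) + y (Inr i)")
    case False
    have "bimonomial x (?z 2) \<noteq> bimonomial y (?z 2)"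
    proof
      assume "bimonomial x (?z 2) = bimonomial y (?z 2)"
      then have "(2::complex) ^ (x (Inl i) + x (Inr i)) = 2 ^ (y (Inl i) + y (Inr i))"
        by (simp add: bimonomial_single power_add)
      from arg_cong[OF this, of norm] have "(2::real) ^ (x (Inl i) + x (Inr i)) = 2 ^ (y (Inl i) + y (Inr i))"
        by (simp add: norm_power)
      with False show False by simp
    qed
    then show ?thesis using mem[of 2] by (intro bexI[of _ "?z 2"]) auto
  next
    case True
    define s where "s = x (Inl i) + x (Inr i)"
    \<comment> \<open>All angles that occur are at most \<open>s * t\<close> in absolute value,
      hence below pi, and in this range \<open>cis\<close> determines the angle.\<close>
    define t where "t = 1 / (1 + real s)"
    have bi: "bimonomial u (?z (cis t)) = cis ((real (u (Inl i)) - real (u (Inr i))) * t)" for u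
      unfolding bimonomial_single cis_cnj Complex.DeMoivre cis_mult
      by (rule arg_cong[of _ _ cis]) (simp add: left_diff_distrib)
    have bnd: "\<bar>(real (u (Inl i)) - real (u (Inr i))) * t\<bar> < pi" if "u (Inl i) + u (Inr i) = s" for u
    proof -
      have "\<bar>real (u (Inl i)) - real (u (Inr i))\<bar> \<le> s" using that by linarith
      then have "\<bar>real (u (Inl i)) - real (u (Inr i))\<bar> * t \<le> s * t"
        by (intro mult_right_mono) (auto simp: t_def)
      also have "s * t \<le> 1" by (simp add: t_def)
      finally have "\<bar>(real (u (Inl i)) - real (u (Inr i))) * t\<bar> \<le> 1"
        unfolding abs_mult by (simp add: t_def)
      then show ?thesis using pi_gt3 by linarith
    qed
    have "bimonomial x (?z (cis t)) \<noteq> bimonomial y (?z (cis t))"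
    proof
      assume "bimonomial x (?z (cis t)) = bimonomial y (?z (cis t))"
      then have "cis ((real (x (Inl i)) - real (x (Inr i))) * t) = cis ((real (y (Inl i)) - real (y (Inr i))) * t)"
        unfolding bi .
      moreover have "Arg (cis ((real (x (Inl i)) - real (x (Inr i))) * t)) = (real (x (Inl i)) - real (x (Inr i))) * t"
        by (rule Arg_cis) (use bnd[of x] in \<open>auto simp: s_def abs_less_iff\<close>)
      moreover have "Arg (cis ((real (y (Inl i)) - real (y (Inr i))) * t)) = (real (y (Inl i)) - real (y (Inr i))) * t"
        by (rule Arg_cis) (use bnd[of y] True in \<open>auto simp: s_def abs_less_iff\<close>)
      ultimately have "(real (x (Inl i)) - real (x (Inr i))) * t = (real (y (Inl i)) - real (y (Inr i))) * t"
        by metis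
      then have "real (x (Inl i)) - real (x (Inr i)) = real (y (Inl i)) - real (y (Inr i))"
        by (auto simp: t_def)
      with True i show False by linarith
    qed
    then show ?thesis using mem[of "cis t"] by (intro bexI[of _ "?z (cis t)"]) auto
  qed
qed

lemma bimonomial_one: "bimonomial x (\<chi> i. 1) = 1"
  by (auto simp: bimonomial_def coordinate_def intro!: prod.neutral split: sum.splits)

lemma bimonomials_independent:
  fixes X :: "('n::finite + 'n \<Rightarrow> nat) set"
  assumes "finite X" "\<And>z. (\<forall>i. z $ i \<noteq> 0) \<Longrightarrow> (\<Sum>x\<in>X. d x * bimonomial x z) = 0"
  shows "\<forall>x\<in>X. d x = 0"
proof (rule characters_independent[where M = "{z :: complex ^ 'n. \<forall>i. z $ i \<noteq> 0}" and e = "\<chi> i. 1"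
    and m = "\<lambda>z w. \<chi> i. z $ i * w $ i" and ch = bimonomial, OF assms(1)])
  show "\<exists>a\<in>{z. \<forall>i. z $ i \<noteq> 0}. bimonomial x a \<noteq> bimonomial y a" if "x \<noteq> y" for x y :: "'n + 'n \<Rightarrow> nat"
    using bimonomial_distinct[OF that] .
qed (use assms(2) in \<open>auto simp: bimonomial_one bimonomial_mult\<close>)

text \<open>By \<open>rewrite\<close>, a real relation becomes a complex one on the closure
  \<open>Y\<close> of \<open>X\<close> under conjugation, with coefficients
  \<open>(1 - \<i>) * c' y + (1 + \<i>) * c' (bar y)\<close>. As \<open>c'\<close> is real, the real
  and imaginary parts give both \<open>c' y + c' (bar y) = 0\<close> and
  \<open>c' (bar y) - c' y = 0\<close>.\<close>

lemma re_im_bimonomials_independent: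
  fixes X :: "('n::finite + 'n \<Rightarrow> nat) set"
  assumes "finite X" "\<And>z. (\<forall>i. z $ i \<noteq> 0) \<Longrightarrow> (\<Sum>x\<in>X. c x * re_im (bimonomial x z)) = 0"
  shows "\<forall>x\<in>X. c x = 0"
proof -
  define c' where "c' x = (if x \<in> X then c x else 0)" for x
  define bar where "bar x = x \<circ> conj_index" for x :: "'n + 'n \<Rightarrow> nat"
  have bar2: "bar (bar x) = x" for x by (simp add: bar_def fun_eq_iff)
  have inj: "inj bar" by (rule inj_on_inverseI[of _ bar]) (rule bar2)
  define Y where "Y = X \<union> bar ` X"
  have Y: "finite Y" "bar ` Y = Y" using assms(1) bar2 by (auto simp: Y_def image_Un image_image)
  have rewrite: "2 * complex_of_real (re_im w) = (1 - \<i>) * w + (1 + \<i>) * cnj w" for w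
    by (simp add: complex_eq_iff re_im_def)
  have "\<forall>y\<in>Y. (1 - \<i>) * of_real (c' y) + (1 + \<i>) * of_real (c' (bar y)) = 0"
  proof (rule bimonomials_independent[OF Y(1)])
    fix z :: "complex ^ 'n" assume z: "\<forall>i. z $ i \<noteq> 0"
    have "0 = 2 * complex_of_real (\<Sum>x\<in>X. c x * re_im (bimonomial x z))"
      using assms(2)[OF z] by simp
    also have "(\<Sum>x\<in>X. c x * re_im (bimonomial x z)) = (\<Sum>x\<in>Y. c' x * re_im (bimonomial x z))"
      using Y(1) by (intro sum.mono_neutral_cong_left) (auto simp: Y_def c'_def)
    also have "2 * complex_of_real \<dots> = (\<Sum>x\<in>Y. of_real (c' x) * (2 * complex_of_real (re_im (bimonomial x z))))"
      by (simp add: sum_distrib_left mult_ac)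
    also have "\<dots> = (\<Sum>x\<in>Y. (1 - \<i>) * of_real (c' x) * bimonomial x z) + (\<Sum>x\<in>Y. (1 + \<i>) * of_real (c' x) * bimonomial (bar x) z)"
      unfolding rewrite by (simp add: bar_def bimonomial_conj sum.distrib[symmetric] algebra_simps)
    also have "(\<Sum>x\<in>Y. (1 + \<i>) * of_real (c' x) * bimonomial (bar x) z) = (\<Sum>x\<in>Y. (1 + \<i>) * of_real (c' (bar x)) * bimonomial x z)"
      by (rule sum.reindex_cong[of bar]) (use inj Y(2) bar2 in \<open>auto intro: inj_on_subset\<close>)
    finally show "(\<Sum>y\<in>Y. ((1 - \<i>) * of_real (c' y) + (1 + \<i>) * of_real (c' (bar y))) * bimonomial y z) = 0"
      by (simp add: sum.distrib[symmetric] algebra_simps)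
  qed
  then have "c' y = 0" if "y \<in> Y" for y using that by (force simp: complex_eq_iff)
  then show ?thesis by (metis UnI1 Y_def c'_def)
qed

section \<open>Weights of monomials under the circle action\<close>

definition weight :: "('n \<Rightarrow> nat) \<Rightarrow> 'n + 'n \<Rightarrow> int" where
  "weight N j = (case j of Inl i \<Rightarrow> int (N i) | Inr i \<Rightarrow> - int (N i))"

definition total_weight :: "('n::finite \<Rightarrow> nat) \<Rightarrow> ('n + 'n \<Rightarrow> nat) \<Rightarrow> int" where
  "total_weight N x = (\<Sum>j\<in>UNIV. int (x j) * weight N j)"

definition exponents :: "('n::finite \<Rightarrow> nat) \<Rightarrow> nat \<Rightarrow> ('n + 'n \<Rightarrow> nat) set" where
  "exponents N k = {x. sum x UNIV = k \<and> total_weight N x = 0}"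

text \<open>These are the exponents of degree \<open>k - 2\<close>; writing \<open>+ 2\<close> on
  the left makes the set empty for \<open>k < 2\<close>, which truncated subtraction would
  not.\<close>

definition exponents2 :: "('n::finite \<Rightarrow> nat) \<Rightarrow> nat \<Rightarrow> ('n + 'n \<Rightarrow> nat) set" where
  "exponents2 N k = {x. sum x UNIV + 2 = k \<and> total_weight N x = 0}"

lemma finite_exponents: "finite (exponents N k)"
proof (rule finite_subset)
  show "exponents N k \<subseteq> PiE UNIV (\<lambda>_. {..k})"
  proof
    fix x assume "x \<in> exponents N k"
    then have "x j \<le> k" for j
      using member_le_sum[of j UNIV x] by (auto simp: exponents_def)
    then show "x \<in> PiE UNIV (\<lambda>_. {..k})" by auto
  qed
qed (auto intro: finite_PiE)

lemma weight_conj_index: "weight N (conj_index j) = - weight N j"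
  by (auto simp: weight_def conj_index_def split: sum.splits)

lemma lower_sums:
  assumes "x j > 0"
  shows "sum (lower j x) UNIV + 1 = sum x UNIV" "total_weight N (lower j x) = total_weight N x - weight N j"
proof -
  have "sum (lower j x) UNIV = lower j x j + sum (lower j x) (UNIV - {j})" by (rule sum.remove) auto
  also have "sum (lower j x) (UNIV - {j}) = sum x (UNIV - {j})" by (intro sum.cong) (auto simp: lower_def)
  finally show "sum (lower j x) UNIV + 1 = sum x UNIV"
    using assms sum.remove[of UNIV j x] by (simp add: lower_def)
  have "total_weight N (lower j x) = int (lower j x j) * weight N j + (\<Sum>l\<in>UNIV - {j}. int (lower j x l) * weight N l)"
    unfolding total_weight_def by (rule sum.remove) auto
  also have "(\<Sum>l\<in>UNIV - {j}. int (lower j x l) * weight N l) = (\<Sum>l\<in>UNIV - {j}. int (x l) * weight N l)"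
    by (intro sum.cong) (auto simp: lower_def)
  finally show "total_weight N (lower j x) = total_weight N x - weight N j"
    using assms sum.remove[of UNIV j "\<lambda>l. int (x l) * weight N l"]
    by (simp add: lower_def total_weight_def of_nat_diff algebra_simps)
qed

lemma lower_exponents:
  assumes "x \<in> exponents N k" "x j > 0" "x (conj_index j) > 0"
  shows "lower (conj_index j) (lower j x) \<in> exponents2 N k"
proof -
  have "lower j x (conj_index j) > 0" using assms by (simp add: lower_def)
  with lower_sums(1)[of "lower j x" "conj_index j"] lower_sums(1)[of x j]
    lower_sums(2)[of "lower j x" "conj_index j" N] lower_sums(2)[of x j N] assms show ?thesis
    by (simp add: exponents_def exponents2_def weight_conj_index)
qed

section \<open>The eigenspaces\<close>

text \<open>Extension by zero matches the representation in \<open>smooth_sphere_functions\<close>,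
  so that eigenvalue equations become equations between functions.\<close>

definition laplacian_function :: "('a::euclidean_space \<Rightarrow> real) \<Rightarrow> 'a \<Rightarrow> real" where
  "laplacian_function f = (\<lambda>z. if norm z = 1 then sphere_laplacian f z else 0)"

definition monomial_space :: "('n::finite \<Rightarrow> nat) \<Rightarrow> nat \<Rightarrow> (complex ^ 'n \<Rightarrow> real) set" where
  "monomial_space N k = real_functions.span (sphere_monomial ` exponents N k)"

definition monomial_space2 :: "('n::finite \<Rightarrow> nat) \<Rightarrow> nat \<Rightarrow> (complex ^ 'n \<Rightarrow> real) set" where
  "monomial_space2 N k = real_functions.span (sphere_monomial ` exponents2 N k)"

definition shifted_laplacian :: "real \<Rightarrow> ('a::euclidean_space \<Rightarrow> real) \<Rightarrow> 'a \<Rightarrow> real" where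
  "shifted_laplacian \<mu> f = laplacian_function f - (\<lambda>z. \<mu> * f z)"

lemma shifted_laplacian_add:
  assumes "f \<in> smooth_sphere_functions" "g \<in> smooth_sphere_functions"
  shows "shifted_laplacian \<mu> (f + g) = shifted_laplacian \<mu> f + shifted_laplacian \<mu> g"
proof
  have p: "f + g = (\<lambda>x. f x + g x)" by (simp add: fun_eq_iff)
  show "shifted_laplacian \<mu> (f + g) z = (shifted_laplacian \<mu> f + shifted_laplacian \<mu> g) z" for z
    unfolding shifted_laplacian_def laplacian_function_def p
    using sphere_laplacian_add[OF sphere_smooth_ray_extension[OF assms(1)] sphere_smooth_ray_extension[OF assms(2)], of z]
    by (simp add: algebra_simps)
qed

lemma shifted_laplacian_scale:
  assumes "f \<in> smooth_sphere_functions"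
  shows "shifted_laplacian \<mu> (\<lambda>x. c * f x) = (\<lambda>x. c * shifted_laplacian \<mu> f x)"
proof
  show "shifted_laplacian \<mu> (\<lambda>x. c * f x) z = c * shifted_laplacian \<mu> f z" for z
  proof -
    have "laplacian_function (\<lambda>x. c * f x) z = c * laplacian_function f z"
      unfolding laplacian_function_def
      using sphere_laplacian_scale[OF sphere_smooth_ray_extension[OF assms], of z c] by simp
    then show ?thesis by (simp add: shifted_laplacian_def right_diff_distrib mult.left_commute)
  qed
qed

lemma shifted_laplacian_diff:
  assumes "f \<in> smooth_sphere_functions" "g \<in> smooth_sphere_functions"
  shows "shifted_laplacian \<mu> (f - g) = shifted_laplacian \<mu> f - shifted_laplacian \<mu> g"
proof -
  have "f - g \<in> smooth_sphere_functions"
    by (rule real_functions.subspace_diff[OF smooth_sphere_functions_subspace assms])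
  from shifted_laplacian_add[OF this assms(2), of \<mu>] show ?thesis by (simp add: eq_diff_eq)
qed

lemma sum_fun_apply: "(\<Sum>i\<in>A. f i) x = (\<Sum>i\<in>A. f i x)"
  by (induction A rule: infinite_finite_induct) auto

lemma shifted_laplacian_zero [simp]:
  "shifted_laplacian \<mu> (0 :: 'a::euclidean_space \<Rightarrow> real) = 0"
  using shifted_laplacian_add[of 0 "0 :: 'a \<Rightarrow> real" \<mu>] real_functions.subspace_0[OF smooth_sphere_functions_subspace]
  by (metis add_cancel_right_right add_0)

lemma shifted_laplacian_change:
  "shifted_laplacian \<mu> f = shifted_laplacian \<nu> f + (\<lambda>z. (\<nu> - \<mu>) * f z)"
  by (auto simp: shifted_laplacian_def algebra_simps)

lemma monomial_space_smooth:
  "monomial_space N k \<subseteq> smooth_sphere_functions" "monomial_space2 N k \<subseteq> smooth_sphere_functions"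
  unfolding monomial_space_def monomial_space2_def
  by (intro real_functions.span_minimal smooth_sphere_functions_subspace image_subsetI sphere_monomial_smooth)+

lemma subspace_monomial_space:
  "real_functions.subspace (monomial_space N k)" "real_functions.subspace (monomial_space2 N k)"
  unfolding monomial_space_def monomial_space2_def by (rule real_functions.subspace_span)+

lemmas monomial_space_smoothD = subsetD[OF monomial_space_smooth(1)] subsetD[OF monomial_space_smooth(2)]

lemma exponents2_eq: "exponents2 N k = (if k \<ge> 2 then exponents N (k - 2) else {})"
  by (auto simp: exponents2_def exponents_def)

lemma monomial_space2_eq: "monomial_space2 N k = (if k \<ge> 2 then monomial_space N (k - 2) else {0})"
  by (simp add: monomial_space2_def monomial_space_def exponents2_eq)

lemma raise_index:
  fixes y :: "'n::finite + 'n \<Rightarrow> nat"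
  defines "r i \<equiv> y(Inl i := y (Inl i) + 1, Inr i := y (Inr i) + 1)"
  shows "bimonomial (r i) z = bimonomial y z * (coordinate (Inl i) z * coordinate (Inr i) z)"
    and "y \<in> exponents2 N k \<Longrightarrow> r i \<in> exponents N k"
proof -
  have l: "y = lower (Inr i) (lower (Inl i) (r i))" by (auto simp: r_def lower_def)
  have r: "r i j = y j + (if j = Inl i then 1 else 0) + (if j = Inr i then 1 else 0)" for j
    by (auto simp: r_def)
  show "bimonomial (r i) z = bimonomial y z * (coordinate (Inl i) z * coordinate (Inr i) z)"
    unfolding bimonomial_def r power_add prod.distrib
    by (simp add: if_distrib[of "\<lambda>n. _ ^ n"] cong: if_cong)
  show "y \<in> exponents2 N k \<Longrightarrow> r i \<in> exponents N k"
    unfolding exponents_def exponents2_def total_weight_def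
    by (auto simp: r sum.distrib distrib_right if_distrib[of int] if_distrib[of "\<lambda>a. a * _"] weight_def cong: if_cong)
qed

text \<open>On the unit sphere, multiplication by the sum of all \<open>z $ i * cnj (z $ i)\<close>
  changes nothing, while it raises the degree by two and keeps the weight.\<close>

lemma monomial_space2_subset: "monomial_space2 N k \<subseteq> monomial_space N k"
  unfolding monomial_space2_def
proof (rule real_functions.span_minimal)
  show "sphere_monomial ` exponents2 N k \<subseteq> monomial_space N k"
  proof clarify
    fix y :: "'a + 'a \<Rightarrow> nat" assume y: "y \<in> exponents2 N k"
    define r where "r i = y(Inl i := y (Inl i) + 1, Inr i := y (Inr i) + 1)" for i
    have "sphere_monomial y z = (\<Sum>i\<in>UNIV. sphere_monomial (r i) z)" for z
    proof (cases "norm z = 1")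
      case True
      have "(\<Sum>i\<in>UNIV. bimonomial (r i) z) = bimonomial y z"
        unfolding r_def raise_index(1) sum_distrib_left[symmetric] sphere_sum_coordinate[OF True] by simp
      then show ?thesis using True by (simp add: sphere_monomial_def re_im_simps(4)[symmetric])
    qed (simp add: sphere_monomial_def)
    then have "sphere_monomial y = (\<Sum>i\<in>UNIV. sphere_monomial (r i))" by (auto simp: fun_eq_iff sum_fun_apply)
    moreover have "sphere_monomial (r i) \<in> monomial_space N k" for i
      unfolding monomial_space_def r_def using raise_index(2)[OF y] by (intro real_functions.span_base) auto
    ultimately show "sphere_monomial y \<in> monomial_space N k"
      by (auto intro: real_functions.subspace_sum[OF subspace_monomial_space(1)])
  qed
qed (rule subspace_monomial_space)

text \<open>The eigenvalue accounts for homogeneity. The error is the Euclidean Laplacian, which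
  removes a variable together with its conjugate and so lowers the degree by two at unchanged
  weight.\<close>

lemma shifted_laplacian_monomial_space:
  fixes f :: "complex ^ 'n::finite \<Rightarrow> real"
  assumes "f \<in> monomial_space N k"
  shows "shifted_laplacian (eigenvalue CARD('n) k) f \<in> monomial_space2 N k"
proof -
  let ?L = "shifted_laplacian (eigenvalue CARD('n) k) :: (complex ^ 'n \<Rightarrow> real) \<Rightarrow> _"
  let ?S = "{f \<in> smooth_sphere_functions. ?L f \<in> monomial_space2 N k}"
  have sub: "real_functions.subspace ?S"
    by (intro real_functions.subspaceI)
      (auto simp del: plus_fun_apply simp: shifted_laplacian_add shifted_laplacian_scale smooth_sphere_functions_add
        smooth_sphere_functions_scale real_functions.subspace_0[OF smooth_sphere_functions_subspace]
        real_functions.subspace_add[OF subspace_monomial_space(2)]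
        real_functions.subspace_scale[OF subspace_monomial_space(2)] real_functions.subspace_0[OF subspace_monomial_space(2)])
  have "sphere_monomial ` exponents N k \<subseteq> ?S"
  proof clarify
    fix x :: "'n + 'n \<Rightarrow> nat" assume x: "x \<in> exponents N k"
    let ?c = "\<lambda>j. - real (2 * x j * x (conj_index j))"
    have "?L (sphere_monomial x) = (\<Sum>j\<in>UNIV. (\<lambda>z. ?c j * sphere_monomial (lower (conj_index j) (lower j x)) z))"
    proof
      show "?L (sphere_monomial x) z = (\<Sum>j\<in>UNIV. (\<lambda>z. ?c j * sphere_monomial (lower (conj_index j) (lower j x)) z)) z" for z
        using sphere_laplacian_monomial[of x k z] x
        by (cases "norm z = 1")
          (auto simp: shifted_laplacian_def laplacian_function_def exponents_def sum_negf sum_fun_apply smooth_sphere_functions_zero[OF sphere_monomial_smooth])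
    qed
    moreover have "(\<lambda>z. ?c j * sphere_monomial (lower (conj_index j) (lower j x)) z) \<in> monomial_space2 N k" for j
    proof (cases "x j > 0 \<and> x (conj_index j) > 0")
      case True
      then have "sphere_monomial (lower (conj_index j) (lower j x)) \<in> monomial_space2 N k"
        unfolding monomial_space2_def using lower_exponents[OF x] by (intro real_functions.span_base) auto
      then show ?thesis by (rule real_functions.subspace_scale[OF subspace_monomial_space(2)])
    next
      case False
      then have "(\<lambda>z. ?c j * sphere_monomial (lower (conj_index j) (lower j x)) z) = 0" by auto
      then show ?thesis using real_functions.subspace_0[OF subspace_monomial_space(2)] by metis
    qed
    ultimately have "?L (sphere_monomial x) \<in> monomial_space2 N k"
      by (auto intro: real_functions.subspace_sum[OF subspace_monomial_space(2)])
    then show "sphere_monomial x \<in> smooth_sphere_functions \<and> ?L (sphere_monomial x) \<in> monomial_space2 N k"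
      using sphere_monomial_smooth by blast
  qed
  then have "monomial_space N k \<subseteq> ?S"
    unfolding monomial_space_def by (rule real_functions.span_minimal[OF _ sub])
  then show ?thesis using assms by blast
qed

text \<open>With respect to the degree the operator is triangular, with diagonal entries
  \<open>eigenvalue CARD('n) j - \<mu>\<close>. Solving in the top degree leaves an error of degree
  \<open>k - 2\<close>, which the induction hypothesis removes.\<close>

lemma shifted_laplacian_surj:
  fixes g :: "complex ^ 'n::finite \<Rightarrow> real"
  assumes "g \<in> monomial_space N k" "\<And>j. j \<le> k \<Longrightarrow> \<mu> \<noteq> eigenvalue CARD('n) j"
  shows "\<exists>f \<in> monomial_space N k. shifted_laplacian \<mu> f = g"
  using assms
proof (induction k arbitrary: g rule: less_induct)
  case (less k)
  let ?\<mu> = "eigenvalue CARD('n) k"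
  define c where "c = 1 / (?\<mu> - \<mu>)"
  have c: "c * (?\<mu> - \<mu>) = 1" using less.prems(2)[of k] by (simp add: c_def)
  define f0 where "f0 = (\<lambda>z. c * g z)"
  have f0: "f0 \<in> monomial_space N k"
    unfolding f0_def by (rule real_functions.subspace_scale[OF subspace_monomial_space(1) less.prems(1)])
  note h = shifted_laplacian_monomial_space[OF f0]
  have "shifted_laplacian \<mu> f0 = shifted_laplacian ?\<mu> f0 + (\<lambda>z. (?\<mu> - \<mu>) * f0 z)"
    by (rule shifted_laplacian_change)
  also have "(\<lambda>z. (?\<mu> - \<mu>) * f0 z) = g"
    using c by (simp add: f0_def mult.assoc[symmetric] mult.commute[of _ c])
  finally have f0g: "shifted_laplacian \<mu> f0 = shifted_laplacian ?\<mu> f0 + g" .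
  have "\<exists>f1 \<in> monomial_space2 N k. shifted_laplacian \<mu> f1 = shifted_laplacian ?\<mu> f0"
  proof (cases "k \<ge> 2")
    case True
    then show ?thesis using less.IH[of "k - 2"] h less.prems(2) by (auto simp: monomial_space2_eq)
  next
    case False
    then have "shifted_laplacian ?\<mu> f0 = 0" using h by (simp add: monomial_space2_eq)
    then show ?thesis using real_functions.subspace_0[OF subspace_monomial_space(2)] by (intro bexI[of _ 0]) auto
  qed
  then obtain f1 where f1: "f1 \<in> monomial_space2 N k" "shifted_laplacian \<mu> f1 = shifted_laplacian ?\<mu> f0" by blast
  have "f0 - f1 \<in> monomial_space N k"
    using f0 f1(1) monomial_space2_subset real_functions.subspace_diff[OF subspace_monomial_space(1)] by blast
  moreover have "shifted_laplacian \<mu> (f0 - f1) = g"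
    using shifted_laplacian_diff[OF monomial_space_smoothD(1)[OF f0] monomial_space_smoothD(2)[OF f1(1)], of \<mu>]
      f1(2) f0g by simp
  ultimately show ?case by blast
qed

lemma shifted_laplacian_inj:
  fixes f :: "complex ^ 'n::finite \<Rightarrow> real"
  assumes "f \<in> monomial_space N k" "\<And>j. j \<le> k \<Longrightarrow> \<mu> \<noteq> eigenvalue CARD('n) j" "shifted_laplacian \<mu> f = 0"
  shows "f = 0"
  using assms
proof (induction k rule: less_induct)
  case (less k)
  let ?\<mu> = "eigenvalue CARD('n) k"
  have "shifted_laplacian ?\<mu> f + (\<lambda>z. (?\<mu> - \<mu>) * f z) = 0"
    using shifted_laplacian_change[of \<mu> f ?\<mu>] less.prems(3) by metis
  then have "(\<lambda>z. (?\<mu> - \<mu>) * f z) = 0 - shifted_laplacian ?\<mu> f"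
    by (simp add: eq_neg_iff_add_eq_0 add.commute)
  then have "(\<lambda>z. (?\<mu> - \<mu>) * f z) \<in> monomial_space2 N k"
    using shifted_laplacian_monomial_space[OF less.prems(1)] real_functions.subspace_0[OF subspace_monomial_space(2)]
      real_functions.subspace_diff[OF subspace_monomial_space(2)] by metis
  from real_functions.subspace_scale[OF subspace_monomial_space(2) this, of "1 / (?\<mu> - \<mu>)"]
  have f: "f \<in> monomial_space2 N k" using less.prems(2)[of k] by simp
  show ?case
  proof (cases "k \<ge> 2")
    case True
    then show ?thesis using less.IH[of "k - 2"] f less.prems by (auto simp: monomial_space2_eq)
  qed (use f in \<open>simp add: monomial_space2_eq\<close>)
qed

definition monomial_eigenspace :: "('n::finite \<Rightarrow> nat) \<Rightarrow> nat \<Rightarrow> (complex ^ 'n \<Rightarrow> real) set" where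
  "monomial_eigenspace N k = {f \<in> monomial_space N k. shifted_laplacian (eigenvalue CARD('n) k) f = 0}"

text \<open>This is the splitting of polynomials into harmonic ones and multiples of the squared
  norm, restricted to the sphere. The shifted Laplacian sends \<open>v\<close> into degree
  \<open>k - 2\<close> and is onto there, so some \<open>u\<close> of degree \<open>k - 2\<close>
  has the same image, and \<open>v - u\<close> is an eigenfunction.\<close>

lemma monomial_eigenspace_decomposition:
  fixes v :: "complex ^ 'n::finite \<Rightarrow> real"
  assumes "v \<in> monomial_space N k"
  shows "\<exists>e \<in> monomial_eigenspace N k. \<exists>u \<in> monomial_space2 N k. v = e + u"
proof -
  let ?L = "shifted_laplacian (eigenvalue CARD('n) k)"
  have h: "?L v \<in> monomial_space2 N k" by (rule shifted_laplacian_monomial_space[OF assms])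
  have "\<exists>u \<in> monomial_space2 N k. ?L u = ?L v"
  proof (cases "k \<ge> 2")
    case True
    have "eigenvalue CARD('n) k \<noteq> eigenvalue CARD('n) j" if "j \<le> k - 2" for j
      using that True by (subst eigenvalue_eq_iff) auto
    then show ?thesis using shifted_laplacian_surj[of "?L v" N "k - 2"] h True by (simp add: monomial_space2_eq)
  next
    case False
    then have "?L v = 0" using h by (simp add: monomial_space2_eq)
    then show ?thesis using real_functions.subspace_0[OF subspace_monomial_space(2)] by (intro bexI[of _ 0]) auto
  qed
  then obtain u where u: "u \<in> monomial_space2 N k" "?L u = ?L v" by blast
  have "v - u \<in> monomial_space N k"
    by (rule real_functions.subspace_diff[OF subspace_monomial_space(1) assms subsetD[OF monomial_space2_subset u(1)]])
  moreover have "?L (v - u) = 0"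
    using shifted_laplacian_diff[OF monomial_space_smoothD(1)[OF assms] monomial_space_smoothD(2)[OF u(1)]] u(2)
    by (metis diff_self)
  ultimately have "v - u \<in> monomial_eigenspace N k" by (simp add: monomial_eigenspace_def)
  then show ?thesis using u(1) by (intro bexI[of _ "v - u"] bexI[of _ u]) auto
qed

lemma monomial_eigenspace_inter:
  fixes f :: "complex ^ 'n::finite \<Rightarrow> real"
  assumes "f \<in> monomial_eigenspace N k" "f \<in> monomial_space2 N k"
  shows "f = 0"
proof (cases "k \<ge> 2")
  case True
  have "eigenvalue CARD('n) k \<noteq> eigenvalue CARD('n) j" if "j \<le> k - 2" for j
      using that True by (subst eigenvalue_eq_iff) auto
  then show ?thesis
    using shifted_laplacian_inj[of f N "k - 2" "eigenvalue CARD('n) k"] assms True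
    by (auto simp: monomial_space2_eq monomial_eigenspace_def)
qed (use assms in \<open>simp add: monomial_space2_eq\<close>)

lemma subspace_monomial_eigenspace: "real_functions.subspace (monomial_eigenspace N k)"
proof (rule real_functions.subspaceI)
  show "0 \<in> monomial_eigenspace N k"
    by (simp add: monomial_eigenspace_def real_functions.subspace_0[OF subspace_monomial_space(1)] del: zero_fun_apply)
  fix f g assume f: "f \<in> monomial_eigenspace N k"
  then have fS: "f \<in> monomial_space N k" "shifted_laplacian (eigenvalue CARD('a) k) f = 0"
    by (auto simp: monomial_eigenspace_def)
  show "(\<lambda>x. c * f x) \<in> monomial_eigenspace N k" for c
    using real_functions.subspace_scale[OF subspace_monomial_space(1) fS(1)]
      shifted_laplacian_scale[OF monomial_space_smoothD(1)[OF fS(1)]] fS(2)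
    by (auto simp: monomial_eigenspace_def fun_eq_iff)
  assume g: "g \<in> monomial_eigenspace N k"
  then have gS: "g \<in> monomial_space N k" "shifted_laplacian (eigenvalue CARD('a) k) g = 0"
    by (auto simp: monomial_eigenspace_def)
  show "f + g \<in> monomial_eigenspace N k"
    using real_functions.subspace_add[OF subspace_monomial_space(1) fS(1) gS(1)]
      shifted_laplacian_add[OF monomial_space_smoothD(1)[OF fS(1)] monomial_space_smoothD(1)[OF gS(1)]] fS(2) gS(2)
    by (simp add: monomial_eigenspace_def)
qed

section \<open>Dimension of the eigenspaces\<close>

lemma (in vector_space) independent_Un_disjoint_spans:
  assumes "finite B" "independent B" "independent C" "span B \<inter> span C \<subseteq> {0}"
  shows "independent (B \<union> C) \<and> B \<inter> C = {}"
proof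
  show "independent (B \<union> C)"
    using assms(1,2,4)
  proof (induction B rule: finite_induct)
    case (insert b B)
    have mono: "span B \<subseteq> span (insert b B)" by (intro span_mono) auto
    have ind: "independent B" "b \<notin> span B"
      using insert.prems(1) insert.hyps(2) by (auto simp: independent_insert)
    have "independent (B \<union> C)" using insert.IH ind(1) insert.prems(2) mono by blast
    moreover have "b \<notin> span (B \<union> C)"
    proof
      assume "b \<in> span (B \<union> C)"
      then obtain u v where uv: "u \<in> span B" "v \<in> span C" "b = u + v" unfolding span_Un by auto
      have "b - u \<in> span (insert b B)"
        using uv(1) mono by (intro span_diff) (auto intro: span_base)
      moreover have "b - u = v" using uv(3) by simp
      ultimately have "v = 0" using uv(2) insert.prems(2) by auto
      then show False using uv(1,3) ind(2) by simp
    qed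
    ultimately show ?case by (simp add: independent_insertI)
  qed (use assms(3) in simp)
  show "B \<inter> C = {}"
  proof (rule ccontr)
    assume "B \<inter> C \<noteq> {}"
    then obtain b where b: "b \<in> B" "b \<in> C" by auto
    then have "b = 0" using assms(4) span_base by blast
    with b assms(2) show False using dependent_zero by blast
  qed
qed

text \<open>On the sphere, monomials of different degrees are related through
  \<open>norm z = 1\<close>. In a fixed degree, homogeneity extends a relation from the sphere to
  all points, where the monomials are independent.\<close>

lemma sphere_monomials_independent:
  fixes X :: "('n::finite + 'n \<Rightarrow> nat) set"
  assumes "finite X" "\<And>x. x \<in> X \<Longrightarrow> sum x UNIV = k" "\<And>z. (\<Sum>x\<in>X. c x * sphere_monomial x z) = 0"
  shows "\<forall>x\<in>X. c x = 0"
proof (rule re_im_bimonomials_independent[OF assms(1)])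
  fix z :: "complex ^ 'n" assume z: "\<forall>i. z $ i \<noteq> 0"
  then have z0: "z \<noteq> 0" by auto
  have "re_im (bimonomial x z) = norm z ^ k * sphere_monomial x (sgn z)" if "x \<in> X" for x
  proof -
    have "re_im (bimonomial x (norm z *\<^sub>R sgn z)) = norm z ^ k * re_im (bimonomial x (sgn z))"
      unfolding bimonomial_scaleR assms(2)[OF that] re_im_simps ..
    moreover have "norm z *\<^sub>R sgn z = z" using z0 by (simp add: sgn_div_norm)
    ultimately show ?thesis using z0 by (simp add: sphere_monomial_def norm_sgn)
  qed
  then have "(\<Sum>x\<in>X. c x * re_im (bimonomial x z)) = norm z ^ k * (\<Sum>x\<in>X. c x * sphere_monomial x (sgn z))"
    by (simp add: sum_distrib_left mult_ac)
  then show "(\<Sum>x\<in>X. c x * re_im (bimonomial x z)) = 0" using assms(3) by simp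
qed

lemma sphere_monomials_basis:
  fixes X :: "('n::finite + 'n \<Rightarrow> nat) set"
  assumes "finite X" "\<And>x. x \<in> X \<Longrightarrow> sum x UNIV = k"
  shows "inj_on sphere_monomial X" "real_functions.independent (sphere_monomial ` X)"
proof -
  show inj: "inj_on (sphere_monomial :: _ \<Rightarrow> complex ^ 'n \<Rightarrow> real) X"
  proof (rule inj_onI, rule ccontr)
    fix x y assume xy: "x \<in> X" "y \<in> X" "(sphere_monomial x :: complex ^ 'n \<Rightarrow> real) = sphere_monomial y" "x \<noteq> y"
    have "\<forall>u\<in>{x, y}. (if u = x then 1 else -1 :: real) = 0"
    proof (rule sphere_monomials_independent[where k = k])
      show "(\<Sum>u\<in>{x, y}. (if u = x then 1 else -1) * sphere_monomial u z) = 0" for z :: "complex ^ 'n"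
        using xy(3,4) by simp
    qed (use xy assms(2) in auto)
    then show False by simp
  qed
  show "real_functions.independent (sphere_monomial ` X :: (complex ^ 'n \<Rightarrow> real) set)"
  proof (rule real_functions.independent_if_scalars_zero)
    fix f x assume f: "(\<Sum>x\<in>sphere_monomial ` X. (\<lambda>z. f x * x z)) = (0 :: complex ^ 'n \<Rightarrow> real)" "x \<in> sphere_monomial ` X"
    have "\<forall>u\<in>X. f (sphere_monomial u) = 0"
    proof (rule sphere_monomials_independent[OF assms])
      fix z :: "complex ^ 'n"
      have "(\<Sum>x\<in>sphere_monomial ` X. (\<lambda>z. f x * x z)) z = (\<Sum>x\<in>X. f (sphere_monomial x) * sphere_monomial x z)"
        by (subst sum.reindex[OF inj]) (simp add: sum_fun_apply)
      then show "(\<Sum>x\<in>X. f (sphere_monomial x) * sphere_monomial x z) = 0" using f(1) by simp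
    qed
    then show "f x = 0" using f(2) by auto
  qed (use assms in auto)
qed

lemma finite_exponents2: "finite (exponents2 N k)"
  by (simp add: exponents2_eq finite_exponents)

lemma monomial_eigenspace_basis:
  obtains B where "finite B" "B \<subseteq> monomial_eigenspace N k" "real_functions.independent B"
    "real_functions.span B = monomial_eigenspace N k" "card B = real_functions.dim (monomial_eigenspace N k)"
proof -
  obtain B where B: "B \<subseteq> monomial_eigenspace N k" "real_functions.independent B"
     "monomial_eigenspace N k \<subseteq> real_functions.span B" "card B = real_functions.dim (monomial_eigenspace N k)"
    using real_functions.basis_exists[of "monomial_eigenspace N k"] by metis
  have "B \<subseteq> real_functions.span (sphere_monomial ` exponents N k)"
    using B(1) by (auto simp: monomial_eigenspace_def monomial_space_def)
  then have "finite B"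
    using real_functions.independent_span_bound[OF _ B(2)] finite_exponents by blast
  moreover have "real_functions.span B = monomial_eigenspace N k"
    using B(1,3) real_functions.span_minimal[OF B(1) subspace_monomial_eigenspace] by blast
  ultimately show ?thesis using that B by blast
qed

text \<open>The degree \<open>k\<close> space is the direct sum of the eigenspace and the degree
  \<open>k - 2\<close> space, and in each of the two degrees the sphere monomials form a
  basis.\<close>

lemma dim_monomial_eigenspace:
  fixes N :: "'n::finite \<Rightarrow> nat"
  shows "real_functions.dim (monomial_eigenspace N k) + card (exponents2 N k) = card (exponents N k)"
proof -
  obtain B where B: "finite B" "B \<subseteq> monomial_eigenspace N k" "real_functions.independent B"
    "real_functions.span B = monomial_eigenspace N k" "card B = real_functions.dim (monomial_eigenspace N k)"
    by (rule monomial_eigenspace_basis)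
  let ?A = "sphere_monomial ` exponents N k :: (complex ^ 'n \<Rightarrow> real) set"
  let ?C = "sphere_monomial ` exponents2 N k :: (complex ^ 'n \<Rightarrow> real) set"
  have A: "card ?A = card (exponents N k)" "real_functions.independent ?A"
    using sphere_monomials_basis[OF finite_exponents, of N k k] by (auto simp: exponents_def card_image)
  have C: "card ?C = card (exponents2 N k)" "real_functions.independent ?C"
  proof -
    have "sum x UNIV = k - 2" if "x \<in> exponents2 N k" for x
      using that by (auto simp: exponents2_def)
    from sphere_monomials_basis[OF finite_exponents2 this]
    show "card ?C = card (exponents2 N k)" "real_functions.independent ?C"
      by (auto simp: card_image)
  qed
  have BC: "real_functions.independent (B \<union> ?C)" "B \<inter> ?C = {}"
    using real_functions.independent_Un_disjoint_spans[OF B(1,3) C(2)] monomial_eigenspace_inter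
    unfolding B(4) monomial_space2_def[symmetric] by blast+
  have sub: "monomial_space N k \<subseteq> real_functions.span (B \<union> ?C)"
  proof
    fix v :: "complex ^ 'n \<Rightarrow> real" assume "v \<in> monomial_space N k"
    from monomial_eigenspace_decomposition[OF this] obtain e u where
      "e \<in> monomial_eigenspace N k" "u \<in> monomial_space2 N k" "v = e + u" by blast
    then show "v \<in> real_functions.span (B \<union> ?C)"
      unfolding real_functions.span_Un B(4) monomial_space2_def by blast
  qed
  have "B \<union> ?C \<subseteq> monomial_space N k"
    using B(2) monomial_space2_subset[of N k] real_functions.span_superset[of ?C]
    by (auto simp: monomial_eigenspace_def monomial_space2_def)
  with sub BC(1) have "card (B \<union> ?C) = real_functions.dim (monomial_space N k)"
    by (intro real_functions.basis_card_eq_dim)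
  also have "\<dots> = card ?A"
    unfolding monomial_space_def by (rule real_functions.dim_span_eq_card_independent[OF A(2)])
  finally show ?thesis
    using A(1) C(1) B(1,5) BC(2) finite_exponents2[of N k] by (simp add: card_Un_disjoint)
qed

section \<open>Density of the polynomials and completeness\<close>

inductive bipolynomial :: "(complex ^ 'n::finite \<Rightarrow> complex) \<Rightarrow> bool" where
  bipolynomial_monomial: "bipolynomial (\<lambda>z. c * bimonomial x z)"
| bipolynomial_add: "bipolynomial f \<Longrightarrow> bipolynomial g \<Longrightarrow> bipolynomial (\<lambda>z. f z + g z)"

lemma bipolynomial_mult:
  assumes "bipolynomial f" "bipolynomial g"
  shows "bipolynomial (\<lambda>z. f z * g z)"
  using assms
proof (induction f)
  case (bipolynomial_monomial c x)
  then show ?case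
  proof (induction g)
    case (bipolynomial_monomial d y)
    have "bipolynomial (\<lambda>z. (c * d) * bimonomial (\<lambda>j. x j + y j) z)" by (rule bipolynomial.intros)
    then show ?case by (simp add: bimonomial_def power_add prod.distrib mult_ac)
  qed (simp add: distrib_left bipolynomial_add)
qed (simp add: distrib_right bipolynomial_add)

lemma bipolynomial_const: "bipolynomial (\<lambda>z. c)"
  using bipolynomial_monomial[of c "\<lambda>_. 0"] by (simp add: bimonomial_def)

lemma bipolynomial_coordinate: "bipolynomial (coordinate j)"
proof -
  have "bipolynomial (\<lambda>z. 1 * bimonomial (\<lambda>l. if l = j then 1 else 0) z)" by (rule bipolynomial.intros)
  then show ?thesis by (simp add: bimonomial_def if_distrib[of "\<lambda>n. _ ^ n"] cong: if_cong)
qed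

lemma bipolynomial_sum:
  "(\<And>i. i \<in> I \<Longrightarrow> bipolynomial (f i)) \<Longrightarrow> bipolynomial (\<lambda>z. \<Sum>i\<in>I. f i z)"
  by (induction I rule: infinite_finite_induct) (auto intro: bipolynomial_const bipolynomial_add)

lemma bipolynomial_real_polynomial_function:
  fixes g :: "complex ^ 'n::finite \<Rightarrow> real"
  assumes "real_polynomial_function g"
  shows "bipolynomial (\<lambda>z. of_real (g z))"
  using assms
proof induction
  case (linear f)
  have fz: "f z = (\<Sum>i\<in>UNIV. Re (z $ i) * f (axis i 1) + Im (z $ i) * f (axis i \<i>))" for z
  proof -
    have "f z = f (\<Sum>b\<in>Basis. (z \<bullet> b) *\<^sub>R b)" by (simp add: euclidean_representation)
    also have "\<dots> = (\<Sum>b\<in>Basis. (z \<bullet> b) * f b)"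
      using bounded_linear.linear[OF linear] by (simp add: linear_sum linear_scale)
    also have "\<dots> = (\<Sum>i\<in>UNIV. Re (z $ i) * f (axis i 1) + Im (z $ i) * f (axis i \<i>))"
      unfolding sum_Basis_complex_vec by (simp add: inner_axis)
    finally show ?thesis .
  qed
  have ReIm: "complex_of_real (Re w) = (1/2) * w + (1/2) * cnj w" "complex_of_real (Im w) = - (\<i>/2) * w + (\<i>/2) * cnj w" for w
    by (auto simp: complex_eq_iff)
  have eq: "(\<lambda>z. complex_of_real (f z)) = (\<lambda>z. \<Sum>i\<in>UNIV.
      ((1/2) * coordinate (Inl i) z + (1/2) * coordinate (Inr i) z) * of_real (f (axis i 1)) +
      (- (\<i>/2) * coordinate (Inl i) z + (\<i>/2) * coordinate (Inr i) z) * of_real (f (axis i \<i>)))"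
    by (rule ext, subst fz) (simp only: coordinate_def sum.case of_real_sum of_real_add of_real_mult ReIm)
  show ?case
    by (subst eq) (intro bipolynomial_sum bipolynomial_add bipolynomial_mult bipolynomial_const bipolynomial_coordinate)
qed (auto intro: bipolynomial_const bipolynomial_add bipolynomial_mult)

definition all_monomials :: "(complex ^ 'n::finite \<Rightarrow> real) set" where
  "all_monomials = range sphere_monomial"

text \<open>\<open>re_im\<close> is only real-linear; a complex coefficient is absorbed by using the
  conjugate exponent as well.\<close>

lemma bipolynomial_span:
  assumes "bipolynomial h"
  shows "(\<lambda>z. if norm z = 1 then re_im (h z) else 0) \<in> real_functions.span all_monomials"
  using assms
proof induction
  case (bipolynomial_monomial c x)
  have "re_im (c * w) = Re c * re_im w + Im c * re_im (cnj w)" for w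
    by (simp add: re_im_def algebra_simps)
  then have "(\<lambda>z. if norm z = 1 then re_im (c * bimonomial x z) else 0) =
     (\<lambda>z. Re c * sphere_monomial x z) + (\<lambda>z. Im c * sphere_monomial (x \<circ> conj_index) z)"
    by (auto simp: sphere_monomial_def bimonomial_conj)
  also have "\<dots> \<in> real_functions.span all_monomials"
    by (intro real_functions.span_add real_functions.span_scale real_functions.span_base)
      (auto simp: all_monomials_def)
  finally show ?case .
next
  case (bipolynomial_add f g)
  have "(\<lambda>z. if norm z = 1 then re_im (f z + g z) else 0) = (\<lambda>z. if norm z = 1 then re_im (f z) else 0)
     + (\<lambda>z. if norm z = 1 then re_im (g z) else 0)"
    by (auto simp: re_im_simps)
  then show ?case using real_functions.span_add[OF bipolynomial_add.IH] by simp
qed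

lemma all_monomials_smooth: "real_functions.span all_monomials \<subseteq> smooth_sphere_functions"
  by (rule real_functions.span_minimal[OF _ smooth_sphere_functions_subspace])
    (auto simp: all_monomials_def sphere_monomial_smooth)

text \<open>If a polynomial \<open>p\<close> is within \<open>e\<close> of \<open>f\<close> on the
  sphere, then \<open>sphere_inner f f = sphere_inner (f - p) f\<close>, and this is at most
  \<open>e * I\<close> with \<open>I\<close> independent of \<open>e\<close>. Stone-Weierstrass
  provides such a \<open>p\<close> for every \<open>e\<close>.\<close>

lemma orthogonal_to_polynomials_imp_zero:
  fixes f :: "complex ^ 'n::finite \<Rightarrow> real"
  assumes f: "f \<in> smooth_sphere_functions" and perp: "\<And>p. p \<in> real_functions.span all_monomials \<Longrightarrow> sphere_inner f p = 0"
  shows "f = 0"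
proof (rule sphere_inner_definite[OF f])
  let ?w = "\<lambda>y::complex ^ 'n. annulus_cutoff y / norm y"
  let ?F = "ray_extension f"
  define I where "I = integral\<^sup>L lborel (\<lambda>y. ?w y * \<bar>?F y\<bar>)"
  have cont: "continuous_on (- {0}) ?F" by (rule continuous_ray_extension[OF f])
  have bound: "\<bar>sphere_inner f f\<bar> \<le> e * I" if e: "e > 0" for e
  proof -
    have "continuous_on (sphere 0 1) f"
    proof (rule continuous_on_cong[THEN iffD1, OF refl])
      show "continuous_on (sphere 0 1) ?F" by (rule continuous_on_subset[OF cont]) auto
    qed (auto simp: ray_extension_on_sphere)
    then obtain g where g: "real_polynomial_function g" "\<And>x. x \<in> sphere 0 1 \<Longrightarrow> \<bar>f x - g x\<bar> < e"
      using Stone_Weierstrass_real_polynomial_function[OF compact_sphere _ e] by blast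
    define p where "p = (\<lambda>z. if norm z = 1 then re_im (of_real (g z)) else 0)"
    have p: "p \<in> real_functions.span all_monomials"
      unfolding p_def by (rule bipolynomial_span[OF bipolynomial_real_polynomial_function[OF g(1)]])
    then have pS: "p \<in> smooth_sphere_functions" using all_monomials_smooth by blast
    have fp: "f - p \<in> smooth_sphere_functions"
      by (rule real_functions.subspace_diff[OF smooth_sphere_functions_subspace f pS])
    have "sphere_inner f f = sphere_inner (f - p) f"
      using sphere_inner_add[OF fp pS f] perp[OF p] sphere_inner_commute[of p f] by simp
    also have "\<bar>\<dots>\<bar> \<le> integral\<^sup>L lborel (\<lambda>y. e * (?w y * \<bar>?F y\<bar>))"
      unfolding sphere_inner_def
    proof (rule integral_abs_bound_integral)
      show "integrable lborel (\<lambda>y. ?w y * (ray_extension (f - p) y * ?F y))"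
        by (intro integrable_sphere_inner continuous_intros continuous_ray_extension f fp)
      show "integrable lborel (\<lambda>y. e * (?w y * \<bar>?F y\<bar>))"
        by (intro integrable_mult_right integrable_sphere_inner continuous_intros cont)
      fix y :: "complex ^ 'n"
      have "\<bar>ray_extension (f - p) y\<bar> \<le> e"
        using g(2)[of "sgn y"] smooth_sphere_functions_zero[OF fp, of "sgn y"] e
        by (cases "norm (sgn y) = 1") (auto simp: ray_extension_def p_def re_im_def)
      then have "\<bar>ray_extension (f - p) y\<bar> * (?w y * \<bar>?F y\<bar>) \<le> e * (?w y * \<bar>?F y\<bar>)"
        by (intro mult_right_mono) (auto simp: annulus_cutoff_def)
      then show "\<bar>?w y * (ray_extension (f - p) y * ?F y)\<bar> \<le> e * (?w y * \<bar>?F y\<bar>)"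
        by (simp add: abs_mult mult_ac annulus_cutoff_def)
    qed
    finally show ?thesis by (simp only: I_def integral_mult_right_zero)
  qed
  show "sphere_inner f f = 0"
  proof (rule ccontr)
    assume n: "sphere_inner f f \<noteq> 0"
    \<comment> \<open>Adding 1 keeps the divisor positive even if \<open>I\<close> is zero; the
      resulting \<open>e\<close> bounds \<open>sphere_inner f f\<close> by half of its own absolute
      value.\<close>
    define c where "c = \<bar>I\<bar> + 1"
    have c: "c > 0" by (simp add: c_def)
    define e where "e = \<bar>sphere_inner f f\<bar> / (2 * c)"
    have e: "e > 0" using n c by (simp add: e_def)
    have "e * I \<le> e * c" using e by (intro mult_left_mono) (auto simp: c_def)
    also have "\<dots> = \<bar>sphere_inner f f\<bar> / 2" using c by (simp add: e_def)
    finally show False using bound[OF e] n by linarith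
  qed
qed

lemma sphere_laplacian_eigenfunction_iff:
  assumes "f \<in> smooth_sphere_functions"
  shows "shifted_laplacian \<mu> f = 0 \<longleftrightarrow> (\<forall>z. norm z = 1 \<longrightarrow> sphere_laplacian f z = \<mu> * f z)"
  using smooth_sphere_functions_zero[OF assms]
  by (auto simp: shifted_laplacian_def laplacian_function_def fun_eq_iff)

lemma total_weight_zero [simp]: "total_weight (\<lambda>_. 0) x = 0"
proof -
  have "weight (\<lambda>_. 0) j = 0" for j :: "'a + 'a" by (cases j) (auto simp: weight_def)
  then show ?thesis by (simp add: total_weight_def)
qed

text \<open>With all weights zero every function is invariant, so this is the completeness of the spherical
  harmonics.\<close>

lemma eigenfunction_in_monomial_space:
  fixes f :: "complex ^ 'n::finite \<Rightarrow> real"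
  assumes f: "f \<in> smooth_sphere_functions" and eig: "shifted_laplacian (eigenvalue CARD('n) k) f = 0"
  shows "f \<in> monomial_eigenspace (\<lambda>_. 0) k"
proof -
  let ?\<mu> = "eigenvalue CARD('n)"
  let ?E = "monomial_eigenspace (\<lambda>_. 0) :: nat \<Rightarrow> (complex ^ 'n \<Rightarrow> real) set"
  have ES: "e \<in> smooth_sphere_functions" "shifted_laplacian (?\<mu> j) e = 0" if "e \<in> ?E j" for e j
    using that monomial_space_smoothD(1) by (auto simp: monomial_eigenspace_def)
  obtain B where B: "finite B" "B \<subseteq> ?E k" "real_functions.span B = ?E k"
    by (rule monomial_eigenspace_basis)
  obtain g where g: "g \<in> ?E k" "\<And>h. h \<in> ?E k \<Longrightarrow> sphere_inner (f - g) h = 0"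
    using sphere_projection_exists[OF B(1) _ f] B(2,3) ES(1) by blast
  \<comment> \<open>The part of \<open>f\<close> orthogonal to the polynomial eigenfunctions with
    the same eigenvalue. It is still an eigenfunction, hence orthogonal to the other eigenspaces as
    well, and so to every polynomial.\<close>
  define r where "r = f - g"
  have r: "r \<in> smooth_sphere_functions" "shifted_laplacian (?\<mu> k) r = 0"
    unfolding r_def using real_functions.subspace_diff[OF smooth_sphere_functions_subspace f ES(1)[OF g(1)]]
      shifted_laplacian_diff[OF f ES(1)[OF g(1)], of "?\<mu> k"] ES(2)[OF g(1)] eig by auto
  have perp_eigen: "sphere_inner r e = 0" if e: "e \<in> ?E j" for e j
  proof (cases "j = k")
    case False
    then have "?\<mu> k \<noteq> ?\<mu> j" by (subst eigenvalue_eq_iff) auto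
    then show ?thesis
      using sphere_laplacian_selfadjoint[OF sphere_smooth_ray_extension[OF r(1)] sphere_smooth_ray_extension[OF ES(1)[OF e]]]
        sphere_laplacian_eigenfunction_iff[OF r(1)] r(2) sphere_laplacian_eigenfunction_iff[OF ES(1)[OF e]] ES(2)[OF e]
      by blast
  qed (use g(2) e in \<open>auto simp: r_def\<close>)
  have perp_space: "sphere_inner r v = 0" if "v \<in> monomial_space (\<lambda>_. 0) j" for v j
    using that
  proof (induction j arbitrary: v rule: less_induct)
    case (less j)
    obtain e u where eu: "e \<in> ?E j" "u \<in> monomial_space2 (\<lambda>_. 0) j" "v = e + u"
      using monomial_eigenspace_decomposition[OF less.prems] by blast
    have "sphere_inner r u = 0"
    proof (cases "j \<ge> 2")
      case True
      then show ?thesis using less.IH[of "j - 2" u] eu(2) by (simp add: monomial_space2_eq)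
    next
      case False
      then have "u = 0" using eu(2) by (simp add: monomial_space2_eq)
      then show ?thesis by (simp add: sphere_inner_def ray_extension_def)
    qed
    then show ?case
      using sphere_inner_add[OF ES(1)[OF eu(1)] monomial_space_smoothD(2)[OF eu(2)] r(1)] perp_eigen[OF eu(1)] eu(3)
        sphere_inner_commute[of r v] sphere_inner_commute[of r e] sphere_inner_commute[of r u] by (metis add.right_neutral)
  qed
  have "r = 0"
  proof (rule orthogonal_to_polynomials_imp_zero[OF r(1)])
    have sub: "real_functions.subspace {p \<in> smooth_sphere_functions. sphere_inner p r = 0}"
    proof (rule real_functions.subspaceI)
      show "0 \<in> {p \<in> smooth_sphere_functions. sphere_inner p r = 0}"
        using real_functions.subspace_0[OF smooth_sphere_functions_subspace]
        by (simp add: sphere_inner_def ray_extension_def)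
    qed (auto simp del: plus_fun_apply simp: sphere_inner_add sphere_inner_scale r(1) smooth_sphere_functions_add smooth_sphere_functions_scale)
    have "all_monomials \<subseteq> {p \<in> smooth_sphere_functions. sphere_inner p r = 0}"
    proof
      fix p :: "complex ^ 'n \<Rightarrow> real" assume "p \<in> all_monomials"
      then obtain x where x: "p = sphere_monomial x" by (auto simp: all_monomials_def)
      have "p \<in> monomial_space (\<lambda>_. 0) (sum x UNIV)"
        unfolding x monomial_space_def by (intro real_functions.span_base) (auto simp: exponents_def)
      then show "p \<in> {p \<in> smooth_sphere_functions. sphere_inner p r = 0}"
        using perp_space monomial_space_smoothD(1) sphere_inner_commute by (metis (mono_tags, lifting) mem_Collect_eq)
    qed
    then have "real_functions.span all_monomials \<subseteq> {p \<in> smooth_sphere_functions. sphere_inner p r = 0}"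
      by (rule real_functions.span_minimal[OF _ sub])
    then show "sphere_inner r p = 0" if "p \<in> real_functions.span all_monomials" for p
      using that sphere_inner_commute[of r p] by auto
  qed
  then show ?thesis using g(1) by (simp add: r_def)
qed

section \<open>Invariance under the circle action\<close>

lemma norm_weighted_rotation: "norm (weighted_rotation N t z) = norm z"
  by (simp add: weighted_rotation_def norm_vec_def norm_mult)

lemma prod_cis: "(\<Prod>j\<in>A. cis (a j)) = cis (\<Sum>j\<in>A. a j)"
  by (induction A rule: infinite_finite_induct) (auto simp: cis_mult)

lemma bimonomial_weighted_rotation:
  "bimonomial x (weighted_rotation N t z) = cis (of_int (total_weight N x) * t) * bimonomial x z"
proof -
  let ?w = "\<chi> i. cis (real (N i) * t)"
  have "coordinate j ?w = cis (of_int (weight N j) * t)" for j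
    by (auto simp: coordinate_def weight_def cis_cnj split: sum.splits)
  then have "bimonomial x ?w = (\<Prod>j\<in>UNIV. cis (real (x j) * (of_int (weight N j) * t)))"
    by (simp add: bimonomial_def Complex.DeMoivre)
  also have "\<dots> = cis (of_int (total_weight N x) * t)"
    by (simp add: prod_cis total_weight_def sum_distrib_right mult.assoc)
  finally show ?thesis
    using bimonomial_mult[of x ?w z] by (simp add: weighted_rotation_def)
qed

text \<open>A geometric sum. The bound excludes nonzero multiples of \<open>M\<close>, for which the
  sum would also be \<open>M\<close>.\<close>

lemma sum_roots_of_unity_power:
  assumes "\<bar>m\<bar> < int M"
  shows "(\<Sum>j<M. cis (of_int m * (2 * pi * real j / real M))) = (if m = 0 then of_nat M else 0)"
proof (cases "m = 0")
  case False
  define q where "q = cis (of_int m * (2 * pi / real M))"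
  have M: "M > 0" using assms by linarith
  have pow: "cis (of_int m * (2 * pi * real j / real M)) = q ^ j" for j
    unfolding q_def Complex.DeMoivre by (rule arg_cong[of _ _ cis]) (simp add: field_simps)
  have "q \<noteq> 1"
  proof
    assume "q = 1"
    then obtain n where "of_int m * (2 * pi / real M) = of_int n * (2 * pi)"
      unfolding q_def cis_eq_1_iff by blast
    then have "real_of_int m = real_of_int (n * int M)" using M by (simp add: field_simps)
    then have "m = n * int M" by (simp only: of_int_eq_iff)
    with assms False show False by (auto simp: abs_mult)
  qed
  moreover have "q ^ M = 1"
    using cis_multiple_2pi[of "of_int m"] M unfolding q_def Complex.DeMoivre by (simp add: mult_ac)
  ultimately have "(\<Sum>j<M. q ^ j) = 0" by (simp add: geometric_sum)
  then show ?thesis using False by (simp only: pow if_False)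
qed simp

text \<open>Averaging over a large enough cyclic subgroup of the circle projects onto the span of the
  invariant monomials.\<close>

lemma invariant_in_monomial_space:
  fixes f :: "complex ^ 'n::finite \<Rightarrow> real"
  assumes f: "f \<in> monomial_space (\<lambda>_. 0) k"
    and inv: "\<And>t z. norm z = 1 \<Longrightarrow> f (weighted_rotation N t z) = f z"
  shows "f \<in> monomial_space N k"
proof -
  \<comment> \<open>Larger than the absolute weight of any monomial of degree \<open>k\<close>, so
    that the cyclic group of order \<open>M\<close> already tells weight zero from the other
    weights.\<close>
  define M where "M = nat (int k * (\<Sum>j\<in>UNIV. \<bar>weight N j\<bar>) + 1)"
  have wM: "\<bar>total_weight N x\<bar> < int M" if "sum x UNIV = k" for x
  proof -
    have "\<bar>total_weight N x\<bar> \<le> (\<Sum>j\<in>UNIV. int (x j) * \<bar>weight N j\<bar>)"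
      unfolding total_weight_def by (rule order_trans[OF sum_abs]) (simp add: abs_mult)
    also have "\<dots> \<le> (\<Sum>j\<in>UNIV. int k * \<bar>weight N j\<bar>)"
      using that member_le_sum[of _ UNIV x] by (intro sum_mono mult_right_mono) auto
    finally show ?thesis by (simp add: M_def sum_distrib_left[symmetric] sum_nonneg)
  qed
  have M0: "M > 0" using wM[of "\<lambda>j. if j = Inl undefined then k else 0"] by simp
  define A where "A h = (\<lambda>z. (\<Sum>j<M. h (weighted_rotation N (2 * pi * real j / real M) z)) / real M)" for h :: "complex ^ 'n \<Rightarrow> real"
  have A_mono: "A (sphere_monomial x) = (if total_weight N x = 0 then sphere_monomial x else 0)"
    if x: "sum x UNIV = k" for x
  proof
    fix z :: "complex ^ 'n"
    show "A (sphere_monomial x) z = (if total_weight N x = 0 then sphere_monomial x else 0) z"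
    proof (cases "norm z = 1")
      case True
      have "A (sphere_monomial x) z = re_im ((\<Sum>j<M. cis (of_int (total_weight N x) * (2 * pi * real j / real M))) * bimonomial x z) / real M"
        using True by (simp add: A_def sphere_monomial_def norm_weighted_rotation bimonomial_weighted_rotation
            re_im_simps(4) sum_distrib_right)
      then show ?thesis
        unfolding sum_roots_of_unity_power[OF wM[OF x]] using True M0
        by (auto simp: re_im_simps sphere_monomial_def)
    qed (simp add: A_def sphere_monomial_def norm_weighted_rotation)
  qed
  have "A h \<in> monomial_space N k" if "h \<in> monomial_space (\<lambda>_. 0) k" for h
  proof -
    have sub: "real_functions.subspace {h. A h \<in> monomial_space N k}"
    proof (rule real_functions.subspaceI)
      have "A 0 = 0" by (auto simp: A_def)
      then show "0 \<in> {h. A h \<in> monomial_space N k}"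
        using real_functions.subspace_0[OF subspace_monomial_space(1)] by simp
      have "A (u + v) = A u + A v" for u v
        by (auto simp: A_def sum.distrib add_divide_distrib)
      then show "u + v \<in> {h. A h \<in> monomial_space N k}"
        if "u \<in> {h. A h \<in> monomial_space N k}" "v \<in> {h. A h \<in> monomial_space N k}" for u v
        using that real_functions.subspace_add[OF subspace_monomial_space(1)] by simp
      have "A (\<lambda>x. c * u x) = (\<lambda>x. c * A u x)" for c u
        by (auto simp: A_def sum_distrib_left)
      then show "(\<lambda>x. c * u x) \<in> {h. A h \<in> monomial_space N k}" if "u \<in> {h. A h \<in> monomial_space N k}" for c u
        using that real_functions.subspace_scale[OF subspace_monomial_space(1)] by simp
    qed
    have "sphere_monomial ` exponents (\<lambda>_. 0) k \<subseteq> {h. A h \<in> monomial_space N k}"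
    proof clarify
      fix x :: "'n + 'n \<Rightarrow> nat" assume "x \<in> exponents (\<lambda>_. 0) k"
      then have x: "sum x UNIV = k" by (simp add: exponents_def)
      show "A (sphere_monomial x) \<in> monomial_space N k"
      proof (cases "total_weight N x = 0")
        case True
        then have "x \<in> exponents N k" using x by (simp add: exponents_def)
        then show ?thesis unfolding A_mono[OF x] monomial_space_def using True
          by (auto intro: real_functions.span_base)
      next
        case False
        then have "A (sphere_monomial x) = 0" using A_mono[OF x] by simp
        then show ?thesis using real_functions.subspace_0[OF subspace_monomial_space(1)] by metis
      qed
    qed
    from real_functions.span_minimal[OF this sub] that show ?thesis
      by (auto simp: monomial_space_def)
  qed
  moreover have "A f = f"
  proof
    fix z :: "complex ^ 'n"
    show "A f z = f z"
    proof (cases "norm z = 1")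
      case True
      then show ?thesis using M0 by (simp add: A_def inv)
    next
      case False
      then show ?thesis using smooth_sphere_functions_zero[OF monomial_space_smoothD(1)[OF f]]
        by (simp add: A_def norm_weighted_rotation)
    qed
  qed
  ultimately show ?thesis using f by metis
qed

lemma monomial_space_invariant:
  fixes f :: "complex ^ 'n::finite \<Rightarrow> real"
  assumes "f \<in> monomial_space N k"
  shows "f (weighted_rotation N t z) = f z"
proof -
  have sub: "real_functions.subspace {f :: complex ^ 'n \<Rightarrow> real. f (weighted_rotation N t z) = f z}"
    by (rule real_functions.subspaceI) auto
  have "sphere_monomial ` exponents N k \<subseteq> {f. f (weighted_rotation N t z) = f z}"
    by (auto simp: sphere_monomial_def norm_weighted_rotation bimonomial_weighted_rotation exponents_def)
  from real_functions.span_minimal[OF this sub] assms show ?thesis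
    by (auto simp: monomial_space_def)
qed

text \<open>Completeness makes an eigenfunction a polynomial of degree \<open>k\<close> with
  monomials of any weight, and invariance then leaves only weight zero.\<close>

lemma wps_eigenspace_eq:
  fixes N :: "'n::finite \<Rightarrow> nat"
  shows "wps_eigenspace N (eigenvalue CARD('n) k) = monomial_eigenspace N k"
proof (intro subset_antisym subsetI)
  fix f :: "complex ^ 'n \<Rightarrow> real" assume "f \<in> wps_eigenspace N (eigenvalue CARD('n) k)"
  then have f: "f \<in> smooth_sphere_functions" "\<And>t z. norm z = 1 \<Longrightarrow> f (weighted_rotation N t z) = f z"
    "\<And>z. norm z = 1 \<Longrightarrow> sphere_laplacian f z = eigenvalue CARD('n) k * f z"
    by (auto simp: wps_eigenspace_def wps_smooth_functions_def)
  then have "shifted_laplacian (eigenvalue CARD('n) k) f = 0"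
    by (simp add: sphere_laplacian_eigenfunction_iff)
  with eigenfunction_in_monomial_space[OF f(1)] invariant_in_monomial_space[OF _ f(2)]
  show "f \<in> monomial_eigenspace N k" by (auto simp: monomial_eigenspace_def)
next
  fix f :: "complex ^ 'n \<Rightarrow> real" assume f: "f \<in> monomial_eigenspace N k"
  then have fV: "f \<in> monomial_space N k" by (simp add: monomial_eigenspace_def)
  note fS = monomial_space_smoothD(1)[OF fV]
  have "\<forall>z. norm z = 1 \<longrightarrow> sphere_laplacian f z = eigenvalue CARD('n) k * f z"
    using f sphere_laplacian_eigenfunction_iff[OF fS] by (auto simp: monomial_eigenspace_def)
  then show "f \<in> wps_eigenspace N (eigenvalue CARD('n) k)"
    using fS monomial_space_invariant[OF fV] by (auto simp: wps_eigenspace_def wps_smooth_functions_def)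
qed

text \<open>The dimension formula is a recursion from degree \<open>k - 2\<close> to degree
  \<open>k\<close> that can be solved for the number of exponents.\<close>

theorem laplace_spectrum_determines_exponents:
  fixes N N' :: "'n::finite \<Rightarrow> nat"
  assumes "laplace_spectrum N = laplace_spectrum N'"
  shows "card (exponents N k) = card (exponents N' k)"
proof (induction k rule: less_induct)
  case (less k)
  have "card (exponents2 N k) = card (exponents2 N' k)"
    using less.IH[of "k - 2"] by (simp add: exponents2_eq)
  moreover have "real_functions.dim (monomial_eigenspace N k) = real_functions.dim (monomial_eigenspace N' k)"
    using fun_cong[OF assms, of "eigenvalue CARD('n) k"] by (simp add: laplace_spectrum_def wps_eigenspace_eq)
  ultimately show ?case using dim_monomial_eigenspace[of N k] dim_monomial_eigenspace[of N' k] by simp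
qed

section \<open>The generating function of the invariant monomials\<close>

text \<open>Functions that vanish outside \<open>J\<close> make the step to
  \<open>insert j J\<close> a single function update, as the induction over the set of variables
  requires.\<close>

definition multiindices :: "'j set \<Rightarrow> nat \<Rightarrow> ('j \<Rightarrow> nat) set" where
  "multiindices J k = {x. (\<forall>j. j \<notin> J \<longrightarrow> x j = 0) \<and> sum x J = k}"

lemma finite_multiindices:
  assumes "finite J" shows "finite (multiindices J k)"
proof (rule finite_subset)
  show "multiindices J k \<subseteq> {x. \<forall>j. (j \<in> J \<longrightarrow> x j \<in> {..k}) \<and> (j \<notin> J \<longrightarrow> x j = 0)}"
    using assms by (auto simp: multiindices_def intro: member_le_sum)
qed (rule finite_set_of_finite_funs[OF assms finite_atMost])

lemma sum_multiindices_insert: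
  fixes c :: "'j \<Rightarrow> 'a::comm_semiring_1"
  assumes "finite J" "j \<notin> J"
  shows "(\<Sum>x\<in>multiindices (insert j J) k. \<Prod>i\<in>insert j J. c i ^ x i) =
    (\<Sum>l\<le>k. c j ^ l * (\<Sum>x\<in>multiindices J (k - l). \<Prod>i\<in>J. c i ^ x i))"
proof -
  have "(\<Sum>l\<le>k. c j ^ l * (\<Sum>x\<in>multiindices J (k - l). \<Prod>i\<in>J. c i ^ x i)) =
     (\<Sum>(l, x)\<in>(SIGMA l:{..k}. multiindices J (k - l)). c j ^ l * (\<Prod>i\<in>J. c i ^ x i))"
    unfolding sum_distrib_left by (rule sum.Sigma) (auto intro: finite_multiindices assms)
  also have "\<dots> = (\<Sum>x\<in>multiindices (insert j J) k. \<Prod>i\<in>insert j J. c i ^ x i)"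
  proof (rule sum.reindex_bij_witness[where i = "\<lambda>x. (x j, x(j := 0))" and j = "\<lambda>(l, x). x(j := l)"])
    fix a assume a: "a \<in> (SIGMA l:{..k}. multiindices J (k - l))"
    obtain l x where lx: "a = (l, x)" by force
    have x: "l \<le> k" "\<And>i. i \<notin> J \<Longrightarrow> x i = 0" "sum x J = k - l" using a by (auto simp: lx multiindices_def)
    have s: "sum (x(j := l)) J = sum x J" "(\<Prod>i\<in>J. c i ^ (x(j := l)) i) = (\<Prod>i\<in>J. c i ^ x i)"
      using assms(2) by (auto intro!: sum.cong prod.cong)
    show "((case a of (l, x) \<Rightarrow> x(j := l)) j, (case a of (l, x) \<Rightarrow> x(j := l))(j := 0)) = a"
      using x(2)[OF assms(2)] by (auto simp: lx fun_eq_iff)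
    show "(case a of (l, x) \<Rightarrow> x(j := l)) \<in> multiindices (insert j J) k"
      using x s assms by (auto simp: lx multiindices_def)
    show "(\<Prod>i\<in>insert j J. c i ^ (case a of (l, x) \<Rightarrow> x(j := l)) i) = (case a of (l, x) \<Rightarrow> c j ^ l * (\<Prod>i\<in>J. c i ^ x i))"
      using s assms by (simp add: lx)
  next
    fix x assume "x \<in> multiindices (insert j J) k"
    then have x: "\<And>i. i \<notin> insert j J \<Longrightarrow> x i = 0" "x j + sum x J = k"
      using assms by (auto simp: multiindices_def)
    have "sum (x(j := 0)) J = sum x J" using assms(2) by (auto intro!: sum.cong)
    then show "(x j, x(j := 0)) \<in> (SIGMA l:{..k}. multiindices J (k - l))"
      using x by (auto simp: multiindices_def)
  qed auto
  finally show ?thesis ..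
qed

text \<open>One variable is added at a time by a Cauchy product; absolute convergence is carried
  through the induction for its sake.\<close>

lemma prod_geometric_sums:
  fixes c :: "'j \<Rightarrow> complex"
  assumes "finite J" "\<And>j. j \<in> J \<Longrightarrow> norm (c j) < 1"
  shows "(\<lambda>k. \<Sum>x\<in>multiindices J k. \<Prod>j\<in>J. c j ^ x j) sums (\<Prod>j\<in>J. 1 / (1 - c j))
    \<and> summable (\<lambda>k. norm (\<Sum>x\<in>multiindices J k. \<Prod>j\<in>J. c j ^ x j))"
  using assms
proof (induction J rule: finite_induct)
  case empty
  have m: "multiindices ({} :: 'j set) k = (if k = 0 then {\<lambda>_. 0} else {})" for k
    by (auto simp: multiindices_def)
  have "(\<lambda>k. if k = 0 then 1 else 0 :: complex) sums 1" using sums_single[of 0 "\<lambda>_. 1 :: complex"] by simp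
  moreover have "summable (\<lambda>k. norm (if k = 0 then 1 else 0 :: complex))"
    by (rule summable_finite[of "{0}"]) auto
  moreover have "(\<Sum>x\<in>multiindices {} k. \<Prod>j\<in>{}. c j ^ x j) = (if k = 0 then 1 else 0)" for k
    by (simp add: m)
  ultimately show ?case by (simp only: prod.empty simp_thms)
next
  case (insert j J)
  let ?h = "\<lambda>k. \<Sum>x\<in>multiindices J k. \<Prod>j\<in>J. c j ^ x j"
  have IH: "?h sums (\<Prod>j\<in>J. 1 / (1 - c j))" "summable (\<lambda>k. norm (?h k))"
    using insert.IH insert.prems by auto
  have cj: "norm (c j) < 1" using insert.prems by simp
  have geo: "summable (\<lambda>l. norm (c j ^ l))" "(\<lambda>l. c j ^ l) sums (1 / (1 - c j))"
    using cj geometric_sums[of "c j"] by (auto simp: norm_power intro: summable_geometric)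
  note eq = sum_multiindices_insert[OF insert.hyps(1,2), where c = c]
  have "(\<lambda>k. \<Sum>l\<le>k. c j ^ l * ?h (k - l)) sums ((\<Sum>l. c j ^ l) * (\<Sum>k. ?h k))"
    by (rule Cauchy_product_sums[OF geo(1) IH(2)])
  then have 1: "(\<lambda>k. \<Sum>l\<le>k. c j ^ l * ?h (k - l)) sums (\<Prod>j\<in>insert j J. 1 / (1 - c j))"
    using sums_unique[OF geo(2)] sums_unique[OF IH(1)] insert.hyps by simp
  have "summable (\<lambda>k. \<Sum>l\<le>k. norm (c j ^ l) * norm (?h (k - l)))"
    by (rule summable_Cauchy_product) (use geo IH(2) in auto)
  then have 2: "summable (\<lambda>k. norm (\<Sum>l\<le>k. c j ^ l * ?h (k - l)))"
  proof (rule summable_comparison_test')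
    show "norm (norm (\<Sum>l\<le>k. c j ^ l * ?h (k - l))) \<le> (\<Sum>l\<le>k. norm (c j ^ l) * norm (?h (k - l)))" for k
      using norm_sum[of "\<lambda>l. c j ^ l * ?h (k - l)" "{..k}"] by (simp add: norm_mult)
  qed
  show ?case unfolding eq using 1 2 by blast
qed

text \<open>Setting every \<open>c j\<close> to \<open>r\<close> in
  \<open>prod_geometric_sums\<close> counts the multiindices. The series is the majorant for the
  exchange of sum and contour integral.\<close>

lemma summable_card_multiindices:
  fixes r :: real
  assumes "finite J" "0 \<le> r" "r < 1"
  shows "summable (\<lambda>k. card (multiindices J k) * r ^ k)"
proof -
  have "summable (\<lambda>k. norm (\<Sum>x\<in>multiindices J k. \<Prod>j\<in>J. complex_of_real r ^ x j))"
    using prod_geometric_sums[OF assms(1), of "\<lambda>_. of_real r"] assms by simp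
  also have "(\<lambda>k. norm (\<Sum>x\<in>multiindices J k. \<Prod>j\<in>J. complex_of_real r ^ x j)) = (\<lambda>k. card (multiindices J k) * r ^ k)"
  proof
    fix k
    have "(\<Sum>x\<in>multiindices J k. \<Prod>j\<in>J. complex_of_real r ^ x j) = (\<Sum>x\<in>multiindices J k. complex_of_real r ^ k)"
      by (intro sum.cong refl) (auto simp: multiindices_def power_sum[symmetric])
    then show "norm (\<Sum>x\<in>multiindices J k. \<Prod>j\<in>J. complex_of_real r ^ x j) = card (multiindices J k) * r ^ k"
      using assms by (simp add: norm_mult norm_power)
  qed
  finally show ?thesis .
qed

lemma has_contour_integral_circle_power_int:
  "((\<lambda>z. z powi m / z) has_contour_integral (if m = 0 then 2 * pi * \<i> else 0)) (circlepath 0 1)"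
proof (cases "m = 0")
  case True
  then show ?thesis
    using Cauchy_integral_circlepath_simple[of "\<lambda>_. 1" 0 1 0] by simp
next
  case False
  have "((\<lambda>z. z powi (m - 1)) has_contour_integral 0) (circlepath 0 1)"
  proof (rule Cauchy_theorem_primitive[where S = "- {0}" and f = "\<lambda>z. z powi m / of_int m"])
    show "((\<lambda>z. z powi m / of_int m) has_field_derivative z powi (m - 1)) (at z within - {0})" if "z \<in> - {0}" for z :: complex
      using that False by (auto intro!: derivative_eq_intros)
  qed auto
  then have "((\<lambda>z. z powi m / z) has_contour_integral 0) (circlepath 0 1)"
    by (rule has_contour_integral_eq) (subst power_int_diff, auto)
  with False show ?thesis by simp
qed

lemma weight_prod_power_int:
  fixes z :: complex
  assumes "z \<noteq> 0"
  shows "(\<Prod>j\<in>UNIV. (z powi weight N j) ^ x j) = z powi total_weight N x"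
proof -
  have pow_sum: "z powi (\<Sum>j\<in>A. a j) = (\<Prod>j\<in>A. z powi a j)" for a :: "'a + 'a \<Rightarrow> int" and A
    by (induction A rule: infinite_finite_induct) (auto simp: power_int_add assms)
  have "z powi (int (x j) * weight N j) = (z powi weight N j) ^ x j" for j
    by (subst mult.commute, subst power_int_mult) simp
  then show ?thesis by (simp add: total_weight_def pow_sum)
qed

text \<open>Expanding the product in geometric series sorts the monomials by degree through
  \<open>t\<close> and by weight through \<open>z\<close>. Dividing by \<open>z\<close> and
  integrating over the circle keeps weight zero only; uniform convergence on the circle allows the
  exchange with the sum.\<close>

lemma exponents_generating_function:
  fixes N :: "'n::finite \<Rightarrow> nat" and t :: complex
  assumes t: "norm t < 1"
  shows "(\<lambda>k. 2 * pi * \<i> * (card (exponents N k) * t ^ k)) sums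
    contour_integral (circlepath 0 1) (\<lambda>z. (\<Prod>j\<in>UNIV. 1 / (1 - t * z powi weight N j)) / z)"
proof -
  let ?X = "multiindices (UNIV :: ('n + 'n) set)"
  define h where "h k z = (\<Sum>x\<in>?X k. \<Prod>j\<in>UNIV. (t * z powi weight N j) ^ x j)" for k and z :: complex
  have h_eq: "h k z = t ^ k * (\<Sum>x\<in>?X k. z powi total_weight N x)" if "z \<noteq> 0" for k z
  proof -
    have "(\<Prod>j\<in>UNIV. (t * z powi weight N j) ^ x j) = t ^ k * z powi total_weight N x" if "x \<in> ?X k" for x
      using that weight_prod_power_int[OF \<open>z \<noteq> 0\<close>, of N x]
      by (simp add: power_mult_distrib prod.distrib power_sum[symmetric] multiindices_def)
    then show ?thesis by (simp add: h_def sum_distrib_left)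
  qed
  have norm1: "norm (z powi m) = 1" if "norm z = 1" for z :: complex and m
    using that by (simp add: norm_power_int)
  have fin: "finite (?X k)" for k by (rule finite_multiindices) auto
  have unif: "uniform_limit (sphere 0 1) (\<lambda>K z. \<Sum>k<K. h k z / z) (\<lambda>z. \<Sum>k. h k z / z) sequentially"
  proof (rule Weierstrass_m_test)
    show "norm (h k z / z) \<le> card (?X k) * norm t ^ k" if "z \<in> sphere 0 1" for k z
    proof -
      have z: "norm z = 1" "z \<noteq> 0" using that by auto
      have "norm (h k z / z) = norm t ^ k * norm (\<Sum>x\<in>?X k. z powi total_weight N x)"
        using z by (simp add: h_eq norm_divide norm_mult norm_power)
      also have "\<dots> \<le> norm t ^ k * card (?X k)"
        using sum_norm_le[of "?X k" "\<lambda>x. z powi total_weight N x" "\<lambda>_. 1"] norm1[OF z(1)]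
        by (intro mult_left_mono) auto
      finally show ?thesis by (simp add: mult.commute)
    qed
    show "summable (\<lambda>k. card (?X k) * norm t ^ k)"
      by (rule summable_card_multiindices) (use t in auto)
  qed
  have suminf: "(\<Sum>k. h k z / z) = (\<Prod>j\<in>UNIV. 1 / (1 - t * z powi weight N j)) / z" if "z \<in> sphere 0 1" for z
  proof -
    have z: "norm z = 1" using that by auto
    have "(\<lambda>k. h k z) sums (\<Prod>j\<in>UNIV. 1 / (1 - t * z powi weight N j))"
      unfolding h_def using prod_geometric_sums[of UNIV "\<lambda>j. t * z powi weight N j"] t norm1[OF z]
      by (simp add: norm_mult)
    from sums_divide[OF this, of z] show ?thesis by (simp add: sums_iff)
  qed
  have hint: "((\<lambda>z. h k z / z) has_contour_integral 2 * pi * \<i> * (card (exponents N k) * t ^ k)) (circlepath 0 1)" for k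
  proof -
    have "((\<lambda>z. t ^ k * (\<Sum>x\<in>?X k. z powi total_weight N x / z)) has_contour_integral
       t ^ k * (\<Sum>x\<in>?X k. if total_weight N x = 0 then 2 * pi * \<i> else 0)) (circlepath 0 1)"
      by (intro has_contour_integral_lmul has_contour_integral_sum has_contour_integral_circle_power_int fin)
    also have "(\<Sum>x\<in>?X k. if total_weight N x = 0 then 2 * pi * \<i> else 0) = (\<Sum>x\<in>exponents N k. 2 * pi * \<i>)"
      using fin[of k] by (intro sum.mono_neutral_cong_right) (auto simp: multiindices_def exponents_def)
    finally have "((\<lambda>z. t ^ k * (\<Sum>x\<in>?X k. z powi total_weight N x / z)) has_contour_integral
       2 * pi * \<i> * (card (exponents N k) * t ^ k)) (circlepath 0 1)" by (simp add: mult_ac)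
    then show ?thesis
    proof (rule has_contour_integral_eq)
      fix z :: complex assume "z \<in> path_image (circlepath 0 1)"
      then have "z \<noteq> 0" by auto
      then show "t ^ k * (\<Sum>x\<in>?X k. z powi total_weight N x / z) = h k z / z"
        by (simp add: h_eq sum_divide_distrib[symmetric])
    qed
  qed
  have "(\<lambda>K. contour_integral (circlepath 0 1) (\<lambda>z. \<Sum>k<K. h k z / z)) \<longlonglongrightarrow>
      contour_integral (circlepath 0 1) (\<lambda>z. \<Sum>k. h k z / z)"
  proof (rule contour_integral_uniform_limit_circlepath(2)[where 'a = nat, OF _ _ _ ])
    show "\<forall>\<^sub>F K in sequentially. (\<lambda>z. \<Sum>k<K. h k z / z) contour_integrable_on circlepath 0 1"
      using hint by (intro always_eventually allI contour_integrable_sum) (auto intro: has_contour_integral_integrable)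
  qed (use unif in auto)
  moreover have "contour_integral (circlepath 0 1) (\<lambda>z. \<Sum>k<K. h k z / z) = (\<Sum>k<K. 2 * pi * \<i> * (card (exponents N k) * t ^ k))" for K
    by (rule contour_integral_unique, rule has_contour_integral_sum, simp, rule hint)
  moreover have "contour_integral (circlepath 0 1) (\<lambda>z. \<Sum>k. h k z / z) =
    contour_integral (circlepath 0 1) (\<lambda>z. (\<Prod>j\<in>UNIV. 1 / (1 - t * z powi weight N j)) / z)"
    by (rule contour_integral_eq) (auto simp: suminf)
  ultimately show ?thesis unfolding sums_def by simp
qed

text \<open>The terms are the residues in the unit disc of the integrand for the generating function.\<close>

definition residue_sum :: "nat set \<Rightarrow> complex \<Rightarrow> complex" where
  "residue_sum W t = (\<Sum>w\<in>W. \<Sum>p | p ^ w = t.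
     1 / (of_nat w * (1 - t\<^sup>2)) * (\<Prod>v\<in>W - {w}. 1 / ((1 - t * p ^ v) * (1 - t * inverse p ^ v))))"

section \<open>Evaluation of the contour integral by residues\<close>

lemma norm_power_eq_less_1:
  fixes p t :: "'a::real_normed_div_algebra"
  assumes "norm t < 1" "p ^ w = t"
  shows "norm p < 1"
proof (rule ccontr)
  assume "\<not> norm p < 1"
  then have "1 \<le> norm p ^ w" by (simp add: one_le_power)
  then show False using assms by (metis norm_power not_le)
qed

text \<open>Two different powers with the same nonzero value would force \<open>norm p = 1\<close>.
  Hence zeros belonging to different weights are distinct, and all poles in the unit disc are
  simple.\<close>

lemma power_eq_imp_exponent_eq:
  fixes p t :: complex
  assumes t: "t \<noteq> 0" "norm t < 1" and "p ^ w = t" "p ^ v = t" "w > 0" "v > 0"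
  shows "w = v"
proof -
  have False if "p ^ a = t" "p ^ b = t" "0 < a" "a < b" for a b
  proof -
    have p: "norm p < 1" using norm_power_eq_less_1[OF t(2) that(1)] .
    have "p ^ b = p ^ a * p ^ (b - a)" using that(4) by (simp flip: power_add)
    then have "p ^ (b - a) = 1" using that(1,2) t(1) by simp
    then have "norm p ^ (b - a) = 1" by (metis norm_one norm_power)
    moreover have "norm p ^ (b - a) < 1" using p that by (simp add: power_less_one_iff)
    ultimately show False by simp
  qed
  with assms show ?thesis by (metis linorder_neqE_nat)
qed

lemma finite_power_eq: "w > 0 \<Longrightarrow> finite {p :: complex. p ^ w = t}"
proof -
  assume w: "w > 0"
  have "{p :: complex. p ^ w = t} = {p. poly (monom 1 w - [:t:]) p = 0}" by (auto simp: poly_monom)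
  moreover have "monom 1 w - [:t:] \<noteq> 0"
  proof
    assume "monom 1 w - [:t:] = 0"
    then have "coeff (monom 1 w) w = coeff [:t:] w" by simp
    then show False using w by (cases w) auto
  qed
  ultimately show ?thesis using poly_roots_finite by metis
qed

text \<open>Once negative powers are cleared, the integrand is rational. Its poles in the unit disc
  are the solutions of \<open>p ^ w = t\<close>, while those of \<open>p ^ w = inverse t\<close> lie
  outside.\<close>

lemma contour_integral_eq_residue_sum:
  fixes t :: complex
  assumes W: "finite W" "W \<noteq> {}" "\<And>w. w \<in> W \<Longrightarrow> w > 0" and t: "t \<noteq> 0" "norm t < 1"
  shows "contour_integral (circlepath 0 1) (\<lambda>z. (\<Prod>w\<in>W. 1 / ((1 - t * z ^ w) * (1 - t * inverse z ^ w))) / z)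
    = 2 * pi * \<i> * residue_sum W t"
proof -
  \<comment> \<open>Each factor \<open>1 - t * inverse z ^ w\<close> is multiplied by
    \<open>z ^ w\<close>, which puts \<open>z ^ sum id W\<close> into the numerator; the division by
    \<open>z\<close> takes one power away, and positive weights ensure that there is one.\<close>
  define s where "s = sum id W - 1"
  obtain w0 where w0: "w0 \<in> W" using W(2) by blast
  have "sum id W \<ge> w0" using member_le_sum[OF w0 _ W(1), of id] by simp
  then have s: "sum id W = Suc s" using W(3)[OF w0] by (simp add: s_def)
  define f where "f z = z ^ s / (\<Prod>w\<in>W. (1 - t * z ^ w) * (z ^ w - t))" for z
  define P1 where "P1 w = {p :: complex. p ^ w = t}" for w
  define P2 where "P2 w = {p :: complex. p ^ w = inverse t}" for w
  define pts where "pts = (\<Union>w\<in>W. P1 w) \<union> (\<Union>w\<in>W. P2 w)"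
  have fin: "finite (P1 w)" "finite (P2 w)" if "w \<in> W" for w
    using W(3)[OF that] finite_power_eq by (auto simp: P1_def P2_def)
  have finp: "finite pts" using W(1) fin by (auto simp: pts_def)
  have P2_eq: "1 - t * p ^ w = 0 \<longleftrightarrow> p \<in> P2 w" for p w
    using t(1) by (auto simp: P2_def field_simps)
  have P1_eq: "p ^ w - t = 0 \<longleftrightarrow> p \<in> P1 w" for p w by (auto simp: P1_def)
  have P1_in: "norm p < 1" if "p \<in> P1 w" for p w
    using norm_power_eq_less_1[OF t(2)] that by (auto simp: P1_def)
  have P2_out: "norm p > 1" if "p \<in> P2 w" for p w
  proof -
    have "inverse p ^ w = t" using that by (auto simp: P2_def power_inverse)
    from norm_power_eq_less_1[OF t(2) this] have "inverse (norm p) < 1" by (simp add: norm_inverse)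
    moreover have "p \<noteq> 0 \<or> w = 0" using that t(1) by (auto simp: P2_def power_0_left split: if_splits)
    moreover have "w \<noteq> 0"
    proof
      assume "w = 0"
      then have "inverse t = 1" using that by (simp add: P2_def split: if_splits)
      then show False using t(2) by simp
    qed
    ultimately show ?thesis by (simp add: inverse_less_1_iff)
  qed
  have holo: "f holomorphic_on UNIV - pts"
    unfolding f_def
  proof (intro holomorphic_intros)
    fix z assume "z \<in> UNIV - pts"
    then have "1 - t * z ^ w \<noteq> 0 \<and> z ^ w - t \<noteq> 0" if "w \<in> W" for w
      using that P1_eq[of z w] P2_eq[of z w] by (auto simp: pts_def)
    then show "(\<Prod>w\<in>W. (1 - t * z ^ w) * (z ^ w - t)) \<noteq> 0" using W(1) by (simp add: prod_zero_iff)
  qed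
  have "contour_integral (circlepath 0 1) f = 2 * pi * \<i> * (\<Sum>p\<in>pts. winding_number (circlepath 0 1) p * residue f p)"
  proof (rule Residue_theorem[OF open_UNIV connected_UNIV finp holo])
    show "path_image (circlepath 0 1) \<subseteq> UNIV - pts"
      using P1_in P2_out by (fastforce simp: pts_def)
  qed auto
  also have "(\<Sum>p\<in>pts. winding_number (circlepath 0 1) p * residue f p) = (\<Sum>p\<in>(\<Union>w\<in>W. P1 w). residue f p)"
  proof (rule sum.mono_neutral_cong_right)
    show "\<forall>p\<in>pts - (\<Union>w\<in>W. P1 w). winding_number (circlepath 0 1) p * residue f p = 0"
    proof
      fix p assume "p \<in> pts - (\<Union>w\<in>W. P1 w)"
      then have "norm p > 1" using P2_out by (auto simp: pts_def)
      then have "winding_number (circlepath 0 1) p = 0"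
        by (intro winding_number_zero_outside[of _ "cball 0 1"]) auto
      then show "winding_number (circlepath 0 1) p * residue f p = 0" by simp
    qed
    show "winding_number (circlepath 0 1) p * residue f p = residue f p" if "p \<in> (\<Union>w\<in>W. P1 w)" for p
      using winding_number_circlepath[of p 0 1] that P1_in by auto
    show "finite pts" by (rule finp)
    show "(\<Union>w\<in>W. P1 w) \<subseteq> pts" by (auto simp: pts_def)
  qed
  also have "\<dots> = (\<Sum>w\<in>W. \<Sum>p\<in>P1 w. residue f p)"
  proof (rule sum.UNION_disjoint[OF W(1)])
    show "\<forall>i\<in>W. \<forall>j\<in>W. i \<noteq> j \<longrightarrow> P1 i \<inter> P1 j = {}"
      using power_eq_imp_exponent_eq[OF t] W(3) by (auto simp: P1_def)
  qed (use fin in auto)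
  also have "\<dots> = residue_sum W t"
    unfolding residue_sum_def P1_def
  proof (intro sum.cong refl)
    fix w p assume w: "w \<in> W" and "p \<in> {p. p ^ w = t}"
    then have p: "p ^ w = t" by simp
    have wpos: "w > 0" using W(3)[OF w] .
    have p0: "p \<noteq> 0" using p t(1) wpos by (auto simp: power_0_left)
    \<comment> \<open>The integrand without the one factor that vanishes at \<open>p\<close>. The
      residue is \<open>g p\<close> over the derivative \<open>of_nat w * p ^ (w - 1)\<close> of
      that factor.\<close>
    define g where "g z = z ^ s / ((1 - t * z ^ w) * (\<Prod>v\<in>W - {w}. (1 - t * z ^ v) * (z ^ v - t)))" for z
    have f_eq: "f z = g z / (z ^ w - t)" for z
      unfolding f_def g_def by (subst prod.remove[OF W(1) w]) (simp add: mult_ac)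
    have nz: "1 - t * p ^ v \<noteq> 0" "v \<noteq> w \<Longrightarrow> p ^ v - t \<noteq> 0" if "v \<in> W" for v
      using P2_eq[of p v] P2_out[of p v] P1_in[of p w] p power_eq_imp_exponent_eq[OF t p, of v] W(3)[OF that] wpos
      by (auto simp: P1_def)
    have cont_g: "isCont g p"
      unfolding g_def using nz w W(1) by (intro continuous_intros) (auto simp: prod_zero_iff)
    have "((\<lambda>z. z ^ w - t) has_field_derivative of_nat w * p ^ (w - 1)) (at p)"
      by (auto intro!: derivative_eq_intros)
    then have "((\<lambda>z. (z ^ w - t - (p ^ w - t)) / (z - p)) \<longlongrightarrow> of_nat w * p ^ (w - 1)) (at p)"
      unfolding has_field_derivative_iff .
    then have "((\<lambda>z. (z ^ w - t) / (z - p)) \<longlongrightarrow> of_nat w * p ^ (w - 1)) (at p)" using p by simp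
    then have "((\<lambda>z. g z / ((z ^ w - t) / (z - p))) \<longlongrightarrow> g p / (of_nat w * p ^ (w - 1))) (at p)"
      using cont_g p0 wpos by (intro tendsto_divide) (auto simp: isCont_def)
    then have lim: "((\<lambda>z. f z * (z - p)) \<longlongrightarrow> g p / (of_nat w * p ^ (w - 1))) (at p)"
      by (simp add: f_eq)
    have op: "open (- (pts - {p}))"
      by (rule open_Compl[OF finite_imp_closed[OF finite_Diff[OF finp]]])
    have hol: "f holomorphic_on (- (pts - {p}) - {p})"
      by (rule holomorphic_on_subset[OF holo]) auto
    have "residue f p = g p / (of_nat w * p ^ (w - 1))"
      by (rule residue_simple'[OF op _ hol lim]) simp
    also have "\<dots> = 1 / (of_nat w * (1 - t\<^sup>2)) * (\<Prod>v\<in>W - {w}. 1 / ((1 - t * p ^ v) * (1 - t * inverse p ^ v)))"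
    proof -
      have sw: "s = (w - 1) + sum id (W - {w})"
        using s sum.remove[OF W(1) w, of id] wpos by simp
      have "p ^ s = p ^ (w - 1) * (\<Prod>v\<in>W - {w}. p ^ v)"
        unfolding sw power_add power_sum by simp
      then have "g p / (of_nat w * p ^ (w - 1)) = (\<Prod>v\<in>W - {w}. p ^ v) / (of_nat w * (1 - t\<^sup>2) * (\<Prod>v\<in>W - {w}. (1 - t * p ^ v) * (p ^ v - t)))"
        unfolding g_def using p0 by (simp add: p power2_eq_square mult_ac)
      also have "\<dots> = 1 / (of_nat w * (1 - t\<^sup>2)) * (\<Prod>v\<in>W - {w}. p ^ v / ((1 - t * p ^ v) * (p ^ v - t)))"
        by (simp add: prod_dividef)
      also have "(\<Prod>v\<in>W - {w}. p ^ v / ((1 - t * p ^ v) * (p ^ v - t))) = (\<Prod>v\<in>W - {w}. 1 / ((1 - t * p ^ v) * (1 - t * inverse p ^ v)))"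
      proof (rule prod.cong[OF refl])
        fix v
        have "p ^ v - t = p ^ v * (1 - t * inverse p ^ v)" using p0 by (simp add: field_simps power_inverse)
        then show "p ^ v / ((1 - t * p ^ v) * (p ^ v - t)) = 1 / ((1 - t * p ^ v) * (1 - t * inverse p ^ v))"
          using p0 by simp
      qed
      finally show ?thesis .
    qed
    finally show "residue f p = 1 / (of_nat w * (1 - t\<^sup>2)) * (\<Prod>v\<in>W - {w}. 1 / ((1 - t * p ^ v) * (1 - t * inverse p ^ v)))" .
  qed
  finally have "contour_integral (circlepath 0 1) f = 2 * pi * \<i> * residue_sum W t" .
  moreover have "contour_integral (circlepath 0 1) f =
     contour_integral (circlepath 0 1) (\<lambda>z. (\<Prod>w\<in>W. 1 / ((1 - t * z ^ w) * (1 - t * inverse z ^ w))) / z)"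
  proof (rule contour_integral_eq)
    fix z :: complex assume "z \<in> path_image (circlepath 0 1)"
    then have z: "z \<noteq> 0" by auto
    have zs: "z ^ s * z = (\<Prod>w\<in>W. z ^ w)"
      using power_sum[of z id W] s by (simp add: mult.commute)
    have "(\<Prod>w\<in>W. (1 - t * z ^ w) * (z ^ w - t)) = (\<Prod>w\<in>W. z ^ w) * (\<Prod>w\<in>W. (1 - t * z ^ w) * (1 - t * inverse z ^ w))"
      unfolding prod.distrib[symmetric] using z by (intro prod.cong) (auto simp: field_simps power_inverse)
    then show "f z = (\<Prod>w\<in>W. 1 / ((1 - t * z ^ w) * (1 - t * inverse z ^ w))) / z"
      unfolding f_def zs[symmetric] using z by (simp add: prod_dividef)
  qed
  ultimately show ?thesis by simp
qed

lemma generating_function_eq_residue_sum: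
  fixes N :: "'n::finite \<Rightarrow> nat" and t :: complex
  assumes "inj N" "\<And>i. N i > 0" and t: "t \<noteq> 0" "norm t < 1"
  shows "(\<lambda>k. card (exponents N k) * t ^ k) sums residue_sum (range N) t"
proof -
  have 1: "(\<Prod>j\<in>UNIV. 1 / (1 - t * z powi weight N j)) = (\<Prod>w\<in>range N. 1 / ((1 - t * z ^ w) * (1 - t * inverse z ^ w)))" for z :: complex
  proof -
    have "(\<Prod>j\<in>UNIV. 1 / (1 - t * z powi weight N j)) =
       (\<Prod>i\<in>UNIV. 1 / (1 - t * z powi weight N (Inl i))) * (\<Prod>i\<in>UNIV. 1 / (1 - t * z powi weight N (Inr i)))"
      unfolding UNIV_Plus_UNIV[symmetric] by (subst prod.Plus) (auto simp: o_def)
    also have "\<dots> = (\<Prod>i\<in>UNIV. 1 / ((1 - t * z ^ N i) * (1 - t * inverse z ^ N i)))"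
      by (simp add: prod.distrib[symmetric] weight_def power_int_minus power_inverse)
    also have "\<dots> = (\<Prod>w\<in>range N. 1 / ((1 - t * z ^ w) * (1 - t * inverse z ^ w)))"
      by (subst prod.reindex[OF assms(1)]) simp
    finally show ?thesis .
  qed
  have "(\<lambda>k. 2 * pi * \<i> * (card (exponents N k) * t ^ k)) sums (2 * pi * \<i> * residue_sum (range N) t)"
  proof -
    have "contour_integral (circlepath 0 1) (\<lambda>z. (\<Prod>w\<in>range N. 1 / ((1 - t * z ^ w) * (1 - t * inverse z ^ w))) / z)
      = 2 * pi * \<i> * residue_sum (range N) t"
      by (rule contour_integral_eq_residue_sum) (use assms in auto)
    then show ?thesis using exponents_generating_function[OF t(2), of N] unfolding 1 by simp
  qed
  then show ?thesis by (subst (asm) sums_mult_iff) auto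
qed

lemma residue_sum_eqI:
  fixes N N' :: "'n::finite \<Rightarrow> nat" and t :: complex
  assumes "inj N" "\<And>i. N i > 0" "inj N'" "\<And>i. N' i > 0"
    and "\<And>k. card (exponents N k) = card (exponents N' k)" and t: "t \<noteq> 0" "norm t < 1"
  shows "residue_sum (range N) t = residue_sum (range N') t"
  using generating_function_eq_residue_sum[OF assms(1,2) t] generating_function_eq_residue_sum[OF assms(3,4) t]
  by (simp add: assms(5) sums_unique2)

section \<open>Poles of the generating function\<close>

text \<open>The shape of every factor when \<open>t\<close> moves radially to a point of the unit
  circle: bounded as \<epsilon> tends to 0 if \<open>a\<close> differs from 1, and asymptotic to
  \<open>1 / (c * \<epsilon>)\<close> if \<open>a = 1\<close>.\<close>

definition radial_factor :: "complex \<Rightarrow> real \<Rightarrow> real \<Rightarrow> complex" where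
  "radial_factor a c \<epsilon> = 1 / (1 - a * of_real (exp (- (c * \<epsilon>))))"

lemma radial_factor_tendsto:
  assumes "a \<noteq> 1" shows "(radial_factor a c \<longlongrightarrow> 1 / (1 - a)) (at_right 0)"
proof -
  have "((\<lambda>\<epsilon>. 1 / (1 - a * of_real (exp (- (c * \<epsilon>))))) \<longlongrightarrow> 1 / (1 - a * of_real (exp (- (c * 0))))) (at_right 0)"
    using assms by (intro tendsto_intros) auto
  then show ?thesis by (simp add: radial_factor_def[abs_def])
qed

lemma radial_factor_pole:
  assumes "c \<noteq> 0" shows "((\<lambda>\<epsilon>. of_real \<epsilon> * radial_factor 1 c \<epsilon>) \<longlongrightarrow> 1 / of_real c) (at_right 0)"
proof -
  have "((\<lambda>\<epsilon>. 1 - exp (- (c * \<epsilon>))) has_real_derivative c) (at 0)"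
    by (auto intro!: derivative_eq_intros)
  then have "((\<lambda>\<epsilon>. (1 - exp (- (c * \<epsilon>))) / \<epsilon>) \<longlongrightarrow> c) (at 0)"
    by (simp add: has_field_derivative_iff)
  then have "((\<lambda>\<epsilon>. (1 - exp (- (c * \<epsilon>))) / \<epsilon>) \<longlongrightarrow> c) (at_right 0)"
    by (rule filterlim_mono[OF _ order_refl at_le]) simp
  then have "((\<lambda>\<epsilon>. 1 / ((1 - exp (- (c * \<epsilon>))) / \<epsilon>)) \<longlongrightarrow> 1 / c) (at_right 0)"
    by (intro tendsto_divide tendsto_const assms)
  then have "((\<lambda>\<epsilon>. complex_of_real (1 / ((1 - exp (- (c * \<epsilon>))) / \<epsilon>))) \<longlongrightarrow> of_real (1 / c)) (at_right 0)"
    by (rule tendsto_of_real)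
  then show ?thesis by (simp add: radial_factor_def)
qed

text \<open>The \<open>w\<close>-th roots of \<open>t * exp (- \<epsilon>)\<close> are
  \<open>\<omega> * exp (- \<epsilon> / w)\<close> with \<open>\<omega> ^ w = t\<close>. Inserting
  such a root into the residue produces the rates \<open>1 + v / w\<close> and
  \<open>1 - v / w\<close>.\<close>

definition residue_term :: "nat set \<Rightarrow> complex \<Rightarrow> nat \<Rightarrow> complex \<Rightarrow> real \<Rightarrow> complex" where
  "residue_term W t w \<omega> \<epsilon> = 1 / of_nat w * radial_factor (t\<^sup>2) 2 \<epsilon> *
    (\<Prod>v\<in>W - {w}. radial_factor (t * \<omega> ^ v) (1 + v / w) \<epsilon> * radial_factor (t * inverse \<omega> ^ v) (1 - v / w) \<epsilon>)"

lemma residue_sum_radial: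
  assumes "\<And>w. w \<in> W \<Longrightarrow> w > 0"
  shows "residue_sum W (t * of_real (exp (- \<epsilon>))) = (\<Sum>w\<in>W. \<Sum>\<omega> | \<omega> ^ w = t. residue_term W t w \<omega> \<epsilon>)"
  unfolding residue_sum_def
proof (rule sum.cong[OF refl])
  fix w assume "w \<in> W"
  then have w: "w > 0" using assms by simp
  define q where "q = complex_of_real (exp (- (\<epsilon> / w)))"
  have q0: "q \<noteq> 0" by (simp add: q_def)
  have qv: "q ^ v = of_real (exp (- (v / w * \<epsilon>)))" for v
    by (simp add: q_def exp_of_nat_mult[symmetric] flip: of_real_power)
  have qw: "q ^ w = of_real (exp (- \<epsilon>))" using w by (simp add: qv)
  show "(\<Sum>p | p ^ w = t * of_real (exp (- \<epsilon>)). 1 / (of_nat w * (1 - (t * of_real (exp (- \<epsilon>)))\<^sup>2)) *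
      (\<Prod>v\<in>W - {w}. 1 / ((1 - t * of_real (exp (- \<epsilon>)) * p ^ v) * (1 - t * of_real (exp (- \<epsilon>)) * inverse p ^ v)))) =
    (\<Sum>\<omega> | \<omega> ^ w = t. residue_term W t w \<omega> \<epsilon>)"
  proof (rule sum.reindex_bij_witness[where i = "\<lambda>\<omega>. \<omega> * q" and j = "\<lambda>p. p / q"])
    fix p assume "p \<in> {p. p ^ w = t * of_real (exp (- \<epsilon>))}"
    then have p: "p ^ w = t * of_real (exp (- \<epsilon>))" by simp
    show "p / q * q = p" using q0 by simp
    show "p / q \<in> {\<omega>. \<omega> ^ w = t}" using p by (simp add: power_divide qw)
    have e1: "complex_of_real (exp (- ((1 + v / w) * \<epsilon>))) = of_real (exp (- \<epsilon>)) * q ^ v" for v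
      by (simp add: qv algebra_simps flip: of_real_mult exp_add)
    have e2: "q ^ v * complex_of_real (exp (- ((1 - v / w) * \<epsilon>))) = of_real (exp (- \<epsilon>))" for v
      by (simp add: qv algebra_simps flip: of_real_mult exp_add)
    have 1: "t * (p / q) ^ v * of_real (exp (- ((1 + v / w) * \<epsilon>))) = t * of_real (exp (- \<epsilon>)) * p ^ v" for v
      unfolding e1 using q0 by (simp add: power_divide)
    have 2: "t * inverse (p / q) ^ v * of_real (exp (- ((1 - v / w) * \<epsilon>))) = t * of_real (exp (- \<epsilon>)) * inverse p ^ v" for v
    proof -
      have "inverse (p / q) ^ v = inverse p ^ v * q ^ v"
        by (simp add: divide_inverse power_mult_distrib)
      then show ?thesis using e2[of v] by (metis (no_types, opaque_lifting) mult.assoc mult.commute)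
    qed
    have "exp (- (2 * \<epsilon>)) = (exp (- \<epsilon>))\<^sup>2" using exp_of_nat_mult[of 2 "- \<epsilon>"] by simp
    then have 3: "t\<^sup>2 * of_real (exp (- (2 * \<epsilon>))) = (t * of_real (exp (- \<epsilon>)))\<^sup>2"
      by (simp add: power_mult_distrib)
    show "residue_term W t w (p / q) \<epsilon> = 1 / (of_nat w * (1 - (t * of_real (exp (- \<epsilon>)))\<^sup>2)) *
      (\<Prod>v\<in>W - {w}. 1 / ((1 - t * of_real (exp (- \<epsilon>)) * p ^ v) * (1 - t * of_real (exp (- \<epsilon>)) * inverse p ^ v)))"
      unfolding residue_term_def radial_factor_def 1 2 3 by simp
  next
    fix \<omega> assume "\<omega> \<in> {\<omega>. \<omega> ^ w = t}"
    then show "\<omega> * q \<in> {p. p ^ w = t * of_real (exp (- \<epsilon>))}" by (simp add: power_mult_distrib qw)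
    show "\<omega> * q / q = \<omega>" using q0 by simp
  qed
qed

definition coprime_set :: "nat set \<Rightarrow> bool" where
  "coprime_set W \<longleftrightarrow> finite W \<and> (\<forall>w\<in>W. 1 < w) \<and> (\<forall>w\<in>W. \<forall>v\<in>W. w \<noteq> v \<longrightarrow> coprime w v)"

lemma coprime_setD:
  assumes "coprime_set W"
  shows "finite W" "w \<in> W \<Longrightarrow> 1 < w" "w \<in> W \<Longrightarrow> 0 < w" "w \<in> W \<Longrightarrow> v \<in> W \<Longrightarrow> w \<noteq> v \<Longrightarrow> coprime w v"
  using assms by (force simp: coprime_set_def)+

section \<open>The pole at one\<close>

lemma root_of_unity_coprime:
  fixes q :: "'a::field"
  assumes "q ^ a = 1" "q ^ b = 1" "coprime a b" "a > 0"
  shows "q = 1"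
proof -
  obtain x y where "a * x = b * y + gcd a b" using bezout_nat[of a b] assms(4) by auto
  then have "a * x = b * y + 1" using assms(3) by (simp add: coprime_iff_gcd_eq_1)
  then have "(q ^ a) ^ x = (q ^ b) ^ y * q" by (simp add: power_mult[symmetric] power_add)
  with assms show ?thesis by simp
qed

definition leading_coeff_at_1 :: "nat set \<Rightarrow> real" where
  "leading_coeff_at_1 W = (\<Sum>w\<in>W. 1 / (2 * real w) * (\<Prod>v\<in>W - {w}. 1 / ((1 + v / w) * (1 - v / w))))"

text \<open>A residue term has \<open>2 * card W - 1\<close> singular candidates among its factors,
  and at \<open>\<omega> = 1\<close> each has a simple pole in \<epsilon>. For any other solution of
  \<open>\<omega> ^ w = 1\<close>, coprimality keeps every \<open>\<omega> ^ v\<close> away from 1,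
  so only the first factor is singular and the power of \<epsilon> kills the term.\<close>

lemma residue_sum_at_1:
  assumes W: "coprime_set W" and card: "card W \<ge> 2"
  shows "((\<lambda>\<epsilon>. of_real \<epsilon> ^ (2 * card W - 1) * residue_sum W (of_real (exp (- \<epsilon>)))) \<longlongrightarrow>
    complex_of_real (leading_coeff_at_1 W)) (at_right 0)"
proof -
  note D = coprime_setD[OF W]
  let ?L = "\<lambda>w v. 1 / of_real ((1 + real v / real w) * (1 - real v / real w)) :: complex"
  have term_lim: "((\<lambda>\<epsilon>. of_real \<epsilon> ^ (2 * card W - 1) * residue_term W 1 w \<omega> \<epsilon>) \<longlongrightarrow>
     (if \<omega> = 1 then of_real (1 / (2 * real w)) * (\<Prod>v\<in>W - {w}. ?L w v) else 0)) (at_right 0)"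
    if w: "w \<in> W" and \<omega>: "\<omega> ^ w = 1" for w \<omega>
  proof -
    have cardw: "2 * card W - 1 = 1 + 2 * card (W - {w})"
      using D(1) w card by (simp add: card_Diff_singleton)
    \<comment> \<open>With no second weight, roots of unity other than 1 would contribute to the
      limit too.\<close>
    have ne: "W - {w} \<noteq> {}"
    proof
      assume "W - {w} = {}"
      then have "card W \<le> card {w}" using D(1) by (intro card_mono) auto
      then show False using card by simp
    qed
    have lim: "((\<lambda>\<epsilon>. 1 / of_nat w * (of_real \<epsilon> * radial_factor 1 2 \<epsilon>) *
       (\<Prod>v\<in>W - {w}. (of_real \<epsilon> * radial_factor (\<omega> ^ v) (1 + v / w) \<epsilon>) * (of_real \<epsilon> * radial_factor (inverse \<omega> ^ v) (1 - v / w) \<epsilon>)))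
       \<longlongrightarrow> 1 / of_nat w * (1 / of_real 2) * (\<Prod>v\<in>W - {w}. if \<omega> = 1 then ?L w v else 0)) (at_right 0)"
    proof (intro tendsto_mult tendsto_prod tendsto_const radial_factor_pole)
      fix v assume v: "v \<in> W - {w}"
      have pos: "w > 0" "v > 0" "v \<noteq> w" "coprime w v" using v w D(2-4) by auto
      show "((\<lambda>\<epsilon>. of_real \<epsilon> * radial_factor (\<omega> ^ v) (1 + v / w) \<epsilon> * (of_real \<epsilon> * radial_factor (inverse \<omega> ^ v) (1 - v / w) \<epsilon>))
         \<longlongrightarrow> (if \<omega> = 1 then ?L w v else 0)) (at_right 0)"
      proof (cases "\<omega> = 1")
        case True
        have "1 + real v / real w > 0" using pos by (intro add_pos_nonneg) auto
        then have "1 + real v / real w \<noteq> 0" "1 - real v / real w \<noteq> 0" using pos by auto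
        from tendsto_mult[OF radial_factor_pole[OF this(1)] radial_factor_pole[OF this(2)]] True
        show ?thesis by simp
      next
        case False
        then have n1: "\<omega> ^ v \<noteq> 1" using root_of_unity_coprime[OF \<omega>] pos by blast
        then have n2: "inverse \<omega> ^ v \<noteq> 1" by (simp add: power_inverse)
        have "((\<lambda>\<epsilon>. of_real \<epsilon> * radial_factor (\<omega> ^ v) (1 + v / w) \<epsilon> * (of_real \<epsilon> * radial_factor (inverse \<omega> ^ v) (1 - v / w) \<epsilon>))
         \<longlongrightarrow> of_real 0 * (1 / (1 - \<omega> ^ v)) * (of_real 0 * (1 / (1 - inverse \<omega> ^ v)))) (at_right 0)"
          by (intro tendsto_mult radial_factor_tendsto n1 n2 tendsto_of_real tendsto_ident_at)
        then show ?thesis using False by simp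
      qed
    qed simp
    have e1: "1 / of_nat w * (of_real \<epsilon> * radial_factor 1 2 \<epsilon>) *
       (\<Prod>v\<in>W - {w}. (of_real \<epsilon> * radial_factor (\<omega> ^ v) (1 + v / w) \<epsilon>) * (of_real \<epsilon> * radial_factor (inverse \<omega> ^ v) (1 - v / w) \<epsilon>))
      = of_real \<epsilon> ^ (2 * card W - 1) * residue_term W 1 w \<omega> \<epsilon>" for \<epsilon>
      unfolding residue_term_def cardw power_add power_mult
      by (simp add: prod.distrib power2_eq_square power_mult_distrib mult_ac)
    have e2: "1 / of_nat w * (1 / of_real 2) * (\<Prod>v\<in>W - {w}. if \<omega> = 1 then ?L w v else 0) =
       (if \<omega> = 1 then of_real (1 / (2 * real w)) * (\<Prod>v\<in>W - {w}. ?L w v) else 0)"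
      using ne D(1) by (auto simp: power_0_left)
    show ?thesis using lim unfolding e1 e2 .
  qed
  have "((\<lambda>\<epsilon>. \<Sum>w\<in>W. \<Sum>\<omega>\<in>{\<omega>::complex. \<omega> ^ w = 1}. of_real \<epsilon> ^ (2 * card W - 1) * residue_term W 1 w \<omega> \<epsilon>) \<longlongrightarrow>
     (\<Sum>w\<in>W. \<Sum>\<omega>\<in>{\<omega>::complex. \<omega> ^ w = 1}. if \<omega> = 1 then of_real (1 / (2 * real w)) * (\<Prod>v\<in>W - {w}. ?L w v) else 0)) (at_right 0)"
    by (rule tendsto_sum, rule tendsto_sum, rule term_lim) auto
  moreover have "(\<Sum>w\<in>W. \<Sum>\<omega>\<in>{\<omega>::complex. \<omega> ^ w = 1}. of_real \<epsilon> ^ (2 * card W - 1) * residue_term W 1 w \<omega> \<epsilon>) =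
      of_real \<epsilon> ^ (2 * card W - 1) * residue_sum W (of_real (exp (- \<epsilon>)))" for \<epsilon>
    using residue_sum_radial[of W 1 \<epsilon>] D(3) by (simp add: sum_distrib_left)
  moreover have "(\<Sum>w\<in>W. \<Sum>\<omega>\<in>{\<omega>::complex. \<omega> ^ w = 1}. if \<omega> = 1 then of_real (1 / (2 * real w)) * (\<Prod>v\<in>W - {w}. ?L w v) else 0) =
     complex_of_real (leading_coeff_at_1 W)"
  proof -
    have "(\<Sum>\<omega>\<in>{\<omega>::complex. \<omega> ^ w = 1}. if \<omega> = 1 then of_real (1 / (2 * real w)) * (\<Prod>v\<in>W - {w}. ?L w v) else 0) =
       of_real (1 / (2 * real w)) * (\<Prod>v\<in>W - {w}. ?L w v)" if "w \<in> W" for w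
      by (subst sum.delta[OF finite_power_eq[OF D(3)[OF that]]]) simp
    then have "(\<Sum>w\<in>W. \<Sum>\<omega>\<in>{\<omega>::complex. \<omega> ^ w = 1}. if \<omega> = 1 then of_real (1 / (2 * real w)) * (\<Prod>v\<in>W - {w}. ?L w v) else 0) =
      (\<Sum>w\<in>W. of_real (1 / (2 * real w)) * (\<Prod>v\<in>W - {w}. ?L w v))" by (rule sum.cong[OF refl])
    also have "\<dots> = complex_of_real (leading_coeff_at_1 W)" by (simp add: leading_coeff_at_1_def)
    finally show ?thesis .
  qed
  ultimately show ?thesis by simp
qed

lemma leading_coeff_at_1_eqI:
  assumes "coprime_set W" "coprime_set W'" "card W = card W'" "card W \<ge> 2"
    and "\<And>t. t \<noteq> 0 \<Longrightarrow> norm t < 1 \<Longrightarrow> residue_sum W t = residue_sum W' t"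
  shows "leading_coeff_at_1 W = leading_coeff_at_1 W'"
proof -
  have "\<forall>\<^sub>F \<epsilon> in at_right 0. of_real \<epsilon> ^ (2 * card W' - 1) * residue_sum W' (of_real (exp (- \<epsilon>))) =
     of_real \<epsilon> ^ (2 * card W - 1) * residue_sum W (of_real (exp (- \<epsilon>)))"
    unfolding eventually_at_right_field assms(3)
    by (intro exI[of _ 1]) (auto simp: assms(5) norm_of_real)
  moreover have "((\<lambda>\<epsilon>. of_real \<epsilon> ^ (2 * card W' - 1) * residue_sum W' (of_real (exp (- \<epsilon>)))) \<longlongrightarrow>
    complex_of_real (leading_coeff_at_1 W')) (at_right 0)"
    by (rule residue_sum_at_1) (use assms in auto)
  ultimately have "((\<lambda>\<epsilon>. of_real \<epsilon> ^ (2 * card W - 1) * residue_sum W (of_real (exp (- \<epsilon>)))) \<longlongrightarrow>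
    complex_of_real (leading_coeff_at_1 W')) (at_right 0)"
    by (rule Lim_transform_eventually[rotated])
  from tendsto_unique[OF trivial_limit_at_right_real this residue_sum_at_1[OF assms(1,4)]]
  show ?thesis by simp
qed

text \<open>By \<open>no_equal\<close> no factor with \<open>inverse \<omega>\<close> is singular,
  and by \<open>unique\<close> at most one with \<open>\<omega>\<close> is, namely if
  \<open>t * \<omega> ^ v = 1\<close>. Its coefficient \<open>1 / (1 + v / w)\<close> combines with
  \<open>1 / w\<close> to \<open>1 / (w + v)\<close>. Its partner has argument
  \<open>t\<^sup>2\<close>, whence the square of \<open>1 - t\<^sup>2\<close>.\<close>

lemma residue_sum_simple_pole:
  assumes W: "\<And>w. w \<in> W \<Longrightarrow> w > 0" "finite W" and t: "t\<^sup>2 \<noteq> 1"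
    and no_equal: "\<And>w v \<omega>. w \<in> W \<Longrightarrow> v \<in> W \<Longrightarrow> w \<noteq> v \<Longrightarrow> \<omega> ^ w = t \<Longrightarrow> \<omega> ^ v \<noteq> t"
    and unique: "\<And>w v u \<omega>. w \<in> W \<Longrightarrow> v \<in> W \<Longrightarrow> u \<in> W \<Longrightarrow> \<omega> ^ w = t \<Longrightarrow> t * \<omega> ^ v = 1 \<Longrightarrow> t * \<omega> ^ u = 1 \<Longrightarrow> u = v"
    and t0: "t \<noteq> 0"
  shows "((\<lambda>\<epsilon>. of_real \<epsilon> * residue_sum W (t * of_real (exp (- \<epsilon>)))) \<longlongrightarrow>
    (\<Sum>w\<in>W. \<Sum>\<omega> | \<omega> ^ w = t. \<Sum>v | v \<in> W \<and> v \<noteq> w \<and> t * \<omega> ^ v = 1.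
      1 / (of_nat (w + v) * (1 - t\<^sup>2)\<^sup>2) * (\<Prod>u\<in>W - {w, v}. 1 / ((1 - t * \<omega> ^ u) * (1 - t * inverse \<omega> ^ u))))) (at_right 0)"
proof -
  have term_lim: "((\<lambda>\<epsilon>. of_real \<epsilon> * residue_term W t w \<omega> \<epsilon>) \<longlongrightarrow> (\<Sum>v | v \<in> W \<and> v \<noteq> w \<and> t * \<omega> ^ v = 1.
      1 / (of_nat (w + v) * (1 - t\<^sup>2)\<^sup>2) * (\<Prod>u\<in>W - {w, v}. 1 / ((1 - t * \<omega> ^ u) * (1 - t * inverse \<omega> ^ u))))) (at_right 0)"
    if w: "w \<in> W" and \<omega>: "\<omega> ^ w = t" for w \<omega>
  proof -
    have \<omega>0: "\<omega> \<noteq> 0" using \<omega> t0 W(1)[OF w] by (auto simp: power_0_left)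
    have ne: "t * inverse \<omega> ^ u \<noteq> 1" if "u \<in> W" "u \<noteq> w" for u
      using no_equal[OF w that(1) _ \<omega>] that(2) \<omega>0 by (auto simp: power_inverse field_simps)
    let ?P = "\<lambda>A \<epsilon>. \<Prod>u\<in>A. radial_factor (t * \<omega> ^ u) (1 + u / w) \<epsilon> * radial_factor (t * inverse \<omega> ^ u) (1 - u / w) \<epsilon>"
    have P: "(?P A \<longlongrightarrow> (\<Prod>u\<in>A. 1 / ((1 - t * \<omega> ^ u) * (1 - t * inverse \<omega> ^ u)))) (at_right 0)"
      if "A \<subseteq> W - {w}" "\<And>u. u \<in> A \<Longrightarrow> t * \<omega> ^ u \<noteq> 1" for A
    proof (rule tendsto_prod)
      fix u assume u: "u \<in> A"
      have "((\<lambda>\<epsilon>. radial_factor (t * \<omega> ^ u) (1 + u / w) \<epsilon> * radial_factor (t * inverse \<omega> ^ u) (1 - u / w) \<epsilon>)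
        \<longlongrightarrow> 1 / (1 - t * \<omega> ^ u) * (1 / (1 - t * inverse \<omega> ^ u))) (at_right 0)"
        by (intro tendsto_mult radial_factor_tendsto) (use u that ne in auto)
      then show "((\<lambda>\<epsilon>. radial_factor (t * \<omega> ^ u) (1 + u / w) \<epsilon> * radial_factor (t * inverse \<omega> ^ u) (1 - u / w) \<epsilon>)
        \<longlongrightarrow> 1 / ((1 - t * \<omega> ^ u) * (1 - t * inverse \<omega> ^ u))) (at_right 0)" by simp
    qed
    have id: "((\<lambda>\<epsilon>. complex_of_real \<epsilon>) \<longlongrightarrow> of_real 0) (at_right 0)" by (intro tendsto_intros)
    show ?thesis
    proof (cases "\<exists>v. v \<in> W \<and> v \<noteq> w \<and> t * \<omega> ^ v = 1")
      case False
      then have emp: "{v. v \<in> W \<and> v \<noteq> w \<and> t * \<omega> ^ v = 1} = {}" by auto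
      have "((\<lambda>\<epsilon>. of_real \<epsilon> * (1 / of_nat w * radial_factor (t\<^sup>2) 2 \<epsilon> * ?P (W - {w}) \<epsilon>)) \<longlongrightarrow>
         of_real 0 * (1 / of_nat w * (1 / (1 - t\<^sup>2)) * (\<Prod>u\<in>W - {w}. 1 / ((1 - t * \<omega> ^ u) * (1 - t * inverse \<omega> ^ u))))) (at_right 0)"
        by (intro tendsto_mult id tendsto_const radial_factor_tendsto t P) (use False in auto)
      then show ?thesis unfolding emp by (simp add: residue_term_def)
    next
      case True
      then obtain v where v: "v \<in> W" "v \<noteq> w" "t * \<omega> ^ v = 1" by blast
      have single: "{v. v \<in> W \<and> v \<noteq> w \<and> t * \<omega> ^ v = 1} = {v}"
        using v unique[OF w _ _ \<omega>] by auto
      have inv: "inverse \<omega> ^ v = t" using v(3) \<omega>0 by (simp add: power_inverse field_simps)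
      have pos: "1 + real v / real w \<noteq> 0"
      proof -
        have "1 + real v / real w > 0" by (intro add_pos_nonneg) auto
        then show ?thesis by simp
      qed
      have "((\<lambda>\<epsilon>. 1 / of_nat w * radial_factor (t\<^sup>2) 2 \<epsilon> * ((of_real \<epsilon> * radial_factor 1 (1 + v / w) \<epsilon>) * radial_factor (t\<^sup>2) (1 - v / w) \<epsilon>)
          * ?P (W - {w, v}) \<epsilon>) \<longlongrightarrow> 1 / of_nat w * (1 / (1 - t\<^sup>2)) * ((1 / of_real (1 + v / w)) * (1 / (1 - t\<^sup>2)))
          * (\<Prod>u\<in>W - {w, v}. 1 / ((1 - t * \<omega> ^ u) * (1 - t * inverse \<omega> ^ u)))) (at_right 0)"
        by (intro tendsto_mult tendsto_const radial_factor_tendsto radial_factor_pole t P pos)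
          (use unique[OF w v(1) _ \<omega> v(3)] in auto)
      moreover have "1 / of_nat w * radial_factor (t\<^sup>2) 2 \<epsilon> * ((of_real \<epsilon> * radial_factor 1 (1 + v / w) \<epsilon>) * radial_factor (t\<^sup>2) (1 - v / w) \<epsilon>)
          * ?P (W - {w, v}) \<epsilon> = of_real \<epsilon> * residue_term W t w \<omega> \<epsilon>" for \<epsilon>
      proof -
        have eq: "W - {w} - {v} = W - {w, v}" by auto
        have "?P (W - {w}) \<epsilon> = radial_factor (t * \<omega> ^ v) (1 + v / w) \<epsilon> * radial_factor (t * inverse \<omega> ^ v) (1 - v / w) \<epsilon> * ?P (W - {w, v}) \<epsilon>"
          by (subst prod.remove[of "W - {w}" v]) (use v W(2) in \<open>simp_all add: eq\<close>)
        then show ?thesis by (simp add: residue_term_def v(3) inv power2_eq_square mult_ac)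
      qed
      moreover have "1 / of_nat w * (1 / (1 - t\<^sup>2)) * ((1 / of_real (1 + v / w)) * (1 / (1 - t\<^sup>2))) =
         1 / (of_nat (w + v) * (1 - t\<^sup>2)\<^sup>2)"
      proof -
        have "complex_of_nat w * of_real (1 + real v / real w) = of_nat (w + v)"
          using W(1)[OF w] by (simp add: field_simps)
        moreover have "1 / a * (1 / d) * ((1 / c) * (1 / d)) = 1 / ((a * c) * d\<^sup>2)" for a c d :: complex
          by (simp add: power2_eq_square mult_ac)
        ultimately show ?thesis by metis
      qed
      ultimately show ?thesis unfolding single by simp
    qed
  qed
  have "((\<lambda>\<epsilon>. \<Sum>w\<in>W. \<Sum>\<omega> | \<omega> ^ w = t. of_real \<epsilon> * residue_term W t w \<omega> \<epsilon>) \<longlongrightarrow>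
    (\<Sum>w\<in>W. \<Sum>\<omega> | \<omega> ^ w = t. \<Sum>v | v \<in> W \<and> v \<noteq> w \<and> t * \<omega> ^ v = 1.
      1 / (of_nat (w + v) * (1 - t\<^sup>2)\<^sup>2) * (\<Prod>u\<in>W - {w, v}. 1 / ((1 - t * \<omega> ^ u) * (1 - t * inverse \<omega> ^ u))))) (at_right 0)"
    by (rule tendsto_sum, rule tendsto_sum, rule term_lim) auto
  then show ?thesis using residue_sum_radial[OF W(1), of _ t] by (simp add: sum_distrib_left)
qed

section \<open>Simple poles at primitive roots of unity\<close>

lemma cis_primitive_root: "m > 0 \<Longrightarrow> cis (2 * pi / m) ^ a = 1 \<longleftrightarrow> m dvd a" for a m :: nat
proof -
  assume m: "m > 0"
  have "cis (2 * pi / m) ^ a = 1 \<longleftrightarrow> (\<exists>n. real a * (2 * pi / m) = of_int n * (2 * pi))"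
    by (simp add: Complex.DeMoivre cis_eq_1_iff)
  also have "\<dots> \<longleftrightarrow> (\<exists>n. int a = n * int m)"
  proof (intro ex_cong1)
    fix n
    have "real a * (2 * pi / m) = of_int n * (2 * pi) \<longleftrightarrow> real_of_int (int a) = real_of_int (n * int m)"
      using m by (simp add: field_simps)
    then show "real a * (2 * pi / m) = of_int n * (2 * pi) \<longleftrightarrow> int a = n * int m"
      by (simp only: of_int_eq_iff)
  qed
  also have "\<dots> \<longleftrightarrow> int m dvd int a" by (auto simp: dvd_def mult.commute)
  finally show ?thesis by simp
qed

lemma Re_eq_of_cnj: "z = cnj w \<Longrightarrow> Re z = Re w"
  by simp

lemma unit_mult_cnj: "norm z = 1 \<Longrightarrow> z * cnj z = 1"
  using complex_norm_square[of z] by simp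

definition incongruent :: "nat \<Rightarrow> nat set \<Rightarrow> bool" where
  "incongruent m W \<longleftrightarrow> (\<forall>w\<in>W. \<forall>v\<in>W. w < v \<longrightarrow> \<not> m dvd v - w)"

definition simple_pole_coeff :: "nat set \<Rightarrow> complex \<Rightarrow> complex" where
  "simple_pole_coeff W t = (\<Sum>w\<in>W. \<Sum>\<omega> | \<omega> ^ w = t. \<Sum>v | v \<in> W \<and> v \<noteq> w \<and> t * \<omega> ^ v = 1.
      1 / (of_nat (w + v) * (1 - t\<^sup>2)\<^sup>2) * (\<Prod>u\<in>W - {w, v}. 1 / ((1 - t * \<omega> ^ u) * (1 - t * inverse \<omega> ^ u))))"

context
  fixes m :: nat and t :: complex
  assumes m: "m \<ge> 3"
  defines "t \<equiv> cis (2 * pi / m)"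
begin

lemma t_power: "t ^ a = 1 \<longleftrightarrow> m dvd a"
  using m by (simp add: t_def cis_primitive_root)

lemma t_nonzero: "t \<noteq> 0" and norm_t: "norm t = 1"
  by (simp_all add: t_def)

lemma t_square: "t\<^sup>2 \<noteq> 1"
  unfolding t_power using m by (auto dest: dvd_imp_le)

text \<open>Both \<open>t ^ v\<close> and \<open>t ^ w\<close> are equal to
  \<open>\<omega> ^ (w * v)\<close>.\<close>

lemma root_equal_imp_dvd:
  assumes "\<omega> ^ w = t" "\<omega> ^ v = t" "w \<le> v" shows "m dvd v - w"
proof -
  have "t ^ v = t ^ w" using assms by (metis mult.commute power_mult)
  then have "t ^ w * t ^ (v - w) = t ^ w" using assms(3) by (simp flip: power_add)
  then have "t ^ (v - w) = 1" using t_nonzero by simp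
  then show ?thesis by (simp add: t_power)
qed

text \<open>Since \<open>t ^ v = (\<omega> ^ v) ^ w\<close>, the power \<open>t ^ (w + v)\<close> is
  \<open>(t * \<omega> ^ v) ^ w\<close>.\<close>

lemma root_inverse_imp_dvd:
  assumes "\<omega> ^ w = t" "t * \<omega> ^ v = 1" shows "m dvd w + v"
proof -
  have "t ^ (w + v) = (t * \<omega> ^ v) ^ w"
    unfolding power_add power_mult_distrib by (simp add: assms(1)[symmetric] power_mult[symmetric] mult.commute)
  then show ?thesis by (simp add: assms(2) t_power flip: t_power)
qed

lemma incongruent_no_equal:
  assumes "incongruent m W" "w \<in> W" "v \<in> W" "w \<noteq> v" "\<omega> ^ w = t" shows "\<omega> ^ v \<noteq> t"
  using assms root_equal_imp_dvd[of \<omega> w v] root_equal_imp_dvd[of \<omega> v w]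
  unfolding incongruent_def by (metis linorder_neqE_nat less_imp_le)

lemma incongruent_unique:
  assumes "incongruent m W" "w \<in> W" "v \<in> W" "u \<in> W" "\<omega> ^ w = t" "t * \<omega> ^ v = 1" "t * \<omega> ^ u = 1"
  shows "u = v"
proof (rule ccontr)
  assume "u \<noteq> v"
  have d: "m dvd w + v" "m dvd w + u" using root_inverse_imp_dvd assms(5-7) by blast+
  have "m dvd v - u" "m dvd u - v" using dvd_diff_nat[OF d] dvd_diff_nat[OF d(2,1)] by simp_all
  with \<open>u \<noteq> v\<close> assms(1,3,4) show False unfolding incongruent_def by (metis linorder_neqE_nat)
qed

lemma simple_pole_coeff_limit:
  assumes W: "coprime_set W" "incongruent m W"
  shows "((\<lambda>\<epsilon>. of_real \<epsilon> * residue_sum W (t * of_real (exp (- \<epsilon>)))) \<longlongrightarrow> simple_pole_coeff W t) (at_right 0)"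
  unfolding simple_pole_coeff_def
proof (rule residue_sum_simple_pole)
  show "\<omega> ^ v \<noteq> t" if "w \<in> W" "v \<in> W" "w \<noteq> v" "\<omega> ^ w = t" for w v \<omega>
    by (rule incongruent_no_equal[OF W(2) that])
  show "u = v" if "w \<in> W" "v \<in> W" "u \<in> W" "\<omega> ^ w = t" "t * \<omega> ^ v = 1" "t * \<omega> ^ u = 1" for w v u \<omega>
    by (rule incongruent_unique[OF W(2) that])
qed (use coprime_setD[OF W(1)] t_square t_nonzero in auto)

lemma simple_pole_coeff_eqI:
  assumes "coprime_set W" "incongruent m W" "coprime_set W'" "incongruent m W'"
    and eq: "\<And>s. s \<noteq> 0 \<Longrightarrow> norm s < 1 \<Longrightarrow> residue_sum W s = residue_sum W' s"
  shows "simple_pole_coeff W t = simple_pole_coeff W' t"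
proof -
  have "\<forall>\<^sub>F \<epsilon> in at_right 0. of_real \<epsilon> * residue_sum W (t * of_real (exp (- \<epsilon>))) = of_real \<epsilon> * residue_sum W' (t * of_real (exp (- \<epsilon>)))"
    unfolding eventually_at_right_field
    by (intro exI[of _ 1]) (auto simp: eq norm_mult norm_t t_nonzero)
  from Lim_transform_eventually[OF simple_pole_coeff_limit[OF assms(1,2)] this]
  show ?thesis
    using tendsto_unique[OF trivial_limit_at_right_real _ simple_pole_coeff_limit[OF assms(3,4)]] by blast
qed

lemma simple_pole_coeff_zero:
  assumes "\<And>w v. w \<in> W \<Longrightarrow> v \<in> W \<Longrightarrow> w \<noteq> v \<Longrightarrow> \<not> m dvd w + v"
  shows "simple_pole_coeff W t = 0"
  unfolding simple_pole_coeff_def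
  by (intro sum.neutral ballI) (use root_inverse_imp_dvd assms in blast)

text \<open>For \<open>z\<close> on the unit circle, \<open>(1 - t * z) * (1 - t * cnj z)\<close> is
  \<open>t\<close> times this real number. So all terms of the pole coefficient have the same phase,
  a power of \<open>t\<close>, and only their signs matter.\<close>

definition cosine_diff :: "complex \<Rightarrow> nat \<Rightarrow> real" where
  "cosine_diff \<omega> u = 2 * (Re t - Re (\<omega> ^ u))"

lemma factor_eq_cosine_diff:
  assumes "norm \<omega> = 1"
  shows "(1 - t * \<omega> ^ u) * (1 - t * inverse \<omega> ^ u) = t * of_real (cosine_diff \<omega> u)"
proof -
  define z where "z = \<omega> ^ u"
  have "norm z = 1" using assms by (simp add: z_def norm_power)
  note z = unit_mult_cnj[OF this] unit_mult_cnj[OF norm_t]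
  have "inverse \<omega> ^ u = cnj z"
    using inverse_unique[OF z(1)] by (simp add: z_def power_inverse)
  moreover have "(1 - t * z) * (1 - t * cnj z) = t * (t + cnj t - (z + cnj z))"
    using z by (simp add: algebra_simps)
  moreover have "t + cnj t - (z + cnj z) = of_real (cosine_diff \<omega> u)"
    unfolding cosine_diff_def z_def[symmetric] complex_add_cnj by (simp add: algebra_simps)
  ultimately show ?thesis by (simp add: z_def)
qed

lemma norm_root: "\<omega> ^ w = t \<Longrightarrow> w > 0 \<Longrightarrow> norm \<omega> = 1"
proof -
  assume "\<omega> ^ w = t" "w > 0"
  then have "norm \<omega> ^ w = 1 ^ w" using norm_t by (simp flip: norm_power)
  then show "norm \<omega> = 1" by (rule power_eq_imp_eq_base) (use \<open>w > 0\<close> in auto)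
qed

lemma cosine_diff_nonzero:
  assumes "incongruent m W" "\<omega> ^ w = t" "t * \<omega> ^ v = 1" "w \<in> W" "v \<in> W" "u \<in> W - {w, v}" "w > 0"
  shows "cosine_diff \<omega> u \<noteq> 0"
proof
  assume "cosine_diff \<omega> u = 0"
  then have "(1 - t * \<omega> ^ u) * (1 - t * inverse \<omega> ^ u) = 0"
    using factor_eq_cosine_diff[OF norm_root[OF assms(2,7)]] by simp
  then consider "t * \<omega> ^ u = 1" | "t * inverse \<omega> ^ u = 1" by auto
  then show False
  proof cases
    case 1
    then show False using incongruent_unique[OF assms(1,4,5) _ assms(2,3)] assms(6) by auto
  next
    case 2
    have "\<omega> \<noteq> 0" using norm_root[OF assms(2,7)] by auto
    with 2 have "\<omega> ^ u = t" by (simp add: power_inverse field_simps)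
    then show False using incongruent_no_equal[OF assms(1,4) _ _ assms(2), of u] assms(6) by auto
  qed
qed

lemma simple_pole_coeff_real:
  assumes W: "coprime_set W"
  shows "simple_pole_coeff W t = 1 / (1 - t\<^sup>2)\<^sup>2 * (1 / t) ^ (card W - 2) *
    of_real (\<Sum>w\<in>W. \<Sum>\<omega> | \<omega> ^ w = t. \<Sum>v | v \<in> W \<and> v \<noteq> w \<and> t * \<omega> ^ v = 1.
      1 / (real (w + v) * (\<Prod>u\<in>W - {w, v}. cosine_diff \<omega> u)))"
  unfolding simple_pole_coeff_def of_real_sum sum_distrib_left
proof (intro sum.cong refl)
  fix w \<omega> v assume w: "w \<in> W" "\<omega> \<in> {\<omega>. \<omega> ^ w = t}" "v \<in> {v \<in> W. v \<noteq> w \<and> t * \<omega> ^ v = 1}"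
  have n: "norm \<omega> = 1" using norm_root coprime_setD(3)[OF W w(1)] w(2) by auto
  have "card (W - {w, v}) = card W - card {w, v}"
    using w coprime_setD(1)[OF W] by (intro card_Diff_subset) auto
  then have c: "card (W - {w, v}) = card W - 2" using w by simp
  have "(\<Prod>u\<in>W - {w, v}. 1 / ((1 - t * \<omega> ^ u) * (1 - t * inverse \<omega> ^ u))) = (\<Prod>u\<in>W - {w, v}. (1 / t) * of_real (1 / cosine_diff \<omega> u))"
    unfolding factor_eq_cosine_diff[OF n] by simp
  also have "\<dots> = (1 / t) ^ (card W - 2) * of_real (1 / (\<Prod>u\<in>W - {w, v}. cosine_diff \<omega> u))"
    unfolding prod.distrib prod_constant c by (simp add: prod_dividef)
  finally show "1 / (of_nat (w + v) * (1 - t\<^sup>2)\<^sup>2) * (\<Prod>u\<in>W - {w, v}. 1 / ((1 - t * \<omega> ^ u) * (1 - t * inverse \<omega> ^ u))) =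
    1 / (1 - t\<^sup>2)\<^sup>2 * (1 / t) ^ (card W - 2) * complex_of_real (1 / (real (w + v) * (\<Prod>u\<in>W - {w, v}. cosine_diff \<omega> u)))"
    by (simp add: mult_ac)
qed

text \<open>After the common phase is removed the coefficient is a real sum. If all its terms have
  the sign of \<rho>, nothing cancels, and the pair \<open>w0\<close>, \<open>v0\<close> contributes
  at least one term.\<close>

lemma simple_pole_coeff_nonzero:
  assumes W: "coprime_set W" "incongruent m W"
    and ex: "w0 \<in> W" "v0 \<in> W" "w0 \<noteq> v0" "m dvd w0 + v0"
    and sign: "\<rho> \<noteq> 0" "\<And>w v \<omega>. w \<in> W \<Longrightarrow> v \<in> W \<Longrightarrow> v \<noteq> w \<Longrightarrow> \<omega> ^ w = t \<Longrightarrow> t * \<omega> ^ v = 1 \<Longrightarrow>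
       \<rho> * (\<Prod>u\<in>W - {w, v}. cosine_diff \<omega> u) > 0"
  shows "simple_pole_coeff W t \<noteq> 0"
proof -
  note D = coprime_setD[OF W(1)]
  define R where "R = (\<Sum>w\<in>W. \<Sum>\<omega> | \<omega> ^ w = t. \<Sum>v | v \<in> W \<and> v \<noteq> w \<and> t * \<omega> ^ v = 1.
      1 / (real (w + v) * (\<Prod>u\<in>W - {w, v}. cosine_diff \<omega> u)))"
  let ?T = "\<lambda>w \<omega> v. \<rho> * (1 / (real (w + v) * (\<Prod>u\<in>W - {w, v}. cosine_diff \<omega> u)))"
  have pos: "?T w \<omega> v > 0" if "w \<in> W" "\<omega> ^ w = t" "v \<in> W" "v \<noteq> w" "t * \<omega> ^ v = 1" for w \<omega> v
  proof -
    have p: "\<rho> * (\<Prod>u\<in>W - {w, v}. cosine_diff \<omega> u) > 0" using sign(2) that by blast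
    then have "\<rho> / (\<Prod>u\<in>W - {w, v}. cosine_diff \<omega> u) > 0" by (simp add: zero_less_divide_iff zero_less_mult_iff)
    moreover have "1 / real (w + v) > 0" using D(3)[OF that(1)] by simp
    ultimately have "1 / real (w + v) * (\<rho> / (\<Prod>u\<in>W - {w, v}. cosine_diff \<omega> u)) > 0" by (rule mult_pos_pos[rotated])
    then show ?thesis by simp
  qed
  \<comment> \<open>A common divisor of \<open>w0\<close> and \<open>m\<close> also divides
    \<open>v0\<close>. So \<open>w0\<close> has an inverse \<open>x\<close> modulo \<open>m\<close>,
    and \<open>t ^ x\<close> is a \<open>w0\<close>-th root of \<open>t\<close> with the required
    property.\<close>
  have "gcd w0 m = 1"
  proof -
    have "gcd w0 m dvd w0 + v0" using ex(4) dvd_trans gcd_dvd2 by blast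
    then have "gcd w0 m dvd v0" using dvd_add_right_iff gcd_dvd1 by blast
    from coprime_common_divisor_nat[OF D(4)[OF ex(1-3)] gcd_dvd1 this] show ?thesis .
  qed
  then obtain x y where xy: "w0 * x = m * y + 1" using bezout_nat[of w0 m] D(3)[OF ex(1)] by auto
  define \<omega>0 where "\<omega>0 = t ^ x"
  have tm: "t ^ m = 1" by (simp add: t_power)
  have \<omega>w: "\<omega>0 ^ w0 = t"
  proof -
    have "\<omega>0 ^ w0 = t ^ (w0 * x)" by (simp add: \<omega>0_def power_mult[symmetric] mult.commute)
    then show ?thesis by (simp add: xy power_add power_mult tm)
  qed
  have \<omega>v: "t * \<omega>0 ^ v0 = 1"
  proof -
    have "t * \<omega>0 ^ v0 = \<omega>0 ^ (w0 + v0)" by (simp add: \<omega>w power_add)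
    also have "\<dots> = t ^ (x * (w0 + v0))" by (simp add: \<omega>0_def power_mult)
    also have "\<dots> = 1" unfolding t_power using ex(4) by simp
    finally show ?thesis .
  qed
  have fin: "finite {\<omega>. \<omega> ^ w = t}" if "w \<in> W" for w using finite_power_eq[OF D(3)[OF that]] .
  have finv: "finite {v. v \<in> W \<and> v \<noteq> w \<and> t * \<omega> ^ v = 1}" for w \<omega> using D(1) by simp
  have nn1: "(\<Sum>v | v \<in> W \<and> v \<noteq> w \<and> t * \<omega> ^ v = 1. ?T w \<omega> v) \<ge> 0" if "w \<in> W" "\<omega> ^ w = t" for w \<omega>
    by (rule sum_nonneg) (use pos[OF that] in \<open>auto intro: less_imp_le\<close>)
  have nn2: "(\<Sum>\<omega> | \<omega> ^ w = t. \<Sum>v | v \<in> W \<and> v \<noteq> w \<and> t * \<omega> ^ v = 1. ?T w \<omega> v) \<ge> 0" if "w \<in> W" for w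
    by (rule sum_nonneg) (use nn1[OF that] in auto)
  have p1: "(\<Sum>v | v \<in> W \<and> v \<noteq> w0 \<and> t * \<omega>0 ^ v = 1. ?T w0 \<omega>0 v) > 0"
  proof (rule sum_pos2[OF finv, of v0])
    show "v0 \<in> {v. v \<in> W \<and> v \<noteq> w0 \<and> t * \<omega>0 ^ v = 1}" using ex \<omega>v by auto
    show "?T w0 \<omega>0 v0 > 0" by (rule pos) (use ex \<omega>v \<omega>w in auto)
    show "?T w0 \<omega>0 v \<ge> 0" if "v \<in> {v. v \<in> W \<and> v \<noteq> w0 \<and> t * \<omega>0 ^ v = 1}" for v
      using pos[OF ex(1) \<omega>w, of v] that by (auto intro: less_imp_le)
  qed
  have p2: "(\<Sum>\<omega> | \<omega> ^ w0 = t. \<Sum>v | v \<in> W \<and> v \<noteq> w0 \<and> t * \<omega> ^ v = 1. ?T w0 \<omega> v) > 0"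
    by (rule sum_pos2[OF fin[OF ex(1)], of \<omega>0]) (use p1 nn1[OF ex(1)] \<omega>w in auto)
  have "(\<Sum>w\<in>W. \<Sum>\<omega> | \<omega> ^ w = t. \<Sum>v | v \<in> W \<and> v \<noteq> w \<and> t * \<omega> ^ v = 1. ?T w \<omega> v) > 0"
    by (rule sum_pos2[OF D(1) ex(1)], rule p2, rule nn2)
  then have "\<rho> * R > 0" by (simp only: R_def sum_distrib_left)
  then have "R \<noteq> 0" by auto
  then show ?thesis
    unfolding simple_pole_coeff_real[OF W(1)] R_def[symmetric] using t_square t_nonzero by simp
qed

text \<open>Here \<open>\<omega> ^ (w + v) = 1\<close>, and \<open>w\<close> is invertible modulo
  \<open>w + v\<close>; hence \<omega> is a power of \<open>\<omega> ^ w = t\<close>, and so an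
  \<open>m\<close>-th root of unity.\<close>

lemma power_eq_1_of_pair:
  assumes "\<omega> ^ w = t" "t * \<omega> ^ v = 1" "coprime w v" "w > 0"
  shows "\<omega> ^ m = 1"
proof -
  have 1: "\<omega> ^ (w + v) = 1" using assms(1,2) by (simp add: power_add)
  have "coprime w (w + v)" using assms(3) by (simp add: coprime_iff_gcd_eq_1)
  then obtain x y where xy: "w * x = (w + v) * y + 1"
    using bezout_nat[of w "w + v"] assms(4) by (auto simp: coprime_iff_gcd_eq_1)
  have "t ^ x = \<omega> ^ (w * x)" by (simp add: assms(1)[symmetric] power_mult)
  also have "\<dots> = \<omega>" by (simp only: xy power_add[of _ "(w + v) * y"] power_mult 1 power_one power_one_right mult_1)
  finally have "\<omega> = t ^ x" ..
  then have "\<omega> ^ m = (t ^ m) ^ x" by (simp add: power_mult[symmetric] mult.commute)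
  then show ?thesis by (simp add: t_power[THEN iffD2])
qed

text \<open>No cancellation occurs if only one pair of weights contributes, or if the contributing pairs
  are complementary in a set of four weights: then the last two cosine differences agree.\<close>

lemma simple_pole_coeff_nonzero_pairs:
  assumes W: "coprime_set W" "incongruent m W"
    and ex: "w0 \<in> W" "v0 \<in> W" "w0 \<noteq> v0" "m dvd w0 + v0"
    and pairs: "(\<forall>w\<in>W. \<forall>v\<in>W. w \<noteq> v \<and> m dvd w + v \<longrightarrow> {w, v} = {w0, v0}) \<or>
      (\<forall>w\<in>W. \<forall>v\<in>W. w \<noteq> v \<and> m dvd w + v \<longrightarrow> (\<exists>x y. x \<noteq> y \<and> W - {w, v} = {x, y} \<and> m dvd x + y))"
  shows "simple_pole_coeff W t \<noteq> 0"
  using pairs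
proof
  note D = coprime_setD[OF W(1)]
  assume single: "\<forall>w\<in>W. \<forall>v\<in>W. w \<noteq> v \<and> m dvd w + v \<longrightarrow> {w, v} = {w0, v0}"
  show ?thesis
  proof (cases "\<exists>\<omega>. \<omega> ^ w0 = t \<and> t * \<omega> ^ v0 = 1")
    case True
    then obtain \<omega>0 where \<omega>0: "\<omega>0 ^ w0 = t" "t * \<omega>0 ^ v0 = 1" by blast
    let ?\<rho> = "\<Prod>u\<in>W - {w0, v0}. cosine_diff \<omega>0 u"
    have \<rho>: "?\<rho> \<noteq> 0"
      using cosine_diff_nonzero[OF W(2) \<omega>0 ex(1,2) _ D(3)[OF ex(1)]] D(1) by (simp add: prod_zero_iff)
    \<comment> \<open>The quotient of two solutions is a root of unity for the coprime orders
      \<open>w0\<close> and \<open>v0\<close>.\<close>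
    have uniq: "\<omega> = \<omega>0" if "\<omega> ^ w0 = t" "t * \<omega> ^ v0 = 1" for \<omega>
    proof -
      have nz: "\<omega>0 \<noteq> 0" using norm_root[OF \<omega>0(1) D(3)[OF ex(1)]] by auto
      have "t * \<omega> ^ v0 = t * \<omega>0 ^ v0" using that(2) \<omega>0(2) by simp
      then have "\<omega> ^ v0 = \<omega>0 ^ v0" using t_nonzero by simp
      then have "(\<omega> / \<omega>0) ^ w0 = 1" "(\<omega> / \<omega>0) ^ v0 = 1"
        using that(1) \<omega>0(1) nz t_nonzero by (simp_all add: power_divide)
      then have "\<omega> / \<omega>0 = 1" using root_of_unity_coprime D(4)[OF ex(1-3)] D(3)[OF ex(1)] by blast
      then show ?thesis using nz by simp
    qed
    show ?thesis
    proof (rule simple_pole_coeff_nonzero[OF W ex \<rho>])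
      fix w v \<omega> assume w: "w \<in> W" "v \<in> W" "v \<noteq> w" "\<omega> ^ w = t" "t * \<omega> ^ v = 1"
      have wv: "{w, v} = {w0, v0}" using single w root_inverse_imp_dvd[OF w(4,5)] by metis
      have "cosine_diff \<omega> u = cosine_diff \<omega>0 u" for u
      proof (cases "w = w0")
        case True
        then have "v = v0" using wv w(3) by (auto simp: doubleton_eq_iff)
        then show ?thesis using uniq w True by simp
      next
        case False
        \<comment> \<open>In the opposite order it is \<open>inverse \<omega>\<close> that solves
          the original equations. It is the conjugate of \<omega>, and \<open>cosine_diff\<close>
          sees only real parts, so the product of cosine differences is the same.\<close>
        then have wv': "w = v0" "v = w0" using wv by (auto simp: doubleton_eq_iff)
        have n: "norm \<omega> = 1" using norm_root[OF w(4) D(3)[OF w(1)]] .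
        then have nz: "\<omega> \<noteq> 0" by auto
        have "inverse \<omega> ^ w0 = t" "t * inverse \<omega> ^ v0 = 1"
          using w(4,5) nz t_nonzero by (auto simp: wv' power_inverse field_simps)
        then have "inverse \<omega> = \<omega>0" by (rule uniq)
        moreover have "inverse \<omega> = cnj \<omega>" by (rule inverse_unique[OF unit_mult_cnj[OF n]])
        ultimately have "\<omega>0 ^ u = cnj (\<omega> ^ u)" by simp
        from Re_eq_of_cnj[OF this] show ?thesis by (simp add: cosine_diff_def)
      qed
      then have "?\<rho> * (\<Prod>u\<in>W - {w, v}. cosine_diff \<omega> u) = ?\<rho> * ?\<rho>" using wv by simp
      then show "?\<rho> * (\<Prod>u\<in>W - {w, v}. cosine_diff \<omega> u) > 0" using \<rho> by (auto simp: zero_less_mult_iff linorder_neq_iff)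
    qed
  next
    \<comment> \<open>No root exists for the pair, and inversion shows that none exists in the
      opposite order; the sign condition is vacuous.\<close>
    case False
    show ?thesis
    proof (rule simple_pole_coeff_nonzero[OF W ex])
      fix w v \<omega> assume w: "w \<in> W" "v \<in> W" "v \<noteq> w" "\<omega> ^ w = t" "t * \<omega> ^ v = 1"
      have wv: "{w, v} = {w0, v0}" using single w root_inverse_imp_dvd[OF w(4,5)] by metis
      have nz: "\<omega> \<noteq> 0" using norm_root[OF w(4) D(3)[OF w(1)]] by auto
      have "inverse \<omega> ^ v = t" "t * inverse \<omega> ^ w = 1"
        using w(4,5) nz t_nonzero by (auto simp: power_inverse field_simps)
      with w False wv have False by (metis doubleton_eq_iff)
      then show "1 * (\<Prod>u\<in>W - {w, v}. cosine_diff \<omega> u) > 0" ..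
    qed simp
  qed
next
  note D = coprime_setD[OF W(1)]
  assume compl: "\<forall>w\<in>W. \<forall>v\<in>W. w \<noteq> v \<and> m dvd w + v \<longrightarrow> (\<exists>x y. x \<noteq> y \<and> W - {w, v} = {x, y} \<and> m dvd x + y)"
  show ?thesis
  proof (rule simple_pole_coeff_nonzero[OF W ex])
    fix w v \<omega> assume w: "w \<in> W" "v \<in> W" "v \<noteq> w" "\<omega> ^ w = t" "t * \<omega> ^ v = 1"
    obtain x y where xy: "x \<noteq> y" "W - {w, v} = {x, y}" "m dvd x + y"
      using compl w root_inverse_imp_dvd[OF w(4,5)] by metis
    have n: "norm \<omega> = 1" using norm_root[OF w(4) D(3)[OF w(1)]] .
    have "\<omega> ^ m = 1" using power_eq_1_of_pair[OF w(4,5) D(4)] w D(3) by auto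
    then have "\<omega> ^ (x + y) = 1" using xy(3) by (metis dvdE power_mult power_one)
    then have "\<omega> ^ x * \<omega> ^ y = 1" by (simp add: power_add)
    moreover have "\<omega> ^ x * cnj (\<omega> ^ x) = 1"
      using n by (intro unit_mult_cnj) (simp add: norm_power)
    ultimately have "\<omega> ^ y = cnj (\<omega> ^ x)" by (metis mult_left_cancel mult_zero_left zero_neq_one)
    from Re_eq_of_cnj[OF this] have "cosine_diff \<omega> y = cosine_diff \<omega> x" by (simp add: cosine_diff_def)
    moreover have "cosine_diff \<omega> x \<noteq> 0"
      by (rule cosine_diff_nonzero[OF W(2) w(4,5,1,2) _ D(3)[OF w(1)]]) (use xy(2) in auto)
    ultimately show "1 * (\<Prod>u\<in>W - {w, v}. cosine_diff \<omega> u) > 0"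
      using xy(1) by (auto simp: xy(2) zero_less_mult_iff linorder_neq_iff)
  qed simp
qed

end

text \<open>The generating function of \<open>W'\<close> has a simple pole at the primitive \<open>m\<close>-th roots of unity, that of
  \<open>W\<close> stays bounded there.\<close>

lemma audible_sum:
  assumes m: "m \<ge> 3" and W: "coprime_set W" "incongruent m W" "\<And>w v. w \<in> W \<Longrightarrow> v \<in> W \<Longrightarrow> w \<noteq> v \<Longrightarrow> \<not> m dvd w + v"
    and W': "coprime_set W'" "incongruent m W'"
    and ex: "w0 \<in> W'" "v0 \<in> W'" "w0 \<noteq> v0" "m dvd w0 + v0"
    and pairs: "(\<forall>w\<in>W'. \<forall>v\<in>W'. w \<noteq> v \<and> m dvd w + v \<longrightarrow> {w, v} = {w0, v0}) \<or>
      (\<forall>w\<in>W'. \<forall>v\<in>W'. w \<noteq> v \<and> m dvd w + v \<longrightarrow> (\<exists>x y. x \<noteq> y \<and> W' - {w, v} = {x, y} \<and> m dvd x + y))"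
    and eq: "\<And>s. s \<noteq> 0 \<Longrightarrow> norm s < 1 \<Longrightarrow> residue_sum W s = residue_sum W' s"
  shows False
proof -
  have "simple_pole_coeff W (cis (2 * pi / m)) = simple_pole_coeff W' (cis (2 * pi / m))"
    by (rule simple_pole_coeff_eqI[OF m W(1,2) W' eq])
  then show False
    using simple_pole_coeff_zero[OF m W(3)] simple_pole_coeff_nonzero_pairs[OF m W' ex pairs] by simp
qed

section \<open>The leading coefficient at one\<close>

text \<open>The second elementary symmetric polynomial. It arises as the alternant with exponents 3,
  2, 0 divided by the Vandermonde product, that is, as a Schur polynomial.\<close>

definition lead_num3 :: "real \<Rightarrow> real \<Rightarrow> real \<Rightarrow> real" where
  "lead_num3 a b c = a * b + a * c + b * c"

text \<open>In elementary symmetric polynomials this is \<open>e2 * e3 - e1 * e4\<close>, the Schur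
  polynomial given by the alternant with exponents 5, 4, 2, 0.\<close>

definition lead_num4 :: "real \<Rightarrow> real \<Rightarrow> real \<Rightarrow> real \<Rightarrow> real" where
  "lead_num4 a b c e =
    (a * b + a * c + a * e + b * c + b * e + c * e) * (a * b * c + a * b * e + a * c * e + b * c * e)
    - (a + b + c + e) * (a * b * c * e)"

lemma leading_factor:
  fixes w v :: real
  assumes "w > 0" shows "1 / ((1 + v / w) * (1 - v / w)) = w\<^sup>2 / (w\<^sup>2 - v\<^sup>2)"
proof -
  have "(1 + v / w) * (1 - v / w) = (w\<^sup>2 - v\<^sup>2) / w\<^sup>2"
    using assms by (simp add: field_simps power2_eq_square)
  then show ?thesis by simp
qed

lemma frac_eqI: "y \<noteq> 0 \<Longrightarrow> z \<noteq> 0 \<Longrightarrow> x * z = w * y \<Longrightarrow> x / y = w / (z :: 'a::field)"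
  by (simp add: frac_eq_eq)

lemma common_denominator3:
  fixes p q r :: real
  assumes "p - q \<noteq> 0" "p - r \<noteq> 0" "q - r \<noteq> 0"
  shows "x / ((p - q) * (p - r)) + y / ((q - p) * (q - r)) + z / ((r - p) * (r - q)) =
    (x * (q - r) - y * (p - r) + z * (p - q)) / ((p - q) * (p - r) * (q - r))"
proof -
  have n: "q - p \<noteq> 0" "r - p \<noteq> 0" "r - q \<noteq> 0" using assms by auto
  have 1: "x / ((p - q) * (p - r)) = (x * (q - r)) / ((p - q) * (p - r) * (q - r))"
    by (rule frac_eqI) (simp_all only: mult_eq_0_iff assms n simp_thms, algebra)
  have 2: "y / ((q - p) * (q - r)) = (- (y * (p - r))) / ((p - q) * (p - r) * (q - r))"
    by (rule frac_eqI) (simp_all only: mult_eq_0_iff assms n simp_thms, algebra)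
  have 3: "z / ((r - p) * (r - q)) = (z * (p - q)) / ((p - q) * (p - r) * (q - r))"
    by (rule frac_eqI) (simp_all only: mult_eq_0_iff assms n simp_thms, algebra)
  show ?thesis unfolding 1 2 3 by (simp only: add_divide_distrib[symmetric] add_uminus_conv_diff)
qed

lemma common_denominator4:
  fixes p q r s :: real
  assumes "p - q \<noteq> 0" "p - r \<noteq> 0" "q - r \<noteq> 0" "p - s \<noteq> 0" "q - s \<noteq> 0" "r - s \<noteq> 0"
  shows "x / ((p - q) * (p - r) * (p - s)) + y / ((q - p) * (q - r) * (q - s)) + z / ((r - p) * (r - q) * (r - s))
      + w / ((s - p) * (s - q) * (s - r)) =
    (x * ((q - r) * (q - s) * (r - s)) - y * ((p - r) * (p - s) * (r - s)) + z * ((p - q) * (p - s) * (q - s))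
      - w * ((p - q) * (p - r) * (q - r))) / ((p - q) * (p - r) * (q - r) * (p - s) * (q - s) * (r - s))"
proof -
  let ?D = "(p - q) * (p - r) * (q - r) * (p - s) * (q - s) * (r - s)"
  have n: "q - p \<noteq> 0" "r - p \<noteq> 0" "r - q \<noteq> 0" "s - p \<noteq> 0" "s - q \<noteq> 0" "s - r \<noteq> 0" using assms by auto
  have 1: "x / ((p - q) * (p - r) * (p - s)) = (x * ((q - r) * (q - s) * (r - s))) / ?D"
    by (rule frac_eqI) (simp_all only: mult_eq_0_iff assms n simp_thms, algebra)
  have 2: "y / ((q - p) * (q - r) * (q - s)) = (- (y * ((p - r) * (p - s) * (r - s)))) / ?D"
    by (rule frac_eqI) (simp_all only: mult_eq_0_iff assms n simp_thms, algebra)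
  have 3: "z / ((r - p) * (r - q) * (r - s)) = (z * ((p - q) * (p - s) * (q - s))) / ?D"
    by (rule frac_eqI) (simp_all only: mult_eq_0_iff assms n simp_thms, algebra)
  have 4: "w / ((s - p) * (s - q) * (s - r)) = (- (w * ((p - q) * (p - r) * (q - r)))) / ?D"
    by (rule frac_eqI) (simp_all only: mult_eq_0_iff assms n simp_thms, algebra)
  show ?thesis unfolding 1 2 3 4 by (simp only: add_divide_distrib[symmetric] add_uminus_conv_diff)
qed

text \<open>Over the common denominator, the Vandermonde product of the squares, the numerator is
  alternating. Hence the Vandermonde product \<open>Q\<close> of the numbers themselves cancels, and
  only pairwise sums remain below.\<close>

lemma partial_fractions3:
  fixes a b c :: real
  assumes "0 < a" "a < b" "b < c"
  shows "a ^ 3 / ((a\<^sup>2 - b\<^sup>2) * (a\<^sup>2 - c\<^sup>2)) + b ^ 3 / ((b\<^sup>2 - a\<^sup>2) * (b\<^sup>2 - c\<^sup>2)) + c ^ 3 / ((c\<^sup>2 - a\<^sup>2) * (c\<^sup>2 - b\<^sup>2))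
    = lead_num3 a b c / ((a + b) * (a + c) * (b + c))"
proof -
  define P where "P = (a + b) * (a + c) * (b + c)"
  define Q where "Q = (a - b) * (a - c) * (b - c)"
  have Q0: "Q \<noteq> 0" using assms by (auto simp: Q_def)
  have sq: "a\<^sup>2 - b\<^sup>2 \<noteq> 0" "a\<^sup>2 - c\<^sup>2 \<noteq> 0" "b\<^sup>2 - c\<^sup>2 \<noteq> 0"
    using assms power_strict_mono[of a b 2] power_strict_mono[of b c 2] power_strict_mono[of a c 2] by auto
  have num: "a ^ 3 * (b\<^sup>2 - c\<^sup>2) - b ^ 3 * (a\<^sup>2 - c\<^sup>2) + c ^ 3 * (a\<^sup>2 - b\<^sup>2) = lead_num3 a b c * Q"
    unfolding lead_num3_def Q_def by algebra
  have den: "(a\<^sup>2 - b\<^sup>2) * (a\<^sup>2 - c\<^sup>2) * (b\<^sup>2 - c\<^sup>2) = P * Q"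
    unfolding P_def Q_def by algebra
  show ?thesis
    unfolding common_denominator3[OF sq] num den using Q0 by (simp add: P_def)
qed

lemma partial_fractions4:
  fixes a b c e :: real
  assumes "0 < a" "a < b" "b < c" "c < e"
  shows "a ^ 5 / ((a\<^sup>2 - b\<^sup>2) * (a\<^sup>2 - c\<^sup>2) * (a\<^sup>2 - e\<^sup>2)) + b ^ 5 / ((b\<^sup>2 - a\<^sup>2) * (b\<^sup>2 - c\<^sup>2) * (b\<^sup>2 - e\<^sup>2))
    + c ^ 5 / ((c\<^sup>2 - a\<^sup>2) * (c\<^sup>2 - b\<^sup>2) * (c\<^sup>2 - e\<^sup>2)) + e ^ 5 / ((e\<^sup>2 - a\<^sup>2) * (e\<^sup>2 - b\<^sup>2) * (e\<^sup>2 - c\<^sup>2))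
    = lead_num4 a b c e / ((a + b) * (a + c) * (a + e) * (b + c) * (b + e) * (c + e))"
proof -
  define P where "P = (a + b) * (a + c) * (a + e) * (b + c) * (b + e) * (c + e)"
  define Q where "Q = (a - b) * (a - c) * (a - e) * (b - c) * (b - e) * (c - e)"
  have Q0: "Q \<noteq> 0" using assms by (auto simp: Q_def)
  have sq: "a\<^sup>2 - b\<^sup>2 \<noteq> 0" "a\<^sup>2 - c\<^sup>2 \<noteq> 0" "b\<^sup>2 - c\<^sup>2 \<noteq> 0" "a\<^sup>2 - e\<^sup>2 \<noteq> 0" "b\<^sup>2 - e\<^sup>2 \<noteq> 0" "c\<^sup>2 - e\<^sup>2 \<noteq> 0"
    using assms power_strict_mono[of a b 2] power_strict_mono[of b c 2] power_strict_mono[of a c 2]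
      power_strict_mono[of a e 2] power_strict_mono[of b e 2] power_strict_mono[of c e 2] by auto
  have num: "a ^ 5 * ((b\<^sup>2 - c\<^sup>2) * (b\<^sup>2 - e\<^sup>2) * (c\<^sup>2 - e\<^sup>2)) - b ^ 5 * ((a\<^sup>2 - c\<^sup>2) * (a\<^sup>2 - e\<^sup>2) * (c\<^sup>2 - e\<^sup>2))
     + c ^ 5 * ((a\<^sup>2 - b\<^sup>2) * (a\<^sup>2 - e\<^sup>2) * (b\<^sup>2 - e\<^sup>2)) - e ^ 5 * ((a\<^sup>2 - b\<^sup>2) * (a\<^sup>2 - c\<^sup>2) * (b\<^sup>2 - c\<^sup>2)) = lead_num4 a b c e * Q"
    unfolding lead_num4_def Q_def by algebra
  have den: "(a\<^sup>2 - b\<^sup>2) * (a\<^sup>2 - c\<^sup>2) * (b\<^sup>2 - c\<^sup>2) * (a\<^sup>2 - e\<^sup>2) * (b\<^sup>2 - e\<^sup>2) * (c\<^sup>2 - e\<^sup>2) = P * Q"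
  proof -
    have f: "x\<^sup>2 - y\<^sup>2 = (x + y) * (x - y)" for x y :: real by algebra
    show ?thesis unfolding f P_def Q_def by (simp only: mult_ac)
  qed
  show ?thesis
    unfolding common_denominator4[OF sq] num den using Q0 by (simp add: P_def)
qed

lemma leading_coeff_at_1_3:
  fixes a b c :: nat
  assumes "0 < a" "a < b" "b < c"
  shows "2 * leading_coeff_at_1 {a, b, c} = lead_num3 a b c / ((real a + b) * (real a + c) * (real b + c))"
proof -
  have d: "{a, b, c} - {a} = {b, c}" "{a, b, c} - {b} = {a, c}" "{a, b, c} - {c} = {a, b}" "a \<noteq> b" "a \<noteq> c" "b \<noteq> c"
    using assms by auto
  have pos: "real a > 0" "real b > 0" "real c > 0" using assms by auto
  have t: "1 / w * (w\<^sup>2 / u * (w\<^sup>2 / v)) = w ^ 3 / (u * v)" if "w > 0" for w u v :: real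
    using that by (simp add: field_simps power2_eq_square power3_eq_cube)
  have "2 * leading_coeff_at_1 {a, b, c} = (\<Sum>w\<in>{a, b, c}. 1 / w * (\<Prod>v\<in>{a, b, c} - {w}. 1 / ((1 + v / w) * (1 - v / w))))"
    by (simp add: leading_coeff_at_1_def sum_distrib_left mult.assoc[symmetric])
  also have "\<dots> = real a ^ 3 / ((real a ^ 2 - real b ^ 2) * (real a ^ 2 - real c ^ 2)) + real b ^ 3 / ((real b ^ 2 - real a ^ 2) * (real b ^ 2 - real c ^ 2))
      + real c ^ 3 / ((real c ^ 2 - real a ^ 2) * (real c ^ 2 - real b ^ 2))"
    using d(4-6) by (simp only: sum.insert finite.intros sum.empty insert_iff empty_iff simp_thms d prod.insert prod.empty mult_1_right
      leading_factor[OF pos(1)] leading_factor[OF pos(2)] leading_factor[OF pos(3)] t[OF pos(1)] t[OF pos(2)] t[OF pos(3)] add_0_right add.assoc)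
  also have "\<dots> = lead_num3 a b c / ((real a + b) * (real a + c) * (real b + c))"
    by (rule partial_fractions3) (use assms in auto)
  finally show ?thesis .
qed

lemma leading_coeff_at_1_4:
  fixes a b c e :: nat
  assumes "0 < a" "a < b" "b < c" "c < e"
  shows "2 * leading_coeff_at_1 {a, b, c, e} = lead_num4 a b c e /
    ((real a + b) * (real a + c) * (real a + e) * (real b + c) * (real b + e) * (real c + e))"
proof -
  have d: "{a, b, c, e} - {a} = {b, c, e}" "{a, b, c, e} - {b} = {a, c, e}" "{a, b, c, e} - {c} = {a, b, e}" "{a, b, c, e} - {e} = {a, b, c}"
    "a \<noteq> b" "a \<noteq> c" "b \<noteq> c" "a \<noteq> e" "b \<noteq> e" "c \<noteq> e"
    using assms by auto
  have pos: "real a > 0" "real b > 0" "real c > 0" "real e > 0" using assms by auto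
  have t: "1 / w * (w\<^sup>2 / u * (w\<^sup>2 / v * (w\<^sup>2 / q))) = w ^ 5 / (u * v * q)" if "w > 0" for w u v q :: real
    using that by (simp add: field_simps power2_eq_square eval_nat_numeral)
  have "2 * leading_coeff_at_1 {a, b, c, e} = (\<Sum>w\<in>{a, b, c, e}. 1 / w * (\<Prod>v\<in>{a, b, c, e} - {w}. 1 / ((1 + v / w) * (1 - v / w))))"
    by (simp add: leading_coeff_at_1_def sum_distrib_left mult.assoc[symmetric])
  also have "\<dots> = real a ^ 5 / ((real a ^ 2 - real b ^ 2) * (real a ^ 2 - real c ^ 2) * (real a ^ 2 - real e ^ 2))
      + real b ^ 5 / ((real b ^ 2 - real a ^ 2) * (real b ^ 2 - real c ^ 2) * (real b ^ 2 - real e ^ 2))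
      + real c ^ 5 / ((real c ^ 2 - real a ^ 2) * (real c ^ 2 - real b ^ 2) * (real c ^ 2 - real e ^ 2))
      + real e ^ 5 / ((real e ^ 2 - real a ^ 2) * (real e ^ 2 - real b ^ 2) * (real e ^ 2 - real c ^ 2))"
    using d(5-10) by (simp only: sum.insert finite.intros sum.empty insert_iff empty_iff simp_thms d prod.insert prod.empty mult_1_right
      leading_factor[OF pos(1)] leading_factor[OF pos(2)] leading_factor[OF pos(3)] leading_factor[OF pos(4)]
      t[OF pos(1)] t[OF pos(2)] t[OF pos(3)] t[OF pos(4)] add_0_right add.assoc)
  also have "\<dots> = lead_num4 a b c e / ((real a + b) * (real a + c) * (real a + e) * (real b + c) * (real b + e) * (real c + e))"
    by (rule partial_fractions4) (use assms in auto)
  finally show ?thesis .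
qed

text \<open>In each of the following monotonicity lemmas the difference of the two sides is a polynomial with
  positive coefficients in the parameters.\<close>

lemma lead3_less:
  fixes a b c d :: real
  assumes "0 < a" "a \<le> b" "0 < d" "b + d \<le> c"
  shows "lead_num3 (a + d) (b + d) (c - d) * (a + b) < lead_num3 a b c * (a + b + 2 * d)"
proof -
  \<comment> \<open>The slacks of \<open>a \<le> b\<close> and \<open>b + d \<le> c\<close>; in
    these coordinates all coefficients of the difference become positive.\<close>
  define x y where "x = b - a" and "y = c - b - d"
  have b: "b = a + x" and c: "c = a + x + d + y" by (simp_all add: x_def y_def)
  have nn: "0 \<le> x" "0 \<le> y" using assms by (simp_all add: x_def y_def)
  have "lead_num3 a b c * (a + b + 2 * d) - lead_num3 (a + d) (b + d) (c - d) * (a + b) = 2 * a^2 * d + 2 * a * x * d + 2 * a * d^2 + 1 * x * d^2"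
    unfolding lead_num3_def b c by algebra
  also have "\<dots> > 0"
    using nn assms(1,3) by (intro add_pos_nonneg mult_pos_pos mult_nonneg_nonneg zero_less_power zero_le_power) auto
  finally show ?thesis by simp
qed

text \<open>Only the smallest weight moves. The sums of \<open>b\<close>, \<open>c\<close>,
  \<open>e\<close> among themselves are common to both denominators and have been cancelled.\<close>

lemma lead4_less_I:
  fixes a b c e d :: real
  assumes "0 < a" "0 < b" "0 < c" "0 < e" "0 < d"
  shows "lead_num4 (a + d) b c e * ((a + b) * (a + c) * (a + e)) < lead_num4 a b c e * ((a + d + b) * (a + d + c) * (a + d + e))"
proof -
  have "lead_num4 a b c e * ((a + d + b) * (a + d + c) * (a + d + e)) - lead_num4 (a + d) b c e * ((a + b) * (a + c) * (a + e)) =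
      1 * a^4 * b^2 * c * d + 1 * a^4 * b^2 * d * e + 1 * a^4 * b * c^2 * d + 2 * a^4 * b * c * d
      * e + 1 * a^4 * b * d * e^2 + 1 * a^4 * c^2 * d * e + 1 * a^4 * c * d * e^2 + 2 * a^3 * b^2
      * c^2 * d + 2 * a^3 * b^2 * c * d^2 + 4 * a^3 * b^2 * c * d * e + 2 * a^3 * b^2 * d^2 * e +
      2 * a^3 * b^2 * d * e^2 + 2 * a^3 * b * c^2 * d^2 + 4 * a^3 * b * c^2 * d * e + 4 * a^3 * b
      * c * d^2 * e + 4 * a^3 * b * c * d * e^2 + 2 * a^3 * b * d^2 * e^2 + 2 * a^3 * c^2 * d^2 *
      e + 2 * a^3 * c^2 * d * e^2 + 2 * a^3 * c * d^2 * e^2 + 3 * a^2 * b^2 * c^2 * d^2 + 4 * a^2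
      * b^2 * c^2 * d * e + 1 * a^2 * b^2 * c * d^3 + 6 * a^2 * b^2 * c * d^2 * e + 4 * a^2 * b^2
      * c * d * e^2 + 1 * a^2 * b^2 * d^3 * e + 3 * a^2 * b^2 * d^2 * e^2 + 1 * a^2 * b * c^2 *
      d^3 + 6 * a^2 * b * c^2 * d^2 * e + 4 * a^2 * b * c^2 * d * e^2 + 2 * a^2 * b * c * d^3 * e
      + 6 * a^2 * b * c * d^2 * e^2 + 1 * a^2 * b * d^3 * e^2 + 1 * a^2 * c^2 * d^3 * e + 3 * a^2
      * c^2 * d^2 * e^2 + 1 * a^2 * c * d^3 * e^2 + 1 * a * b^2 * c^2 * d^3 + 4 * a * b^2 * c^2 *
      d^2 * e + 2 * a * b^2 * c^2 * d * e^2 + 2 * a * b^2 * c * d^3 * e + 4 * a * b^2 * c * d^2 *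
      e^2 + 1 * a * b^2 * d^3 * e^2 + 2 * a * b * c^2 * d^3 * e + 4 * a * b * c^2 * d^2 * e^2 + 2
      * a * b * c * d^3 * e^2 + 1 * a * c^2 * d^3 * e^2 + 1 * b^2 * c^2 * d^3 * e + 1 * b^2 * c^2
      * d^2 * e^2 + 1 * b^2 * c * d^3 * e^2 + 1 * b * c^2 * d^3 * e^2"
    unfolding lead_num4_def by algebra
  also have "\<dots> > 0"
    using assms by (intro add_pos_pos mult_pos_pos zero_less_power) auto
  finally show ?thesis by simp
qed

text \<open>The shift keeps the three sums with \<open>e\<close> fixed, and these have been
  cancelled from the denominators. The last hypothesis says that the sum of the two inner weights is
  still at most that of the two outer ones after the shift.\<close>

lemma lead4_less_II:
  fixes a b c e d :: real
  assumes "0 < a" "a \<le> b" "b \<le> c" "0 < d" "b + c + 2 * d \<le> a + e"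
  shows "lead_num4 (a + d) (b + d) (c + d) (e - d) * ((a + b) * (a + c) * (b + c))
    < lead_num4 a b c e * ((a + b + 2 * d) * (a + c + 2 * d) * (b + c + 2 * d))"
proof -
  define x y z where "x = b - a" and "y = c - b" and "z = e - (b + c - a + 2 * d)"
  have b: "b = a + x" and c: "c = a + x + y" and e: "e = a + 2 * x + y + 2 * d + z"
    by (simp_all add: x_def y_def z_def)
  have nn: "0 \<le> x" "0 \<le> y" "0 \<le> z" using assms by (simp_all add: x_def y_def z_def)
  have "lead_num4 a b c e * ((a + b + 2 * d) * (a + c + 2 * d) * (b + c + 2 * d))
      - lead_num4 (a + d) (b + d) (c + d) (e - d) * ((a + b) * (a + c) * (b + c)) =
      80 * a^7 * d + 448 * a^6 * x * d + 224 * a^6 * y * d + 336 * a^6 * d^2 + 56 * a^6 * d * z +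
      1012 * a^5 * x^2 * d + 1012 * a^5 * x * y * d + 1568 * a^5 * x * d^2 + 224 * a^5 * x * d * z
      + 228 * a^5 * y^2 * d + 784 * a^5 * y * d^2 + 112 * a^5 * y * d * z + 528 * a^5 * d^3 + 168
      * a^5 * d^2 * z + 1188 * a^4 * x^3 * d + 1782 * a^4 * x^2 * y * d + 2884 * a^4 * x^2 * d^2 +
      354 * a^4 * x^2 * d * z + 794 * a^4 * x * y^2 * d + 2884 * a^4 * x * y * d^2 + 354 * a^4 * x
      * y * d * z + 1984 * a^4 * x * d^3 + 560 * a^4 * x * d^2 * z + 100 * a^4 * y^3 * d + 644 *
      a^4 * y^2 * d^2 + 74 * a^4 * y^2 * d * z + 992 * a^4 * y * d^3 + 280 * a^4 * y * d^2 * z +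
      368 * a^4 * d^4 + 168 * a^4 * d^3 * z + 776 * a^3 * x^4 * d + 1552 * a^3 * x^3 * y * d +
      2656 * a^3 * x^3 * d^2 + 280 * a^3 * x^3 * d * z + 1024 * a^3 * x^2 * y^2 * d + 3984 * a^3 *
      x^2 * y * d^2 + 420 * a^3 * x^2 * y * d * z + 2832 * a^3 * x^2 * d^3 + 708 * a^3 * x^2 * d^2
      * z + 248 * a^3 * x * y^3 * d + 1760 * a^3 * x * y^2 * d^2 + 172 * a^3 * x * y^2 * d * z +
      2832 * a^3 * x * y * d^3 + 708 * a^3 * x * y * d^2 * z + 1056 * a^3 * x * d^4 + 448 * a^3 *
      x * d^3 * z + 16 * a^3 * y^4 * d + 216 * a^3 * y^3 * d^2 + 16 * a^3 * y^3 * d * z + 624 *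
      a^3 * y^2 * d^3 + 148 * a^3 * y^2 * d^2 * z + 528 * a^3 * y * d^4 + 224 * a^3 * y * d^3 * z
      + 96 * a^3 * d^5 + 56 * a^3 * d^4 * z + 280 * a^2 * x^5 * d + 700 * a^2 * x^4 * y * d + 1280
      * a^2 * x^4 * d^2 + 116 * a^2 * x^4 * d * z + 608 * a^2 * x^3 * y^2 * d + 2560 * a^2 * x^3 *
      y * d^2 + 232 * a^2 * x^3 * y * d * z + 1904 * a^2 * x^3 * d^3 + 420 * a^2 * x^3 * d^2 * z +
      212 * a^2 * x^2 * y^3 * d + 1676 * a^2 * x^2 * y^2 * d^2 + 140 * a^2 * x^2 * y^2 * d * z +
      2856 * a^2 * x^2 * y * d^3 + 630 * a^2 * x^2 * y * d^2 * z + 1080 * a^2 * x^2 * d^4 + 424 *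
      a^2 * x^2 * d^3 * z + 24 * a^2 * x * y^4 * d + 396 * a^2 * x * y^3 * d^2 + 24 * a^2 * x *
      y^3 * d * z + 1240 * a^2 * x * y^2 * d^3 + 258 * a^2 * x * y^2 * d^2 * z + 1080 * a^2 * x *
      y * d^4 + 424 * a^2 * x * y * d^3 * z + 192 * a^2 * x * d^5 + 112 * a^2 * x * d^4 * z + 24 *
      a^2 * y^4 * d^2 + 144 * a^2 * y^3 * d^3 + 24 * a^2 * y^3 * d^2 * z + 232 * a^2 * y^2 * d^4 +
      88 * a^2 * y^2 * d^3 * z + 96 * a^2 * y * d^5 + 56 * a^2 * y * d^4 * z + 52 * a * x^6 * d +
      156 * a * x^5 * y * d + 304 * a * x^5 * d^2 + 24 * a * x^5 * d * z + 168 * a * x^4 * y^2 * d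
      + 760 * a * x^4 * y * d^2 + 60 * a * x^4 * y * d * z + 600 * a * x^4 * d^3 + 116 * a * x^4 *
      d^2 * z + 76 * a * x^3 * y^3 * d + 656 * a * x^3 * y^2 * d^2 + 48 * a * x^3 * y^2 * d * z +
      1200 * a * x^3 * y * d^3 + 232 * a * x^3 * y * d^2 * z + 464 * a * x^3 * d^4 + 168 * a * x^3
      * d^3 * z + 12 * a * x^2 * y^4 * d + 224 * a * x^2 * y^3 * d^2 + 12 * a * x^2 * y^3 * d * z
      + 768 * a * x^2 * y^2 * d^3 + 140 * a * x^2 * y^2 * d^2 * z + 696 * a * x^2 * y * d^4 + 252
      * a * x^2 * y * d^3 * z + 120 * a * x^2 * d^5 + 70 * a * x^2 * d^4 * z + 24 * a * x * y^4 *
      d^2 + 168 * a * x * y^3 * d^3 + 24 * a * x * y^3 * d^2 * z + 288 * a * x * y^2 * d^4 + 100 *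
      a * x * y^2 * d^3 * z + 120 * a * x * y * d^5 + 70 * a * x * y * d^4 * z + 8 * a * y^4 * d^3
      + 28 * a * y^3 * d^4 + 8 * a * y^3 * d^3 * z + 24 * a * y^2 * d^5 + 14 * a * y^2 * d^4 * z +
      4 * x^7 * d + 14 * x^6 * y * d + 28 * x^6 * d^2 + 2 * x^6 * d * z + 18 * x^5 * y^2 * d + 84
      * x^5 * y * d^2 + 6 * x^5 * y * d * z + 72 * x^5 * d^3 + 12 * x^5 * d^2 * z + 10 * x^4 * y^3
      * d + 90 * x^4 * y^2 * d^2 + 6 * x^4 * y^2 * d * z + 180 * x^4 * y * d^3 + 30 * x^4 * y *
      d^2 * z + 72 * x^4 * d^4 + 24 * x^4 * d^3 * z + 2 * x^3 * y^4 * d + 40 * x^3 * y^3 * d^2 + 2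
      * x^3 * y^3 * d * z + 152 * x^3 * y^2 * d^3 + 24 * x^3 * y^2 * d^2 * z + 144 * x^3 * y * d^4
      + 48 * x^3 * y * d^3 * z + 24 * x^3 * d^5 + 14 * x^3 * d^4 * z + 6 * x^2 * y^4 * d^2 + 48 *
      x^2 * y^3 * d^3 + 6 * x^2 * y^3 * d^2 * z + 86 * x^2 * y^2 * d^4 + 28 * x^2 * y^2 * d^3 * z
      + 36 * x^2 * y * d^5 + 21 * x^2 * y * d^4 * z + 4 * x * y^4 * d^3 + 14 * x * y^3 * d^4 + 4 *
      x * y^3 * d^3 * z + 12 * x * y^2 * d^5 + 7 * x * y^2 * d^4 * z"
    unfolding lead_num4_def b c e by algebra
  also have "\<dots> > 0"
    by (intro add_pos_nonneg mult_pos_pos mult_nonneg_nonneg zero_less_power zero_le_power nn assms(1,4)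
        less_imp_le[OF assms(1)] less_imp_le[OF assms(4)] zero_le_numeral zero_less_numeral zero_le_one zero_less_one)
  finally show ?thesis by simp
qed

text \<open>Complementing each weight with respect to half of the total preserves the multiset of sums.\<close>

lemma lead4_complement_le:
  fixes a b c e :: real
  assumes "0 < a" "a \<le> b" "b \<le> c" "c \<le> e" "a + e \<le> b + c"
  defines "h \<equiv> (a + b + c + e) / 2"
  shows "lead_num4 a b c e \<le> lead_num4 (h - e) (h - c) (h - b) (h - a)"
proof -
  \<comment> \<open>The slacks of \<open>c \<le> e\<close> and \<open>b \<le> c\<close>, and half of
    the excess of \<open>b + c\<close> over \<open>a + e\<close>; the smallest complemented weight
    is then \<open>a + d\<close>.\<close>
  define z d y where "z = e - c" and "d = (b + c - a - e) / 2" and "y = c - b"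
  have b: "b = a + z + 2 * d" and c: "c = a + z + 2 * d + y" and e: "e = a + 2 * z + 2 * d + y"
    by (simp_all add: z_def d_def y_def field_simps)
  have h: "h - e = a + d" "h - c = a + z + d" "h - b = a + z + d + y" "h - a = a + 2 * z + 3 * d + y"
    unfolding h_def by (simp_all add: b c e field_simps)
  have nn: "0 \<le> z" "0 \<le> d" "0 \<le> y" using assms by (simp_all add: z_def d_def y_def)
  have "lead_num4 (h - e) (h - c) (h - b) (h - a) - lead_num4 a b c e =
      4 * a^2 * z^2 * d + 8 * a^2 * z * d^2 + 4 * a^2 * z * d * y + 4 * a^2 * d^3 + 4 * a^2 * d^2
      * y + 8 * a * z^3 * d + 28 * a * z^2 * d^2 + 12 * a * z^2 * d * y + 32 * a * z * d^3 + 28 *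
      a * z * d^2 * y + 4 * a * z * d * y^2 + 12 * a * d^4 + 16 * a * d^3 * y + 4 * a * d^2 * y^2
      + 2 * z^4 * d + 12 * z^3 * d^2 + 4 * z^3 * d * y + 24 * z^2 * d^3 + 18 * z^2 * d^2 * y + 2 *
      z^2 * d * y^2 + 20 * z * d^4 + 24 * z * d^3 * y + 6 * z * d^2 * y^2 + 6 * d^5 + 10 * d^4 * y
      + 4 * d^3 * y^2"
    unfolding h lead_num4_def unfolding b c e by algebra
  also have "\<dots> \<ge> 0"
    using nn assms(1) by (intro add_nonneg_nonneg mult_nonneg_nonneg zero_le_power) auto
  finally show ?thesis by simp
qed

lemma frac_eqD: "x / y = w / z \<Longrightarrow> y \<noteq> 0 \<Longrightarrow> z \<noteq> 0 \<Longrightarrow> x * z = w * (y :: 'a::field)"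
  by (simp add: frac_eq_eq)

section \<open>From poles to sums of weights\<close>

definition isospectral_sets :: "nat set \<Rightarrow> nat set \<Rightarrow> bool" where
  "isospectral_sets W W' \<longleftrightarrow> coprime_set W \<and> coprime_set W' \<and>
    (\<forall>s. s \<noteq> 0 \<longrightarrow> norm s < 1 \<longrightarrow> residue_sum W s = residue_sum W' s)"

lemma isospectral_sets_sym: "isospectral_sets W W' \<Longrightarrow> isospectral_sets W' W"
  by (auto simp: isospectral_sets_def)

lemma dvd_imp_eq_of_less_double: "0 < s \<Longrightarrow> s < 2 * m \<Longrightarrow> m dvd s \<Longrightarrow> s = (m :: nat)"
proof (elim dvdE)
  fix k assume "0 < s" "s < 2 * m" and k: "s = m * k"
  then have "m * k < m * 2" by simp
  then have "k < 2" by (simp only: mult_less_cancel1)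
  moreover have "k \<noteq> 0" using \<open>0 < s\<close> k by auto
  ultimately have "k = 1" by linarith
  with k show "s = m" by simp
qed

text \<open>A sum below \<open>2 * m\<close> is divisible by \<open>m\<close> only if it equals
  \<open>m\<close>, and the bound on differences gives incongruence. Different pairs with sum
  \<open>m\<close> are disjoint, so two of them exhaust a set of at most four weights. These are
  exactly the two situations in which no cancellation occurs.\<close>

lemma audible_unique_sum:
  assumes iso: "isospectral_sets W W'" and card: "card W' \<le> 4" and m: "m \<ge> 3"
    and W: "\<And>w v. w \<in> W \<Longrightarrow> v \<in> W \<Longrightarrow> w \<noteq> v \<Longrightarrow> w + v < 2 * m \<and> w + v \<noteq> m \<and> v < m + w"
    and W': "\<And>w v. w \<in> W' \<Longrightarrow> v \<in> W' \<Longrightarrow> w \<noteq> v \<Longrightarrow> w + v < 2 * m \<and> v < m + w"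
    and ex: "w0 \<in> W'" "v0 \<in> W'" "w0 \<noteq> v0" "w0 + v0 = m"
  shows False
proof -
  have cop: "coprime_set W" "coprime_set W'" using iso by (auto simp: isospectral_sets_def)
  have inc: "incongruent m A" if "\<And>w v. w \<in> A \<Longrightarrow> v \<in> A \<Longrightarrow> w \<noteq> v \<Longrightarrow> v < m + w" for A
    unfolding incongruent_def
  proof (intro ballI impI notI)
    fix w v assume wv: "w \<in> A" "v \<in> A" "w < v" "m dvd v - w"
    then have "v < m + w" using that by simp
    then show False using wv(3,4) by (auto dest: dvd_imp_le)
  qed
  have eq: "m dvd w + v \<Longrightarrow> w + v = m" if "w \<in> W'" "v \<in> W'" "w \<noteq> v" for w v
    using dvd_imp_eq_of_less_double[of "w + v" m] W'[OF that] coprime_setD(3)[OF cop(2) that(1)] by simp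
  have finW: "finite W'" using coprime_setD(1)[OF cop(2)] .
  show False
  proof (rule audible_sum[OF m cop(1) _ _ cop(2) _ ex(1-3)])
    show "\<not> m dvd w + v" if "w \<in> W" "v \<in> W" "w \<noteq> v" for w v
      using dvd_imp_eq_of_less_double[of "w + v" m] W[OF that] coprime_setD(3)[OF cop(1) that(1)] by auto
    show "(\<forall>w\<in>W'. \<forall>v\<in>W'. w \<noteq> v \<and> m dvd w + v \<longrightarrow> {w, v} = {w0, v0}) \<or>
      (\<forall>w\<in>W'. \<forall>v\<in>W'. w \<noteq> v \<and> m dvd w + v \<longrightarrow> (\<exists>x y. x \<noteq> y \<and> W' - {w, v} = {x, y} \<and> m dvd x + y))"
    proof (subst disj_imp, rule impI)
      assume "\<not> (\<forall>w\<in>W'. \<forall>v\<in>W'. w \<noteq> v \<and> m dvd w + v \<longrightarrow> {w, v} = {w0, v0})"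
      then obtain w1 v1 where 1: "w1 \<in> W'" "v1 \<in> W'" "w1 \<noteq> v1" "m dvd w1 + v1" "{w1, v1} \<noteq> {w0, v0}" by blast
      have s1: "w1 + v1 = m" using eq 1 by blast
      have dist: "w1 \<noteq> w0" "w1 \<noteq> v0" "v1 \<noteq> w0" "v1 \<noteq> v0" using 1(3,5) s1 ex(4) by auto
      \<comment> \<open>Two disjoint pairs fill all of \<open>W'\<close>, so that they are
        complementary.\<close>
      have "card {w0, v0, w1, v1} = 4" using dist ex(3) 1(3) by simp
      then have all: "W' = {w0, v0, w1, v1}"
        using card_seteq[OF finW, of "{w0, v0, w1, v1}"] card ex 1 by auto
      show "\<forall>w\<in>W'. \<forall>v\<in>W'. w \<noteq> v \<and> m dvd w + v \<longrightarrow> (\<exists>x y. x \<noteq> y \<and> W' - {w, v} = {x, y} \<and> m dvd x + y)"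
      proof (intro ballI impI)
        fix w v assume w: "w \<in> W'" "v \<in> W'" "w \<noteq> v \<and> m dvd w + v"
        then have s: "w + v = m" using eq by blast
        from w(1) consider "w = w0" | "w = v0" | "w = w1" | "w = v1" unfolding all by blast
        then have "{w, v} = {w0, v0} \<or> {w, v} = {w1, v1}"
        proof cases
          case 1 then have "v = v0" using s ex(4) by linarith
          with 1 show ?thesis by simp
        next
          case 2 then have "v = w0" using s ex(4) by linarith
          with 2 show ?thesis by auto
        next
          case 3 then have "v = v1" using s s1 by linarith
          with 3 show ?thesis by simp
        next
          case 4 then have "v = w1" using s s1 by linarith
          with 4 show ?thesis by auto
        qed
        then show "\<exists>x y. x \<noteq> y \<and> W' - {w, v} = {x, y} \<and> m dvd x + y"
        proof
          assume "{w, v} = {w0, v0}"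
          then have "W' - {w, v} = W' - {w0, v0}" by (rule arg_cong)
          also have "\<dots> = {w1, v1}" using dist unfolding all by auto
          finally have "W' - {w, v} = {w1, v1}" .
          then show ?thesis using 1 by blast
        next
          assume "{w, v} = {w1, v1}"
          then have "W' - {w, v} = W' - {w1, v1}" by (rule arg_cong)
          also have "\<dots> = {w0, v0}" using dist unfolding all by auto
          finally have "W' - {w, v} = {w0, v0}" .
          then show ?thesis using ex by (metis dvd_refl)
        qed
      qed
    qed
    show "residue_sum W s = residue_sum W' s" if "s \<noteq> 0" "norm s < 1" for s
      using iso that by (auto simp: isospectral_sets_def)
    show "incongruent m W" by (rule inc) (use W in blast)
    show "incongruent m W'" by (rule inc) (use W' in blast)
    show "m dvd w0 + v0" by (simp add: ex)
  qed
qed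

section \<open>Three weights\<close>

text \<open>For ordered weights, the bounds required of all pairs follow from those for the largest
  sum and the largest difference.\<close>

lemma audible_triple:
  fixes a b c a' b' c' m :: nat
  assumes iso: "isospectral_sets {a, b, c} {a', b', c'}"
    and s: "a < b" "b < c" "a' < b'" "b' < c'" and m: "3 \<le> m"
    and W: "b + c < 2 * m" "c < m + a" "m \<notin> {a + b, a + c, b + c}"
    and W': "b' + c' < 2 * m" "c' < m + a'" "m \<in> {a' + b', a' + c', b' + c'}"
  shows False
proof -
  have pairs: "w + v \<in> {x + y, x + z, y + z}" if "w \<in> {x, y, z}" "v \<in> {x, y, z}" "w \<noteq> v" for w v x y z :: nat
    using that by (auto simp: add.commute)
  have sums: "t \<le> y + z" if "t \<in> {x + y, x + z, y + z}" "x < y" "y < z" for t x y z :: nat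
    using that by auto
  have range: "x \<le> w \<and> w \<le> z" if "w \<in> {x, y, z}" "x < y" "y < z" for w x y z :: nat
    using that by auto
  from W'(3) consider "m = a' + b'" | "m = a' + c'" | "m = b' + c'" by auto
  then have "\<exists>w0\<in>{a', b', c'}. \<exists>v0\<in>{a', b', c'}. w0 \<noteq> v0 \<and> w0 + v0 = m"
  proof cases
    case 1 then show ?thesis using s(3,4) by (intro bexI[of _ a'] bexI[of _ b']) auto
  next
    case 2 then show ?thesis using s(3,4) by (intro bexI[of _ a'] bexI[of _ c']) auto
  next
    case 3 then show ?thesis using s(3,4) by (intro bexI[of _ b'] bexI[of _ c']) auto
  qed
  then obtain w0 v0 where ex: "w0 \<in> {a', b', c'}" "v0 \<in> {a', b', c'}" "w0 \<noteq> v0" "w0 + v0 = m" by blast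
  show False
  proof (rule audible_unique_sum[OF iso _ m _ _ ex])
    show "card {a', b', c'} \<le> 4" by (simp add: card_insert_if)
    show "w + v < 2 * m \<and> w + v \<noteq> m \<and> v < m + w" if wv: "w \<in> {a, b, c}" "v \<in> {a, b, c}" "w \<noteq> v" for w v
    proof (intro conjI notI)
      show "w + v < 2 * m" using sums[OF pairs[OF wv] s(1,2)] W(1) by linarith
      show False if "w + v = m" using pairs[OF wv] W(3) that by simp
      show "v < m + w" using range[OF wv(1) s(1,2)] range[OF wv(2) s(1,2)] W(2) by linarith
    qed
    show "w + v < 2 * m \<and> v < m + w" if wv: "w \<in> {a', b', c'}" "v \<in> {a', b', c'}" "w \<noteq> v" for w v
      using sums[OF pairs[OF wv] s(3,4)] range[OF wv(1) s(3,4)] range[OF wv(2) s(3,4)] W'(1,2) by linarith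
  qed
qed

lemma audible3_first:
  fixes a b c a' b' c' :: nat
  assumes iso: "isospectral_sets {a, b, c} {a', b', c'}"
    and s: "a < b" "b < c" "a' < b'" "b' < c'" and p: "1 < a" "1 < a'"
  shows "b' + c' \<le> b + c"
proof (rule ccontr)
  assume n: "\<not> b' + c' \<le> b + c"
  show False
    by (rule audible_triple[OF iso s, of "b' + c'"]) (use s n p in auto)
qed

text \<open>The size condition survives at \<open>m = a' + c'\<close>, because
  \<open>b' < c'\<close> gives \<open>b' + c' < 2 * m\<close>; the known equality of the largest
  sums transfers it to the other system.\<close>

lemma audible3_second:
  fixes a b c a' b' c' :: nat
  assumes iso: "isospectral_sets {a, b, c} {a', b', c'}"
    and s: "a < b" "b < c" "a' < b'" "b' < c'" and p: "1 < a" "1 < a'" and eq: "b + c = b' + c'"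
  shows "a' + c' \<le> a + c"
proof (rule ccontr)
  assume n: "\<not> a' + c' \<le> a + c"
  show False
    by (rule audible_triple[OF iso s, of "a' + c'"]) (use s n p eq in auto)
qed

text \<open>Twice the smallest sum need not exceed \<open>b' + c'\<close>, so the pole argument may
  fail. With the other two sums fixed the weights can only move as \<open>a + d\<close>,
  \<open>b + d\<close>, \<open>c - d\<close>, and this strictly changes the leading coefficient at
  1.\<close>

lemma audible3_third:
  fixes a b c a' b' c' :: nat
  assumes iso: "isospectral_sets {a, b, c} {a', b', c'}"
    and s: "a < b" "b < c" "a' < b'" "b' < c'" and p: "1 < a" "1 < a'"
    and eq: "b + c = b' + c'" "a + c = a' + c'"
  shows "a' + b' \<le> a + b"
proof (rule ccontr)
  assume n: "\<not> a' + b' \<le> a + b"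
  have cop: "coprime_set {a, b, c}" "coprime_set {a', b', c'}"
    and res: "\<And>t. t \<noteq> 0 \<Longrightarrow> norm t < 1 \<Longrightarrow> residue_sum {a, b, c} t = residue_sum {a', b', c'} t"
    using iso unfolding isospectral_sets_def by blast+
  have lead: "leading_coeff_at_1 {a, b, c} = leading_coeff_at_1 {a', b', c'}"
    by (rule leading_coeff_at_1_eqI[OF cop _ _ res]) (use s in auto)
  define K where "K = (real a + c) * (real b + c)"
  have K: "K > 0" using p s by (simp add: K_def)
  define d where "d = real a' - real a"
  have d: "real a' = a + d" "real b' = b + d" "real c' = c - d" "d > 0"
  proof -
    have "real b + c = real b' + c'" "real a + c = real a' + c'" "real a + b < real a' + b'"
      using eq n by (simp_all flip: of_nat_add)
    then show "real a' = a + d" "real b' = b + d" "real c' = c - d" "d > 0"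
      unfolding d_def by linarith+
  qed
  have pos: "0 < real a" "0 < real b" using p s by auto
  have "lead_num3 a b c / ((real a + b) * K) = lead_num3 (a + d) (b + d) (c - d) / ((real a + b + 2 * d) * K)"
  proof -
    have "lead_num3 a b c / ((real a + b) * (real a + c) * (real b + c)) =
        lead_num3 a' b' c' / ((real a' + b') * (real a' + c') * (real b' + c'))"
      using lead leading_coeff_at_1_3[of a b c] leading_coeff_at_1_3[of a' b' c'] s p by simp
    then show ?thesis unfolding d K_def by (simp add: algebra_simps)
  qed
  then have "lead_num3 a b c * (real a + b + 2 * d) = lead_num3 (a + d) (b + d) (c - d) * (real a + b)"
    using K pos d(4) by (simp add: divide_eq_eq eq_divide_eq)
  moreover have "lead_num3 (a + d) (b + d) (c - d) * (real a + b) < lead_num3 a b c * (real a + b + 2 * d)"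
    by (rule lead3_less) (insert pos d s, linarith+)
  ultimately show False by simp
qed

lemma weights3_audible:
  fixes a b c a' b' c' :: nat
  assumes iso: "isospectral_sets {a, b, c} {a', b', c'}"
    and s: "a < b" "b < c" "a' < b'" "b' < c'" and p: "1 < a" "1 < a'"
  shows "a = a' \<and> b = b' \<and> c = c'"
proof -
  note iso' = isospectral_sets_sym[OF iso]
  have 1: "b + c = b' + c'"
    using audible3_first[OF iso s p] audible3_first[OF iso' s(3,4,1,2) p(2,1)] by simp
  have 2: "a + c = a' + c'"
    using audible3_second[OF iso s p 1] audible3_second[OF iso' s(3,4,1,2) p(2,1) 1[symmetric]] by simp
  have "a + b = a' + b'"
    using audible3_third[OF iso s p 1 2] audible3_third[OF iso' s(3,4,1,2) p(2,1) 1[symmetric] 2[symmetric]] by simp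
  with 1 2 show ?thesis by linarith
qed

section \<open>Four weights\<close>

lemma audible_quadruple:
  fixes a b c e a' b' c' e' m :: nat
  assumes iso: "isospectral_sets {a, b, c, e} {a', b', c', e'}"
    and s: "a < b" "b < c" "c < e" and s': "a' < b'" "b' < c'" "c' < e'" and m: "3 \<le> m"
    and W: "c + e < 2 * m" "e < m + a" "m \<notin> {a + b, a + c, a + e, b + c, b + e, c + e}"
    and W': "c' + e' < 2 * m" "e' < m + a'" "m \<in> {a' + e', b' + c', b' + e', c' + e'}"
  shows False
proof -
  have pairs: "w + v \<in> {x + y, x + z, x + u, y + z, y + u, z + u}"
    if "w \<in> {x, y, z, u}" "v \<in> {x, y, z, u}" "w \<noteq> v" for w v x y z u :: nat
    using that by (auto simp: add.commute)
  have sums: "t \<le> z + u" if "t \<in> {x + y, x + z, x + u, y + z, y + u, z + u}" "x < y" "y < z" "z < u" for t x y z u :: nat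
    using that by auto
  have range: "x \<le> w \<and> w \<le> u" if "w \<in> {x, y, z, u}" "x < y" "y < z" "z < u" for w x y z u :: nat
    using that by auto
  from W'(3) consider "m = a' + e'" | "m = b' + c'" | "m = b' + e'" | "m = c' + e'" by auto
  then have "\<exists>w0\<in>{a', b', c', e'}. \<exists>v0\<in>{a', b', c', e'}. w0 \<noteq> v0 \<and> w0 + v0 = m"
  proof cases
    case 1 then show ?thesis using s' by (intro bexI[of _ a'] bexI[of _ e']) auto
  next
    case 2 then show ?thesis using s' by (intro bexI[of _ b'] bexI[of _ c']) auto
  next
    case 3 then show ?thesis using s' by (intro bexI[of _ b'] bexI[of _ e']) auto
  next
    case 4 then show ?thesis using s' by (intro bexI[of _ c'] bexI[of _ e']) auto
  qed
  then obtain w0 v0 where ex: "w0 \<in> {a', b', c', e'}" "v0 \<in> {a', b', c', e'}" "w0 \<noteq> v0" "w0 + v0 = m" by blast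
  show False
  proof (rule audible_unique_sum[OF iso _ m _ _ ex])
    show "card {a', b', c', e'} \<le> 4" by (simp add: card_insert_if)
    show "w + v < 2 * m \<and> w + v \<noteq> m \<and> v < m + w" if wv: "w \<in> {a, b, c, e}" "v \<in> {a, b, c, e}" "w \<noteq> v" for w v
    proof (intro conjI notI)
      show "w + v < 2 * m" using sums[OF pairs[OF wv] s] W(1) by linarith
      show False if "w + v = m" using pairs[OF wv] W(3) that by simp
      show "v < m + w" using range[OF wv(1) s] range[OF wv(2) s] W(2) by linarith
    qed
    show "w + v < 2 * m \<and> v < m + w" if wv: "w \<in> {a', b', c', e'}" "v \<in> {a', b', c', e'}" "w \<noteq> v" for w v
      using sums[OF pairs[OF wv] s'] range[OF wv(1) s'] range[OF wv(2) s'] W'(1,2) by linarith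
  qed
qed

context
  fixes a b c e a' b' c' e' :: nat
  assumes iso: "isospectral_sets {a, b, c, e} {a', b', c', e'}"
    and s: "a < b" "b < c" "c < e" and s': "a' < b'" "b' < c'" "c' < e'" and p: "1 < a" "1 < a'"
begin

lemma audible4_first: "c' + e' \<le> c + e"
proof (rule ccontr)
  assume "\<not> c' + e' \<le> c + e"
  with s have lt: "c + e < c' + e'" "b + e < c' + e'" "b + c < c' + e'" "a + e < c' + e'" "a + c < c' + e'" "a + b < c' + e'"
    by linarith+
  show False
  proof (rule audible_quadruple[OF iso s s', of "c' + e'"])
    show "c' + e' \<notin> {a + b, a + c, a + e, b + c, b + e, c + e}" using lt by auto
    show "c' + e' \<in> {a' + e', b' + c', b' + e', c' + e'}" by blast
  qed (insert s s' lt p, auto)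
qed

lemma audible4_second:
  assumes eq: "c + e = c' + e'"
  shows "b' + e' \<le> b + e"
proof (rule ccontr)
  assume "\<not> b' + e' \<le> b + e"
  with s s' eq have lt: "b' + e' < c + e" "b + e < b' + e'" "b + c < b' + e'" "a + e < b' + e'" "a + c < b' + e'" "a + b < b' + e'"
    by linarith+
  show False
  proof (rule audible_quadruple[OF iso s s', of "b' + e'"])
    show "b' + e' \<notin> {a + b, a + c, a + e, b + c, b + e, c + e}" using lt by auto
    show "b' + e' \<in> {a' + e', b' + c', b' + e', c' + e'}" by blast
  qed (insert s s' lt p eq, auto)
qed

text \<open>Twice the larger middle sum is at least the total of all four weights, hence exceeds
  \<open>c' + e'\<close>, so the size condition for a pole still holds.\<close>

lemma audible4_third:
  assumes eq: "c + e = c' + e'" "b + e = b' + e'"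
  shows "max (a' + e') (b' + c') \<le> max (a + e) (b + c)"
proof (rule ccontr)
  define m where "m = max (a' + e') (b' + c')"
  assume "\<not> max (a' + e') (b' + c') \<le> max (a + e) (b + c)"
  then have "max (a + e) (b + c) < m" by (simp only: m_def not_le)
  then have ae: "a + e < m" "b + c < m" by (simp_all only: max_less_iff_conj)
  have m: "m = a' + e' \<or> m = b' + c'" "a' + e' \<le> m" "b' + c' \<le> m" by (auto simp: m_def)
  have lt: "m < b + e" "m < c + e" "a + c < m" "a + b < m" using s s' ae m eq by linarith+
  show False
  proof (rule audible_quadruple[OF iso s s', of m])
    show "m \<notin> {a + b, a + c, a + e, b + c, b + e, c + e}" using lt ae by auto
    show "m \<in> {a' + e', b' + c', b' + e', c' + e'}" using m(1) by blast
  qed (insert s s' lt ae m(2,3) p eq, auto)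
qed

lemma lead4_eq:
  "lead_num4 a b c e * ((real a' + b') * (real a' + c') * (real a' + e') * (real b' + c') * (real b' + e') * (real c' + e')) =
   lead_num4 a' b' c' e' * ((real a + b) * (real a + c) * (real a + e) * (real b + c) * (real b + e) * (real c + e))"
proof -
  have cop: "coprime_set {a, b, c, e}" "coprime_set {a', b', c', e'}"
    and res: "\<And>t. t \<noteq> 0 \<Longrightarrow> norm t < 1 \<Longrightarrow> residue_sum {a, b, c, e} t = residue_sum {a', b', c', e'} t"
    using iso unfolding isospectral_sets_def by blast+
  have "leading_coeff_at_1 {a, b, c, e} = leading_coeff_at_1 {a', b', c', e'}"
    by (rule leading_coeff_at_1_eqI[OF cop _ _ res]) (use s s' in auto)
  then have "lead_num4 a b c e / ((real a + b) * (real a + c) * (real a + e) * (real b + c) * (real b + e) * (real c + e))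
    = lead_num4 a' b' c' e' / ((real a' + b') * (real a' + c') * (real a' + e') * (real b' + c') * (real b' + e') * (real c' + e'))"
    using leading_coeff_at_1_4[of a b c e] leading_coeff_at_1_4[of a' b' c' e'] s s' p by simp
  moreover have "(real a + b) * (real a + c) * (real a + e) * (real b + c) * (real b + e) * (real c + e) \<noteq> 0"
    "(real a' + b') * (real a' + c') * (real a' + e') * (real b' + c') * (real b' + e') * (real c' + e') \<noteq> 0"
    using p s s' by auto
  ultimately show ?thesis by (rule frac_eqD)
qed

text \<open>With the two largest sums and the larger middle sum matched, one parameter is left. The
  cases record which middle sum is the larger one in each system. In case I only the smallest weight
  moves, in case II \<open>a\<close>, \<open>b\<close>, \<open>c\<close> rise while \<open>e\<close>
  falls; monotonicity of the leading coefficient excludes both.\<close>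

lemma audible4_fourth:
  assumes eq: "c + e = c' + e'" "b + e = b' + e'" "max (a + e) (b + c) = max (a' + e') (b' + c')"
  shows "min (a' + e') (b' + c') \<le> min (a + e) (b + c)"
proof (rule ccontr)
  assume n: "\<not> min (a' + e') (b' + c') \<le> min (a + e) (b + c)"
  have pos: "0 < real a" "0 < real b" "0 < real c" "0 < real e" "0 < real a'" "real a < b" "real b < c" "real c < e"
    "real a' < b'" "real b' < c'" "real c' < e'" using p s s' by auto
  consider (I) "a + e \<le> b + c" "a' + e' \<le> b' + c'" | (IV) "a + e \<le> b + c" "b' + c' < a' + e'"
    | (II) "b + c < a + e" "b' + c' \<le> a' + e'" | (III) "b + c < a + e" "a' + e' < b' + c'" by linarith
  then show False
  proof cases
    case I
    then have same: "b' = b" "c' = c" "e' = e" "a < a'" using eq n by auto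
    define d where "d = real a' - real a"
    have d: "real a' = a + d" "d > 0" using same by (auto simp: d_def)
    define K where "K = (real b + c) * (real b + e) * (real c + e)"
    have K: "K > 0" using pos by (simp add: K_def)
    have "lead_num4 (a + d) b c e * ((real a + b) * (real a + c) * (real a + e)) < lead_num4 a b c e * ((a + d + b) * (a + d + c) * (a + d + e))"
      by (rule lead4_less_I) (use pos d in auto)
    note less = mult_strict_right_mono[OF this K]
    have "lead_num4 a b c e * ((a + d + b) * (a + d + c) * (a + d + e)) * K = lead_num4 (a + d) b c e * ((real a + b) * (real a + c) * (real a + e)) * K"
      using lead4_eq unfolding same d K_def by (simp only: mult_ac)
    with less show False by simp
  next
    \<comment> \<open>The smaller middle sum \<open>m = b' + c'\<close> can be heard by its pole
      here: it exceeds \<open>a + e\<close>, and \<open>c < e\<close> gives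
      \<open>c + e < 2 * (a + e) < 2 * m\<close>.\<close>
    case IV
    have lt: "b + c = a' + e'" "a + e < b' + c'" using IV n eq(3) by auto
    have ne: "b' + c' < b + c" "b' + c' < b + e" "b' + c' < c + e" "a + c < b' + c'" "a + b < b' + c'"
      using s s' lt IV eq by linarith+
    show False
    proof (rule audible_quadruple[OF iso s s', of "b' + c'"])
      show "b' + c' \<notin> {a + b, a + c, a + e, b + c, b + e, c + e}" using lt ne by auto
      show "b' + c' \<in> {a' + e', b' + c', b' + e', c' + e'}" by blast
    qed (insert s s' lt ne IV p eq(1,2), auto)
  next
    case II
    define d where "d = real e - real e'"
    have eqs: "real a + e = real a' + e'" "real b + e = real b' + e'" "real c + e = real c' + e'"
      using eq II by (simp_all add: max_def flip: of_nat_add)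
    have "b + c < b' + c'" using n II by (simp add: min_def split: if_splits)
    then have lt: "real b + c < real b' + c'" "real b' + c' \<le> real a' + e'"
      using II by (simp_all flip: of_nat_add)
    have d: "real a' = a + d" "real b' = b + d" "real c' = c + d" "real e' = e - d"
      using eqs by (simp_all add: d_def)
    have dpos: "d > 0" "real b + c + 2 * d \<le> real a + e"
      using lt d by simp_all
    define K where "K = (real a + e) * (real b + e) * (real c + e)"
    have K: "K > 0" using pos by (simp add: K_def)
    have "lead_num4 (a + d) (b + d) (c + d) (e - d) * ((real a + b) * (real a + c) * (real b + c))
      < lead_num4 a b c e * ((real a + b + 2 * d) * (real a + c + 2 * d) * (real b + c + 2 * d))"
      by (rule lead4_less_II) (use pos dpos in auto)
    note less = mult_strict_right_mono[OF this K]
    have sums: "real a + d + (b + d) = real a + b + 2 * d" "real a + d + (c + d) = real a + c + 2 * d" "real b + d + (c + d) = real b + c + 2 * d"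
      "real a + d + (e - d) = real a + e" "real b + d + (e - d) = real b + e" "real c + d + (e - d) = real c + e" by auto
    have "lead_num4 a b c e * ((real a + b + 2 * d) * (real a + c + 2 * d) * (real b + c + 2 * d)) * K =
      lead_num4 (a + d) (b + d) (c + d) (e - d) * ((real a + b) * (real a + c) * (real b + c)) * K"
      using lead4_eq unfolding d sums K_def by (simp only: mult_ac)
    with less show False by simp
  next
    \<comment> \<open>The roles of the middle sums differ in the two systems. Complementing the
      primed weights restores agreement and leads back to the shift of case II, while
      \<open>lead4_complement_le\<close> estimates the change of the numerator in the right
      direction. The complement may be half-integral, so the comparison takes place over the
      reals.\<close>
    case III
    define h where "h = (real a' + b' + c' + e') / 2"
    define d where "d = real e - (h - a')"
    have eqs: "real a + e = real b' + c'" "real b + e = real b' + e'" "real c + e = real c' + e'"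
      using eq III by (simp_all add: max_def flip: of_nat_add)
    have "b + c < a' + e'" using n III by (simp add: min_def split: if_splits)
    then have lt: "real b + c < real a' + e'" "real a' + e' \<le> real b' + c'"
      using III by (simp_all flip: of_nat_add)
    have d: "h - e' = a + d" "h - c' = b + d" "h - b' = c + d" "h - a' = e - d"
      using eqs by (simp_all add: h_def d_def field_simps)
    have dpos: "d > 0" "real b + c + 2 * d \<le> real a + e"
      using eqs lt by (simp_all add: h_def d_def field_simps)
    have sums: "real a + b + 2 * d = real a' + b'" "real a + c + 2 * d = real a' + c'" "real b + c + 2 * d = real a' + e'"
      using eqs by (simp_all add: h_def d_def field_simps)
    define K where "K = (real b' + c') * (real b' + e') * (real c' + e')"
    have K: "K > 0" using pos by (simp add: K_def)
    have "lead_num4 a' b' c' e' \<le> lead_num4 (h - e') (h - c') (h - b') (h - a')"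
      unfolding h_def by (rule lead4_complement_le) (use pos lt in auto)
    then have "lead_num4 a' b' c' e' * ((real a + b) * (real a + c) * (real b + c)) \<le>
       lead_num4 (a + d) (b + d) (c + d) (e - d) * ((real a + b) * (real a + c) * (real b + c))"
      unfolding d using pos by (intro mult_right_mono) auto
    also have "\<dots> < lead_num4 a b c e * ((real a + b + 2 * d) * (real a + c + 2 * d) * (real b + c + 2 * d))"
      by (rule lead4_less_II) (use pos dpos in auto)
    finally have "lead_num4 a' b' c' e' * ((real a + b) * (real a + c) * (real b + c)) <
      lead_num4 a b c e * ((real a' + b') * (real a' + c') * (real a' + e'))" unfolding sums .
    note less = mult_strict_right_mono[OF this K]
    have "lead_num4 a b c e * ((real a' + b') * (real a' + c') * (real a' + e')) * K =
      lead_num4 a' b' c' e' * ((real a + b) * (real a + c) * (real b + c)) * K"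
      using lead4_eq unfolding K_def eqs by (simp only: mult_ac)
    with less show False by simp
  qed
qed

end

lemma sums4_audible:
  fixes a b c e a' b' c' e' :: nat
  assumes iso: "isospectral_sets {a, b, c, e} {a', b', c', e'}"
    and s: "a < b" "b < c" "c < e" and s': "a' < b'" "b' < c'" "c' < e'" and p: "1 < a" "1 < a'"
  shows "{#a + b, a + c, a + e, b + c, b + e, c + e#} = {#a' + b', a' + c', a' + e', b' + c', b' + e', c' + e'#}"
proof -
  note iso' = isospectral_sets_sym[OF iso]
  have 1: "c + e = c' + e'"
    by (rule antisym[OF audible4_first[OF iso' s' s p(2,1)] audible4_first[OF iso s s' p]])
  have 2: "b + e = b' + e'"
    by (rule antisym[OF audible4_second[OF iso' s' s p(2,1) 1[symmetric]] audible4_second[OF iso s s' p 1]])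
  have 3: "max (a + e) (b + c) = max (a' + e') (b' + c')"
    by (rule antisym[OF audible4_third[OF iso' s' s p(2,1) 1[symmetric] 2[symmetric]] audible4_third[OF iso s s' p 1 2]])
  have 4: "min (a + e) (b + c) = min (a' + e') (b' + c')"
    by (rule antisym[OF audible4_fourth[OF iso' s' s p(2,1) 1[symmetric] 2[symmetric] 3[symmetric]] audible4_fourth[OF iso s s' p 1 2 3]])
  have 5: "(a + e = a' + e' \<and> b + c = b' + c') \<or> (a + e = b' + c' \<and> b + c = a' + e')"
    using 3 4 by (auto simp: max_def min_def split: if_splits)
  \<comment> \<open>Complementary pairs have the same total, for instance
    \<open>(a + b) + (c + e) = (a + e) + (b + c)\<close>; so the four matched sums fix the two
    smallest.\<close>
  then have "a + b = a' + b'" "a + c = a' + c'" using 1 2 by linarith+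
  with 1 2 5 show ?thesis by (auto simp: add_mset_commute)
qed

section \<open>Multisets of pairwise sums\<close>

text \<open>This form depends on the set of weights only, whereas \<open>pairwise_sums\<close>
  refers to an indexing; it permits passing to the ordered elements.\<close>

definition pair_sums :: "nat set \<Rightarrow> nat multiset" where
  "pair_sums W = image_mset (\<lambda>P. \<Sum>P) (mset_set {P. P \<subseteq> W \<and> card P = 2})"

lemma pairwise_sums_eq_pair_sums:
  fixes N :: "'n::{finite,linorder} \<Rightarrow> nat"
  assumes "inj N"
  shows "pairwise_sums N = pair_sums (range N)"
proof -
  let ?f = "\<lambda>(i, j). {N i, N j}"
  have inj: "inj_on ?f {(i, j). i < j}"
  proof (rule inj_onI, clarify)
    fix i j k l assume ij: "i < j" "k < l" "{N i, N j} = {N k, N l}"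
    then have "(i = k \<and> j = l) \<or> (i = l \<and> j = k)"
      using assms by (auto simp: doubleton_eq_iff inj_eq)
    with ij(1,2) show "i = k \<and> j = l" by auto
  qed
  have im: "?f ` {(i, j). i < j} = {P. P \<subseteq> range N \<and> card P = 2}"
  proof (intro equalityI subsetI)
    fix P assume "P \<in> ?f ` {(i, j). i < j}"
    then show "P \<in> {P. P \<subseteq> range N \<and> card P = 2}" using assms by (auto simp: inj_eq card_insert_if)
  next
    fix P assume "P \<in> {P. P \<subseteq> range N \<and> card P = 2}"
    then obtain x y where xy: "P = {x, y}" "x \<noteq> y" "P \<subseteq> range N" by (auto simp: card_2_iff)
    then obtain i j where ij: "x = N i" "y = N j" by auto
    then consider "i < j" | "j < i" using xy(2) by (metis linorder_neqE)
    then show "P \<in> ?f ` {(i, j). i < j}"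
    proof cases
      case 1 then show ?thesis using xy ij by (intro image_eqI[of _ _ "(i, j)"]) auto
    next
      case 2 then show ?thesis using xy ij by (intro image_eqI[of _ _ "(j, i)"]) auto
    qed
  qed
  have "pair_sums (range N) = image_mset (\<lambda>P. \<Sum>P) (image_mset ?f (mset_set {(i, j). i < j}))"
    unfolding pair_sums_def im[symmetric] by (subst image_mset_mset_set[OF inj]) simp
  also have "\<dots> = image_mset (\<lambda>(i, j). N i + N j) (mset_set {(i, j). i < j})"
    unfolding multiset.map_comp
    by (rule image_mset_cong) (use assms in \<open>auto simp: inj_eq\<close>)
  finally show ?thesis by (simp add: pairwise_sums_def)
qed

lemma pair_sums_4:
  fixes a b c e :: nat
  assumes "a < b" "b < c" "c < e"
  shows "pair_sums {a, b, c, e} = {#a + b, a + c, a + e, b + c, b + e, c + e#}"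
proof -
  have "{P. P \<subseteq> {a, b, c, e} \<and> card P = 2} = {{a, b}, {a, c}, {a, e}, {b, c}, {b, e}, {c, e}}" (is "?L = ?R")
  proof (intro equalityI subsetI)
    fix P assume "P \<in> ?L"
    then obtain x y where "P = {x, y}" "x \<noteq> y" "{x, y} \<subseteq> {a, b, c, e}" by (auto simp: card_2_iff)
    then show "P \<in> ?R" by auto
  next
    fix P assume "P \<in> ?R"
    then show "P \<in> ?L" using assms by auto
  qed
  then show ?thesis using assms by (simp add: pair_sums_def doubleton_eq_iff)
qed

lemma sorted_elements_3:
  assumes "card W = 3"
  obtains a b c :: nat where "W = {a, b, c}" "a < b" "b < c"
proof -
  have fin: "finite W" using assms by (rule_tac card_ge_0_finite) simp
  define xs where "xs = sorted_list_of_set W"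
  have "length xs = 3" using assms by (simp add: xs_def)
  then obtain a b c where "xs = [a, b, c]"
    by (auto simp: numeral_eq_Suc length_Suc_conv)
  then have l: "sorted_list_of_set W = [a, b, c]" by (simp add: xs_def)
  have "W = set [a, b, c]" using set_sorted_list_of_set[OF fin] l by simp
  moreover have "a < b" "b < c" using strict_sorted_list_of_set[of W] by (simp_all add: l)
  ultimately show ?thesis using that by simp
qed

lemma sorted_elements_4:
  assumes "card W = 4"
  obtains a b c e :: nat where "W = {a, b, c, e}" "a < b" "b < c" "c < e"
proof -
  have fin: "finite W" using assms by (rule_tac card_ge_0_finite) simp
  define xs where "xs = sorted_list_of_set W"
  have "length xs = 4" using assms by (simp add: xs_def)
  then obtain a b c e where "xs = [a, b, c, e]"
    by (auto simp: numeral_eq_Suc length_Suc_conv)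
  then have l: "sorted_list_of_set W = [a, b, c, e]" by (simp add: xs_def)
  have "W = set [a, b, c, e]" using set_sorted_list_of_set[OF fin] l by simp
  moreover have "a < b" "b < c" "c < e" using strict_sorted_list_of_set[of W] by (simp_all add: l)
  ultimately show ?thesis using that by simp
qed

lemma coprime_weights_range:
  fixes N :: "'n::finite \<Rightarrow> nat"
  assumes "coprime_weights N"
  shows "inj N" "coprime_set (range N)" "card (range N) = CARD('n)"
proof -
  show inj: "inj N"
  proof (rule injI, rule ccontr)
    fix i j assume "N i = N j" "i \<noteq> j"
    then have "coprime (N i) (N i)" using assms unfolding coprime_weights_def by metis
    then have "N i = 1" by simp
    moreover have "1 < N i" using assms by (simp add: coprime_weights_def)
    ultimately show False by simp
  qed
  then show "card (range N) = CARD('n)" by (simp add: card_image)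
  show "coprime_set (range N)"
    unfolding coprime_set_def
  proof (intro conjI ballI impI)
    fix x y assume "x \<in> range N" "y \<in> range N" "x \<noteq> y"
    then show "coprime x y" using assms unfolding coprime_weights_def by (metis rangeE)
  qed (use assms in \<open>auto simp: coprime_weights_def\<close>)
qed

lemma laplace_spectrum_isospectral_sets:
  fixes N N' :: "'n::finite \<Rightarrow> nat"
  assumes N: "coprime_weights N" "coprime_weights N'" and "laplace_spectrum N = laplace_spectrum N'"
  shows "isospectral_sets (range N) (range N')"
proof -
  have pos: "N i > 0" "N' i > 0" for i
    using N unfolding coprime_weights_def by (metis gr_zeroI not_one_less_zero)+
  have "residue_sum (range N) s = residue_sum (range N') s" if "s \<noteq> 0" "norm s < 1" for s
    using residue_sum_eqI[OF coprime_weights_range(1)[OF N(1)] pos(1) coprime_weights_range(1)[OF N(2)] pos(2) _ that]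
      laplace_spectrum_determines_exponents[OF assms(3)] by blast
  then show ?thesis using coprime_weights_range(2) N by (auto simp: isospectral_sets_def)
qed

text \<open>The order of the six sums is forced except for the two middle ones. Sorting turns an
  equality of multisets into six equations.\<close>

lemma sorted_pair_sums:
  fixes a b c e :: nat
  assumes "a < b" "b < c" "c < e"
  shows "sorted_list_of_multiset {#a + b, a + c, a + e, b + c, b + e, c + e#} =
    [a + b, a + c, min (a + e) (b + c), max (a + e) (b + c), b + e, c + e]" (is "_ = ?xs")
proof -
  have "{#a + b, a + c, a + e, b + c, b + e, c + e#} = mset ?xs"
    by (auto simp: min_def max_def add_mset_commute)
  moreover have "sorted ?xs" using assms by auto
  ultimately show ?thesis by (simp only: sorted_list_of_multiset_mset sorted_sort_id)
qed

text \<open>The three largest sums determine the weights, once it is known which of the two middle sums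
  is the larger one.\<close>

lemma pair_sums_4_determine:
  fixes a b c e a' b' c' e' :: nat
  assumes s: "a < b" "b < c" "c < e" and s': "a' < b'" "b' < c'" "c' < e'"
    and M: "pair_sums {a, b, c, e} = pair_sums {a', b', c', e'}"
    and type: "a + e \<le> b + c \<longleftrightarrow> a' + e' \<le> b' + c'"
  shows "a = a' \<and> b = b' \<and> c = c' \<and> e = e'"
proof -
  have "[a + b, a + c, min (a + e) (b + c), max (a + e) (b + c), b + e, c + e] =
     [a' + b', a' + c', min (a' + e') (b' + c'), max (a' + e') (b' + c'), b' + e', c' + e']"
    using M unfolding pair_sums_4[OF s] pair_sums_4[OF s'] sorted_pair_sums[OF s, symmetric] sorted_pair_sums[OF s', symmetric]
    by simp
  then have "a + b = a' + b'" "a + c = a' + c'" "b + e = b' + e'" "c + e = c' + e'"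
    "min (a + e) (b + c) = min (a' + e') (b' + c')" "max (a + e) (b + c) = max (a' + e') (b' + c')" by simp_all
  with type show ?thesis by (auto simp: min_def max_def split: if_splits)
qed

lemma subsingleton_card_le_1:
  assumes "\<And>x y. x \<in> A \<Longrightarrow> y \<in> A \<Longrightarrow> x = y"
  shows "finite A \<and> card A \<le> 1"
proof (cases "A = {}")
  case False
  then obtain x where "A = {x}" using assms by blast
  then show ?thesis by simp
qed simp

text \<open>The sets are divided according to which middle sum is the larger one, and by
  \<open>pair_sums_4_determine\<close> each class has at most one member.\<close>

lemma pair_sums_at_most_two:
  "finite {W. card W = 4 \<and> pair_sums W = M} \<and> card {W. card W = 4 \<and> pair_sums W = M} \<le> 2"
proof -
  define S where "S \<epsilon> = {W. pair_sums W = M \<and> (\<exists>a b c e. W = {a, b, c, e} \<and> a < b \<and> b < c \<and> c < e \<and> (a + e \<le> b + c \<longleftrightarrow> \<epsilon>))}" for \<epsilon>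
  have one: "finite (S \<epsilon>) \<and> card (S \<epsilon>) \<le> 1" for \<epsilon>
  proof (rule subsingleton_card_le_1)
    fix W W' assume "W \<in> S \<epsilon>" "W' \<in> S \<epsilon>"
    then obtain a b c e a' b' c' e' where
      "W = {a, b, c, e}" "a < b" "b < c" "c < e" "a + e \<le> b + c \<longleftrightarrow> \<epsilon>" "pair_sums W = M"
      "W' = {a', b', c', e'}" "a' < b'" "b' < c'" "c' < e'" "a' + e' \<le> b' + c' \<longleftrightarrow> \<epsilon>" "pair_sums W' = M"
      unfolding S_def by blast
    then show "W = W'" using pair_sums_4_determine[of a b c e a' b' c' e'] by simp
  qed
  have sub: "{W. card W = 4 \<and> pair_sums W = M} \<subseteq> S True \<union> S False"
  proof
    fix W assume "W \<in> {W. card W = 4 \<and> pair_sums W = M}"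
    then have "card W = 4" "pair_sums W = M" by auto
    from this(1) obtain a b c e where "W = {a, b, c, e}" "a < b" "b < c" "c < e" by (rule sorted_elements_4)
    then show "W \<in> S True \<union> S False" using \<open>pair_sums W = M\<close> unfolding S_def by blast
  qed
  have "card (S True \<union> S False) \<le> 2" using one[of True] one[of False] card_Un_le[of "S True" "S False"] by linarith
  then show ?thesis using sub one by (meson card_mono finite_UnI finite_subset order_trans)
qed

theorem theorem5p2:
  shows "(\<forall>(N :: 3 \<Rightarrow> nat) (N' :: 3 \<Rightarrow> nat).
            coprime_weights N \<longrightarrow> coprime_weights N' \<longrightarrow>
            laplace_spectrum N = laplace_spectrum N' \<longrightarrow> range N = range N')
       \<and> (\<forall>(N :: 4 \<Rightarrow> nat) (N' :: 4 \<Rightarrow> nat).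
            coprime_weights N \<longrightarrow> coprime_weights N' \<longrightarrow>
            laplace_spectrum N = laplace_spectrum N' \<longrightarrow> pairwise_sums N = pairwise_sums N')
       \<and> (\<forall>M :: nat multiset.
            finite {range N | N :: 4 \<Rightarrow> nat. coprime_weights N \<and> pairwise_sums N = M} \<and>
            card {range N | N :: 4 \<Rightarrow> nat. coprime_weights N \<and> pairwise_sums N = M} \<le> 2)"
proof (intro conjI allI impI)
  fix N N' :: "3 \<Rightarrow> nat"
  assume N: "coprime_weights N" "coprime_weights N'" "laplace_spectrum N = laplace_spectrum N'"
  have card: "card (range N) = 3" "card (range N') = 3"
    using coprime_weights_range(3)[OF N(1)] coprime_weights_range(3)[OF N(2)] by simp_all
  obtain a b c where abc: "range N = {a, b, c}" "a < b" "b < c" by (rule sorted_elements_3[OF card(1)])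
  obtain a' b' c' where abc': "range N' = {a', b', c'}" "a' < b'" "b' < c'" by (rule sorted_elements_3[OF card(2)])
  have iso: "isospectral_sets {a, b, c} {a', b', c'}"
    using laplace_spectrum_isospectral_sets[OF N] abc abc' by simp
  have "1 < a" "1 < a'" using iso by (auto simp: isospectral_sets_def coprime_set_def)
  with weights3_audible[OF iso] abc abc' show "range N = range N'" by simp
next
  fix N N' :: "4 \<Rightarrow> nat"
  assume N: "coprime_weights N" "coprime_weights N'" "laplace_spectrum N = laplace_spectrum N'"
  have card: "card (range N) = 4" "card (range N') = 4"
    using coprime_weights_range(3)[OF N(1)] coprime_weights_range(3)[OF N(2)] by simp_all
  obtain a b c e where abc: "range N = {a, b, c, e}" "a < b" "b < c" "c < e" by (rule sorted_elements_4[OF card(1)])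
  obtain a' b' c' e' where abc': "range N' = {a', b', c', e'}" "a' < b'" "b' < c'" "c' < e'" by (rule sorted_elements_4[OF card(2)])
  have iso: "isospectral_sets {a, b, c, e} {a', b', c', e'}"
    using laplace_spectrum_isospectral_sets[OF N] abc abc' by simp
  have "1 < a" "1 < a'" using iso by (auto simp: isospectral_sets_def coprime_set_def)
  with sums4_audible[OF iso] abc abc' show "pairwise_sums N = pairwise_sums N'"
    using pairwise_sums_eq_pair_sums coprime_weights_range(1) N(1,2) pair_sums_4 by metis
next
  fix M :: "nat multiset"
  let ?A = "{range N | N :: 4 \<Rightarrow> nat. coprime_weights N \<and> pairwise_sums N = M}"
  have sub: "?A \<subseteq> {W. card W = 4 \<and> pair_sums W = M}"
    using coprime_weights_range(1,3) pairwise_sums_eq_pair_sums by fastforce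
  show "finite ?A" using sub pair_sums_at_most_two finite_subset by blast
  show "card ?A \<le> 2" using card_mono[OF _ sub] pair_sums_at_most_two[of M] by linarith
qed

end
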